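(* Let $L_n=\min_{u\in\mathbb{T}_n}S_u$ and $R_n=\max_{u\in\mathbb{T}_n}S_u$ be the positions of the leftmost and rightmost particles of generation $n$. Almost surely, $$\lim_{n\to\infty}\frac{L_n}{n}=\Lambda'(t_-)\qquad\text{and}\qquad\lim_{n\to\infty}\frac{R_n}{n}=\Lambda'(t_+).$$
   Context: Branching random walk in a random environment in time. Let $\xi=(\xi_n)_{n\ge 0}$ be a stationary and ergodic sequence of random variables with values in a measurable space $\Theta$; each realization of $\xi_n$ determines a probability distribution $\eta_n=\eta(\xi_n)$ on $\mathbb{N}\times\mathbb{R}\times\mathbb{R}\times\cdots$. Given $\xi$ (quenched law $\mathbb{P}_\xi$, expectation $\mathbb{E}_\xi$), let $X(u)=(N(u),L_1(u),L_2(u),\dots)$, indexed by finite sequences $u\in\{\emptyset\}\cup\bigcup_{n\ge1}\mathbb{N}^n$, be independent random vectors, $X(u)$ having law $\eta_n$ when the length $|u|$ equals $n$ (values $L_i(u)$ with $i>N(u)$ play no role in the process). The initial particle $\emptyset$ is at $S_\emptyset=0$; each particle $u$ of generation $n$, located at $S_u$, is replaced by $N(u)$ particles $ui$ of generation $n+1$ located at $S_{ui}=S_u+L_i(u)$, $1\le i\le N(u)$. Let $\mathbb{T}_n$ be the set of particles of generation $n$. The annealed law $\mathbb{P}$ (expectation $\mathbb{E}$) is $\mathbb{P}_\xi$ integrated against the law of $\xi$; "a.s." refers to $\mathbb{P}$. Write $N=N(\emptyset)$ and $m_n=\mathbb{E}_\xi N(u)$ for $|u|=n$. Standing assumptions: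 $\mathbb{E}\log m_0\in(0,\infty)$ and $\mathbb{E}\frac{N}{m_0}\log^+N<\infty$; $N\ge1$ a.s.; and, with $m_0(t)=\mathbb{E}_\xi\sum_{i=1}^{N}e^{tL_i(\emptyset)}$, $\mathbb{E}|L_1(\emptyset)|<\infty$, $\mathbb{E}|\log m_0(t)|<\infty$ and $\mathbb{E}\left|\frac{m_0'(t)}{m_0(t)}\right|<\infty$ for all $t\in\mathbb{R}$. (The displacements $L_i(u)$ should not be confused with the leftmost position $L_n$.) Notation: $\Lambda(t)=\mathbb{E}\log m_0(t)$, which is convex and differentiable with $\Lambda'(t)=\mathbb{E}\frac{m_0'(t)}{m_0(t)}$; $t_-=\inf\{t\in\mathbb{R}:t\Lambda'(t)-\Lambda(t)\le0\}$, $t_+=\sup\{t\in\mathbb{R}:t\Lambda'(t)-\Lambda(t)\le0\}$, so $-\infty\le t_-<0<t_+\le\infty$. If $t_\pm=\pm\infty$, $\Lambda'(t_\pm)$ denotes $\lim_{t\to\pm\infty}\Lambda'(t)\in[-\infty,\infty]$. *)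

theory Defs
  imports "HOL-Probability.Probability"
begin

text \<open>
  Everything is realised on the canonical space: an environment is a sequence
  \<open>e :: nat \<Rightarrow> 'th\<close>, and a realisation of the branching random walk is a family
  \<open>w :: nat list \<Rightarrow> nat \<times> (nat \<Rightarrow> real)\<close>, where \<open>w u = (N(u), (L\<^sub>1(u), L\<^sub>2(u), \<dots>))\<close>.
  Children are numbered from 0, so \<open>L\<^sub>i\<^sub>+\<^sub>1(u)\<close> is \<open>displacement w u i\<close> and the child
  \<open>u(i+1)\<close> is \<open>u @ [i]\<close>.
\<close>

definition shift :: "(nat \<Rightarrow> 'th) \<Rightarrow> nat \<Rightarrow> 'th" where
  "shift e = (\<lambda>n. e (Suc n))"

definition stationary_ergodic :: "'th measure \<Rightarrow> (nat \<Rightarrow> 'th) measure \<Rightarrow> bool" where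
  "stationary_ergodic Theta nu \<longleftrightarrow>
     prob_space nu \<and> sets nu = sets (Pi\<^sub>M UNIV (\<lambda>_. Theta)) \<and>
     distr nu nu shift = nu \<and>
     (\<forall>A\<in>sets nu. shift -` A \<inter> space nu = A \<longrightarrow> measure nu A = 0 \<or> measure nu A = 1)"

definition mark_space :: "(nat \<times> (nat \<Rightarrow> real)) measure" where
  "mark_space = count_space UNIV \<Otimes>\<^sub>M Pi\<^sub>M UNIV (\<lambda>_. borel)"

definition quenched ::
  "('th \<Rightarrow> (nat \<times> (nat \<Rightarrow> real)) measure) \<Rightarrow> (nat \<Rightarrow> 'th) \<Rightarrow> (nat list \<Rightarrow> nat \<times> (nat \<Rightarrow> real)) measure"
where
  "quenched eta e = Pi\<^sub>M UNIV (\<lambda>u. eta (e (length u)))"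

definition annealed ::
  "(nat \<Rightarrow> 'th) measure \<Rightarrow> ('th \<Rightarrow> (nat \<times> (nat \<Rightarrow> real)) measure) \<Rightarrow>
   ((nat \<Rightarrow> 'th) \<times> (nat list \<Rightarrow> nat \<times> (nat \<Rightarrow> real))) measure"
where
  "annealed nu eta =
     nu \<bind> (\<lambda>e. distr (quenched eta e) (nu \<Otimes>\<^sub>M Pi\<^sub>M UNIV (\<lambda>_. mark_space)) (\<lambda>w. (e, w)))"

text \<open>
  The kernel under the \<open>bind\<close> in \<open>annealed\<close> is measurable, so the bind is the genuine mixture.
\<close>

lemma measurable_quenched:
  assumes nu: "sets nu = sets (Pi\<^sub>M UNIV (\<lambda>_. Theta))"
    and eta: "eta \<in> Theta \<rightarrow>\<^sub>M prob_algebra mark_space"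
  shows "quenched eta \<in> nu \<rightarrow>\<^sub>M prob_algebra (Pi\<^sub>M UNIV (\<lambda>_. mark_space))"
proof -
  have coord: "(\<lambda>e. eta (e n)) \<in> nu \<rightarrow>\<^sub>M prob_algebra mark_space" for n
    using eta unfolding measurable_cong_sets[OF nu refl] by measurable
  have prob: "prob_space (eta (e n))" and sets_eta: "sets (eta (e n)) = sets mark_space"
    if "e \<in> space nu" for e n
    using measurable_space[OF coord that, of n] by (auto simp: space_prob_algebra)
  show ?thesis
  proof (rule measurable_prob_algebra_generated[OF sets_PiM Int_stable_prod_algebra
        prod_algebra_sets_into_space])
    fix e assume e: "e \<in> space nu"
    show "prob_space (quenched eta e)"
      unfolding quenched_def by (intro prob_space_PiM prob e)
    show "sets (quenched eta e) = sets (Pi\<^sub>M UNIV (\<lambda>_. mark_space))"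
      unfolding quenched_def by (intro sets_PiM_cong refl sets_eta e)
  next
    fix A :: "(nat list \<Rightarrow> nat \<times> (nat \<Rightarrow> real)) set"
    assume "A \<in> prod_algebra UNIV (\<lambda>_. mark_space)"
    from prod_algebraE[OF this] obtain J X where A: "A = prod_emb UNIV (\<lambda>_. mark_space) J (Pi\<^sub>E J X)"
      and J: "finite J" and X: "\<And>j. j \<in> J \<Longrightarrow> X j \<in> sets mark_space"
      by metis
    have "emeasure (quenched eta e) A = (\<Prod>u\<in>J. emeasure (eta (e (length u))) (X u))"
      if e: "e \<in> space nu" for e
    proof -
      have "A = prod_emb UNIV (\<lambda>u. eta (e (length u))) J (Pi\<^sub>E J X)"
        unfolding A prod_emb_def using sets_eq_imp_space_eq[OF sets_eta[OF e]] by simp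
      then show ?thesis
        unfolding quenched_def using J X by (simp add: emeasure_PiM_emb prob sets_eta e)
    qed
    moreover have "(\<lambda>e. \<Prod>u\<in>J. emeasure (eta (e (length u))) (X u)) \<in> borel_measurable nu"
      using measurable_compose[OF measurable_prob_algebraD[OF coord] measurable_emeasure_subprob_algebra] X
      by (intro borel_measurable_prod_ennreal) auto
    ultimately show "(\<lambda>e. emeasure (quenched eta e) A) \<in> borel_measurable nu"
      by (simp cong: measurable_cong)
  qed
qed

lemma measurable_annealed_kernel:
  assumes nu: "sets nu = sets (Pi\<^sub>M UNIV (\<lambda>_. Theta))"
    and eta: "eta \<in> Theta \<rightarrow>\<^sub>M prob_algebra mark_space"
  shows "(\<lambda>e. distr (quenched eta e) (nu \<Otimes>\<^sub>M Pi\<^sub>M UNIV (\<lambda>_. mark_space)) (\<lambda>w. (e, w)))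
    \<in> nu \<rightarrow>\<^sub>M prob_algebra (nu \<Otimes>\<^sub>M Pi\<^sub>M UNIV (\<lambda>_. mark_space))"
  by (intro measurable_distr_prob_space2[OF measurable_quenched[OF nu eta]]) simp

lemma AE_annealed_iff:
  assumes env: "stationary_ergodic Theta nu"
    and eta: "eta \<in> Theta \<rightarrow>\<^sub>M prob_algebra mark_space"
    and P: "Measurable.pred (nu \<Otimes>\<^sub>M Pi\<^sub>M UNIV (\<lambda>_. mark_space)) P"
  shows "(AE x in annealed nu eta. P x) \<longleftrightarrow> (AE e in nu. AE w in quenched eta e. P (e, w))"
proof -
  have nu: "sets nu = sets (Pi\<^sub>M UNIV (\<lambda>_. Theta))"
    using env by (simp add: stationary_ergodic_def)
  have "(AE x in annealed nu eta. P x) \<longleftrightarrow>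
      (AE e in nu. AE x in distr (quenched eta e) (nu \<Otimes>\<^sub>M Pi\<^sub>M UNIV (\<lambda>_. mark_space)) (\<lambda>w. (e, w)). P x)"
    unfolding annealed_def
    by (rule AE_bind[OF measurable_prob_algebraD[OF measurable_annealed_kernel[OF nu eta]] P])
  also have "\<dots> \<longleftrightarrow> (AE e in nu. AE w in quenched eta e. P (e, w))"
  proof (intro AE_cong AE_distr_iff)
    fix e assume e: "e \<in> space nu"
    have "sets (quenched eta e) = sets (Pi\<^sub>M UNIV (\<lambda>_. mark_space))"
      using measurable_space[OF measurable_quenched[OF nu eta] e] by (simp add: space_prob_algebra)
    then show "(\<lambda>w. (e, w)) \<in> quenched eta e \<rightarrow>\<^sub>M nu \<Otimes>\<^sub>M Pi\<^sub>M UNIV (\<lambda>_. mark_space)"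
      using e by (simp cong: measurable_cong_sets)
  qed (use P in measurable)
  finally show ?thesis .
qed

definition offspring :: "(nat list \<Rightarrow> nat \<times> (nat \<Rightarrow> real)) \<Rightarrow> nat list \<Rightarrow> nat" where
  "offspring w u = fst (w u)"

definition displacement :: "(nat list \<Rightarrow> nat \<times> (nat \<Rightarrow> real)) \<Rightarrow> nat list \<Rightarrow> nat \<Rightarrow> real" where
  "displacement w u i = snd (w u) i"

primrec generation :: "(nat list \<Rightarrow> nat \<times> (nat \<Rightarrow> real)) \<Rightarrow> nat \<Rightarrow> nat list set" where
  "generation w 0 = {[]}"
| "generation w (Suc n) = {u @ [i] |u i. u \<in> generation w n \<and> i < offspring w u}"

definition position :: "(nat list \<Rightarrow> nat \<times> (nat \<Rightarrow> real)) \<Rightarrow> nat list \<Rightarrow> real" where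
  "position w u = (\<Sum>k<length u. displacement w (take k u) (u ! k))"

lemma position_Nil [simp]: "position w [] = 0"
  by (simp add: position_def)

lemma position_snoc [simp]: "position w (u @ [i]) = position w u + displacement w u i"
  by (simp add: position_def nth_append)

lemma finite_generation: "finite (generation w n)"
proof (induction n)
  case (Suc n)
  have "generation w (Suc n) = (\<Union>u\<in>generation w n. (\<lambda>i. u @ [i]) ` {..<offspring w u})"
    by auto
  with Suc show ?case by simp
qed simp

definition leftmost :: "(nat list \<Rightarrow> nat \<times> (nat \<Rightarrow> real)) \<Rightarrow> nat \<Rightarrow> real" where
  "leftmost w n = Min (position w ` generation w n)"

definition rightmost :: "(nat list \<Rightarrow> nat \<times> (nat \<Rightarrow> real)) \<Rightarrow> nat \<Rightarrow> real" where
  "rightmost w n = Max (position w ` generation w n)"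

text \<open>
  The Bochner integral of a non-integrable function is 0, so the two quenched means below
  only have their intended meaning together with integrability under \<open>quenched eta e\<close>.
  The finiteness of the quenched means, which is implicit in \<open>E |log m\<^sub>0(t)| < \<infinity>\<close>, therefore
  has to be hypothesised separately.
\<close>

definition mean_offspring ::
  "('th \<Rightarrow> (nat \<times> (nat \<Rightarrow> real)) measure) \<Rightarrow> (nat \<Rightarrow> 'th) \<Rightarrow> real"
where
  "mean_offspring eta e = (\<integral>w. real (offspring w []) \<partial>quenched eta e)"

definition exp_sum :: "(nat list \<Rightarrow> nat \<times> (nat \<Rightarrow> real)) \<Rightarrow> real \<Rightarrow> real" where
  "exp_sum w t = (\<Sum>i<offspring w []. exp (t * displacement w [] i))"

definition laplace_mean ::
  "('th \<Rightarrow> (nat \<times> (nat \<Rightarrow> real)) measure) \<Rightarrow> (nat \<Rightarrow> 'th) \<Rightarrow> real \<Rightarrow> real"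
where
  "laplace_mean eta e t = (\<integral>w. exp_sum w t \<partial>quenched eta e)"

definition free_energy ::
  "(nat \<Rightarrow> 'th) measure \<Rightarrow> ('th \<Rightarrow> (nat \<times> (nat \<Rightarrow> real)) measure) \<Rightarrow> real \<Rightarrow> real"
where
  "free_energy nu eta t = (\<integral>e. ln (laplace_mean eta e t) \<partial>nu)"

definition t_minus :: "(real \<Rightarrow> real) \<Rightarrow> ereal" where
  "t_minus \<Lambda> = Inf (ereal ` {t. t * deriv \<Lambda> t - \<Lambda> t \<le> 0})"

definition t_plus :: "(real \<Rightarrow> real) \<Rightarrow> ereal" where
  "t_plus \<Lambda> = Sup (ereal ` {t. t * deriv \<Lambda> t - \<Lambda> t \<le> 0})"

definition extended_deriv :: "(real \<Rightarrow> real) \<Rightarrow> ereal \<Rightarrow> ereal" where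
  "extended_deriv \<Lambda> t =
     (case t of
        ereal r \<Rightarrow> ereal (deriv \<Lambda> r)
      | PInfty \<Rightarrow> Lim at_top (\<lambda>s. ereal (deriv \<Lambda> s))
      | MInfty \<Rightarrow> Lim at_bot (\<lambda>s. ereal (deriv \<Lambda> s)))"

end

theory Submission
  imports Defs
begin

text \<open>
  Let \<open>Z\<^sub>n(t) = \<Sum> exp (t S\<^sub>u)\<close>, summed over generation \<open>n\<close>. Since
  \<open>exp (t R\<^sub>n) \<le> Z\<^sub>n(t)\<close> and \<open>Z\<^sub>n(s) \<le> exp ((s - t) R\<^sub>n) Z\<^sub>n(t)\<close> for \<open>0 < t < s\<close>, the speed of
  \<open>R\<^sub>n\<close> is squeezed between \<open>\<Lambda>(t) / t\<close> and the slopes of \<open>\<Lambda>\<close> as soon as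
  \<open>log Z\<^sub>n(t) / n\<close> is asymptotically at most \<open>\<Lambda>(t)\<close> for every \<open>t\<close>, and at least \<open>\<Lambda>(t)\<close> whenever
  \<open>t \<Lambda>'(t) < \<Lambda>(t)\<close>; the leftmost particle corresponds to negative \<open>t\<close>.

  The upper bound is the first moment estimate together with Birkhoff's theorem. For the lower bound
  choose \<open>p \<in> (1, 2]\<close> with \<open>\<Lambda>(p t) < p \<Lambda>(t)\<close> and truncate the reproduction laws so slightly that this
  persists. The normalised \<open>p\<close>-th moments of the truncated \<open>Z\<^sub>n(t)\<close> satisfy an affine recursion in
  \<open>n\<close> whose random coefficients contract on average, so they are bounded, and a Paley-Zygmund argument
  shows that the truncated \<open>Z\<^sub>n(t)\<close> reaches half of its mean with a probability that does not depend on
  \<open>n\<close>. Subtrees attached to the line of first children during the first \<open>\<delta> n\<close> generations provide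
  linearly many independent trials, which turns this into an exponentially small failure probability
  at the cost of a factor \<open>exp (O(\<delta> n))\<close>.
\<close>

section \<open>Birkhoff's ergodic theorem\<close>

text \<open>Three obstacles shape the argument. The hypotheses give finite means of
  \<open>exp_sum w t\<close> for every t, hence also for the sum of the p-th powers of the weights,
  but no p-th moment of a whole family. The truncation repairs this: the p-th power of the first
  child's weight is one term of the sum at p t, and what remains of the other children is bounded.
  Moreover the environment is not bounded. The constant in the p-th moment estimate is an almost
  surely finite random series, so the survival probability of a truncated tree is independent of its
  height but not uniform over environments. By ergodicity there is a positive frequency of
  generations at which this constant, the displacement of the second child and the chance of having
  one are controlled by a single number; only the trials started there are counted. Such generations
  exist because the mean of log m_0 is positive, and N \<ge> 1 keeps the line of first children
  alive. Finally, the exceptional null sets depend on t, so the squeeze uses rational parameters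
  only, which continuity of \<Lambda> permits.\<close>

locale ergodic_system = prob_space M for M :: "'a measure" +
  fixes T :: "'a \<Rightarrow> 'a"
  assumes T_measurable: "T \<in> M \<rightarrow>\<^sub>M M"
    and T_invariant: "distr M M T = M"
    and T_ergodic: "\<And>A. A \<in> sets M \<Longrightarrow> T -` A \<inter> space M = A \<Longrightarrow> prob A = 0 \<or> prob A = 1"
begin

lemma funpow_measurable [measurable]: "(T ^^ n) \<in> M \<rightarrow>\<^sub>M M"
proof (induction n)
  case (Suc n)
  then show ?case
    unfolding funpow.simps by (rule measurable_comp[OF _ T_measurable])
qed (simp add: id_def)

lemma distr_funpow: "distr M M (T ^^ n) = M"
proof (induction n)
  case 0
  then show ?case by (simp add: id_def distr_id2)
next
  case (Suc n)
  have "distr M M (T ^^ Suc n) = distr (distr M M (T ^^ n)) M T"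
    by (simp add: distr_distr T_measurable)
  with Suc T_invariant show ?case by (simp only:)
qed

lemma funpow_space: "x \<in> space M \<Longrightarrow> (T ^^ n) x \<in> space M"
  using measurable_space[OF funpow_measurable] .

lemma AE_all_funpow:
  assumes "AE x in M. P x"
  shows "AE x in M. \<forall>n. P ((T ^^ n) x)"
proof -
  obtain N where N: "{x \<in> space M. \<not> P x} \<subseteq> N" "N \<in> sets M" "emeasure M N = 0"
    using assms by (auto elim: AE_E)
  have "AE x in M. P ((T ^^ n) x)" for n
  proof (rule AE_I)
    show "{x \<in> space M. \<not> P ((T ^^ n) x)} \<subseteq> (T ^^ n) -` N \<inter> space M"
      using N funpow_space by auto
    show "(T ^^ n) -` N \<inter> space M \<in> sets M"
      using N(2) by measurable
    show "emeasure M ((T ^^ n) -` N \<inter> space M) = 0"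
      using N emeasure_distr[OF funpow_measurable N(2), of n] by (simp add: distr_funpow)
  qed
  then show ?thesis by (simp add: AE_all_countable)
qed

lemma integrable_funpow:
  fixes f :: "'a \<Rightarrow> real"
  assumes "integrable M f"
  shows "integrable M (\<lambda>x. f ((T ^^ n) x))"
  by (metis assms distr_funpow funpow_measurable integrable_distr)

lemma integral_funpow:
  fixes f :: "'a \<Rightarrow> real"
  assumes "integrable M f"
  shows "(\<integral>x. f ((T ^^ n) x) \<partial>M) = (\<integral>x. f x \<partial>M)"
  by (metis assms borel_measurable_integrable distr_funpow funpow_measurable integral_distr)

definition birkhoff_sum :: "('a \<Rightarrow> real) \<Rightarrow> nat \<Rightarrow> 'a \<Rightarrow> real" where
  "birkhoff_sum f n x = (\<Sum>k<n. f ((T ^^ k) x))"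

lemma birkhoff_sum_Suc_shift: "birkhoff_sum f (Suc n) x = f x + birkhoff_sum f n (T x)"
  unfolding birkhoff_sum_def
  by (subst sum.lessThan_Suc_shift) (simp add: funpow_swap1)

text \<open>The largest of the Birkhoff sums of length at most \<open>n\<close>, the empty one
  included. Recursing along \<open>T\<close> makes the cocycle identity behind the maximal argument
  definitional.\<close>

primrec birkhoff_max :: "('a \<Rightarrow> real) \<Rightarrow> nat \<Rightarrow> 'a \<Rightarrow> real" where
  "birkhoff_max f 0 x = 0"
| "birkhoff_max f (Suc n) x = max 0 (f x + birkhoff_max f n (T x))"

lemma birkhoff_max_nonneg: "0 \<le> birkhoff_max f n x"
  by (cases n) auto

lemma birkhoff_max_mono: "birkhoff_max f n x \<le> birkhoff_max f (Suc n) x"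
proof (induction n arbitrary: x)
  case (Suc n)
  from Suc[of "T x"] show ?case by (simp only: birkhoff_max.simps)
qed simp

lemma birkhoff_sum_le_max: "birkhoff_sum f n x \<le> birkhoff_max f n x"
proof (induction n arbitrary: x)
  case 0 then show ?case by (simp add: birkhoff_sum_def)
next
  case (Suc n) then show ?case by (simp add: birkhoff_sum_Suc_shift le_max_iff_disj)
qed

lemma birkhoff_max_measurable [measurable]:
  assumes [measurable]: "f \<in> borel_measurable M"
  shows "birkhoff_max f n \<in> borel_measurable M"
proof (induction n)
  case (Suc n)
  note [measurable] = Suc T_measurable
  show ?case by simp
qed simp

lemma birkhoff_max_integrable:
  assumes "integrable M f"
  shows "integrable M (birkhoff_max f n)"
proof (induction n)
  case (Suc n)
  have "integrable M (\<lambda>x. birkhoff_max f n (T x))"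
    using integrable_funpow[OF Suc, of 1] by simp
  then show ?case using assms by simp
qed simp

text \<open>The maximal ergodic argument: if the maximal sums diverge, then
  \<open>birkhoff_max f (Suc n) x - birkhoff_max f n (T x)\<close>, whose integral is nonnegative by
  invariance, decreases to \<open>f x\<close>.\<close>

lemma AE_birkhoff_max_bounded:
  assumes f: "integrable M f" and neg: "(\<integral>x. f x \<partial>M) < 0"
  shows "AE x in M. \<exists>c. \<forall>n. birkhoff_max f n x \<le> c"
proof -
  have [measurable]: "f \<in> borel_measurable M" using f by simp
  note [measurable] = T_measurable
  define A where "A = {x \<in> space M. \<forall>c::nat. \<exists>n. real c < birkhoff_max f n x}"
  have A [measurable]: "A \<in> sets M" unfolding A_def by measurable
  \<comment> \<open>Passing from \<open>T x\<close> to \<open>x\<close> changes the maximal sums by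
    the fixed number \<open>f x\<close>, so their divergence is an invariant event.\<close>
  have inv: "T -` A \<inter> space M = A"
  proof (intro equalityI subsetI)
    fix x assume x: "x \<in> T -` A \<inter> space M"
    have "\<exists>n. real c < birkhoff_max f n x" for c
    proof -
      obtain c' where c': "real c' > real c - f x" using reals_Archimedean2 by blast
      obtain n where "real c' < birkhoff_max f n (T x)" using x unfolding A_def by auto
      then have "real c < birkhoff_max f (Suc n) x" using c' by auto
      then show ?thesis by blast
    qed
    then show "x \<in> A" using x unfolding A_def by auto
  next
    fix x assume x: "x \<in> A"
    have "\<exists>n. real c < birkhoff_max f n (T x)" for c
    proof -
      \<comment> \<open>A positive level excludes both \<open>n = 0\<close> and the branch 0 of the
        maximum, so the crossing value is \<open>f x\<close> plus a maximal sum at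
        \<open>T x\<close>.\<close>
      obtain c' where c': "real c' > real c + f x + 0" "c' > 0"
        using reals_Archimedean2[of "max 0 (real c + f x)"] by auto
      obtain n where n: "real c' < birkhoff_max f n x" using x unfolding A_def by auto
      then obtain m where "n = Suc m" using c' by (cases n) auto
      then have "real c < birkhoff_max f m (T x)" using n c' by (auto simp: max_def split: if_splits)
      then show ?thesis by blast
    qed
    then show "x \<in> T -` A \<inter> space M"
      using x measurable_space[OF T_measurable] unfolding A_def by auto
  qed
  have "prob A \<noteq> 1"
  proof
    assume "prob A = 1"
    then have AE_A: "AE x in M. x \<in> A" by (simp add: prob_eq_1)
    let ?d = "\<lambda>n x. max (- birkhoff_max f n (T x)) (f x)"
    have int_T: "integrable M (\<lambda>x. birkhoff_max f n (T x))"
      and eq_T: "(\<integral>x. birkhoff_max f n (T x) \<partial>M) = (\<integral>x. birkhoff_max f n x \<partial>M)" for n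
      using integrable_funpow[OF birkhoff_max_integrable[OF f], of _ 1]
        integral_funpow[OF birkhoff_max_integrable[OF f], of _ 1] by simp_all
    have d_eq: "?d n x = birkhoff_max f (Suc n) x - birkhoff_max f n (T x)" for n x
      by simp
    have d_nonneg: "0 \<le> (\<integral>x. ?d n x \<partial>M)" for n
    proof -
      have "(\<integral>x. ?d n x \<partial>M) = (\<integral>x. birkhoff_max f (Suc n) x \<partial>M) - (\<integral>x. birkhoff_max f n x \<partial>M)"
        unfolding d_eq eq_T[of n, symmetric]
        by (intro Bochner_Integration.integral_diff birkhoff_max_integrable int_T f)
      also have "\<dots> \<ge> 0"
        using integral_mono[OF birkhoff_max_integrable[OF f] birkhoff_max_integrable[OF f] birkhoff_max_mono]
        by simp
      finally show ?thesis .
    qed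
    have "(\<lambda>n. \<integral>x. ?d n x \<partial>M) \<longlonglongrightarrow> (\<integral>x. f x \<partial>M)"
    proof (rule integral_dominated_convergence)
      show "integrable M (\<lambda>x. \<bar>f x\<bar>)" using f by simp
      show "AE x in M. norm (?d n x) \<le> \<bar>f x\<bar>" for n
      proof (rule AE_I2)
        fix x
        show "norm (?d n x) \<le> \<bar>f x\<bar>"
          using birkhoff_max_nonneg[of f n "T x"] by (simp add: max_def abs_if)
      qed
      show "AE x in M. (\<lambda>n. ?d n x) \<longlonglongrightarrow> f x"
        using AE_A
      proof eventually_elim
        case (elim x)
        then have "T x \<in> A" using inv by auto
        \<comment> \<open>Once the maximal sum at \<open>T x\<close> exceeds \<open>- f x\<close>,
          the maximum in \<open>?d\<close> is attained by \<open>f x\<close>.\<close>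
        obtain c :: nat where c: "real c > - f x" using reals_Archimedean2 by blast
        obtain n0 where n0: "birkhoff_max f n0 (T x) > real c"
          using \<open>T x \<in> A\<close> unfolding A_def by auto
        have "?d n x = f x" if "n \<ge> n0" for n
        proof -
          have "birkhoff_max f n0 (T x) \<le> birkhoff_max f n (T x)"
            using lift_Suc_mono_le[of "\<lambda>n. birkhoff_max f n (T x)"] birkhoff_max_mono that by blast
          then show ?thesis using n0 c by auto
        qed
        then show ?case
          by (intro tendsto_eventually) (auto simp: eventually_sequentially)
      qed
    qed measurable
    then have "0 \<le> (\<integral>x. f x \<partial>M)"
      using d_nonneg by (intro LIMSEQ_le_const) auto
    with neg show False by simp
  qed
  with T_ergodic[OF A inv] have "prob A = 0" by simp
  then have "AE x in M. x \<notin> A"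
    using A by (simp add: AE_iff_measurable[OF A] emeasure_eq_measure A_def)
  then show ?thesis
    unfolding A_def by (auto elim!: eventually_mono simp: not_less intro: exI)
qed

text \<open>Half of \<open>eps\<close> makes the mean of the centred function negative, so its sums
  stay bounded; the other half absorbs that bound, which depends on \<open>x\<close>.\<close>

lemma AE_birkhoff_upper:
  assumes f: "integrable M f" and eps: "0 < eps"
  shows "AE x in M. eventually (\<lambda>n. birkhoff_sum f n x \<le> real n * ((\<integral>x. f x \<partial>M) + eps)) sequentially"
proof -
  let ?c = "(\<integral>x. f x \<partial>M) + eps / 2"
  let ?g = "\<lambda>x. f x - ?c"
  have "integrable M ?g" "(\<integral>x. ?g x \<partial>M) < 0"
    using f eps by (simp_all add: prob_space)
  from AE_birkhoff_max_bounded[OF this] show ?thesis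
  proof eventually_elim
    case (elim x)
    then obtain c where c: "\<And>n. birkhoff_max ?g n x \<le> c" by blast
    have "eventually (\<lambda>n. c \<le> real n * (eps / 2)) sequentially"
      using eps by real_asymp
    then show ?case
    proof eventually_elim
      case (elim n)
      have "birkhoff_sum ?g n x \<le> c" using c[of n] birkhoff_sum_le_max[of ?g n x] by linarith
      moreover have "birkhoff_sum ?g n x = birkhoff_sum f n x - real n * ?c"
        by (simp add: birkhoff_sum_def sum_subtractf)
      ultimately show ?case using elim by (simp add: algebra_simps)
    qed
  qed
qed

theorem birkhoff:
  assumes f: "integrable M f"
  shows "AE x in M. (\<lambda>n. birkhoff_sum f n x / real n) \<longlonglongrightarrow> (\<integral>x. f x \<partial>M)"
proof -
  let ?I = "\<integral>x. f x \<partial>M"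
  have "AE x in M. \<forall>k. eventually (\<lambda>n. birkhoff_sum f n x \<le> real n * (?I + 1 / real (Suc k))) sequentially"
    unfolding AE_all_countable using AE_birkhoff_upper[OF f] by auto
  moreover have "AE x in M. \<forall>k. eventually (\<lambda>n. birkhoff_sum (\<lambda>x. - f x) n x \<le>
      real n * ((\<integral>x. - f x \<partial>M) + 1 / real (Suc k))) sequentially"
    unfolding AE_all_countable using AE_birkhoff_upper[of "\<lambda>x. - f x"] f by auto
  ultimately show ?thesis
  proof eventually_elim
    case (elim x)
    show ?case
    proof (rule tendstoI)
      fix e :: real assume "0 < e"
      then obtain k where k: "1 / real (Suc k) < e" using nat_approx_posE by blast
      from elim have "eventually (\<lambda>n. birkhoff_sum f n x \<le> real n * (?I + 1 / real (Suc k))) sequentially"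
        and "eventually (\<lambda>n. birkhoff_sum (\<lambda>x. - f x) n x \<le>
          real n * ((\<integral>x. - f x \<partial>M) + 1 / real (Suc k))) sequentially" by auto
      then show "eventually (\<lambda>n. dist (birkhoff_sum f n x / real n) ?I < e) sequentially"
        using eventually_gt_at_top[of 0]
      proof eventually_elim
        case (elim n)
        have "- birkhoff_sum f n x \<le> real n * (- ?I + 1 / real (Suc k))"
          using elim(2) by (simp add: birkhoff_sum_def sum_negf)
        then have "?I - 1 / real (Suc k) \<le> birkhoff_sum f n x / real n"
          using elim(3) by (simp add: field_simps)
        moreover have "birkhoff_sum f n x / real n \<le> ?I + 1 / real (Suc k)"
          using elim(1,3) by (simp add: field_simps)
        ultimately show ?case using k by (simp add: dist_real_def abs_if)
      qed
    qed
  qed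
qed

end

lemma ergodic_system_shift:
  assumes "stationary_ergodic Theta nu"
  shows "ergodic_system nu shift"
proof -
  have nu: "sets nu = sets (Pi\<^sub>M UNIV (\<lambda>_. Theta))"
    using assms by (simp add: stationary_ergodic_def)
  have "shift \<in> nu \<rightarrow>\<^sub>M nu"
    unfolding measurable_cong_sets[OF nu nu] shift_def
    by (rule measurable_PiM_single') (auto simp: space_PiM PiE_iff)
  then show ?thesis
    using assms unfolding stationary_ergodic_def ergodic_system_def ergodic_system_axioms_def by auto
qed

lemma funpow_shift: "(shift ^^ k) e n = e (n + k)"
  by (induction k arbitrary: n) (simp_all add: shift_def)

section \<open>Convex free energies and the speed\<close>

text \<open>Exactly these three properties survive the reflection of the argument, which turns
  statements about the rightmost particle into statements about the leftmost one.\<close>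

locale convex_free_energy =
  fixes \<Lambda> d :: "real \<Rightarrow> real"
  assumes convex: "convex_on UNIV \<Lambda>"
    and deriv: "\<And>t. (\<Lambda> has_real_derivative d t) (at t)"
    and pos: "0 < \<Lambda> 0"
begin

lemma above_tangent: "d s * (t - s) \<le> \<Lambda> t - \<Lambda> s"
  using convex_on_imp_above_tangent[OF convex, of s t "d s"] deriv by simp

lemma deriv_eq: "deriv \<Lambda> = d"
  using deriv by (auto intro: DERIV_imp_deriv)

lemma d_mono: "s \<le> t \<Longrightarrow> d s \<le> d t"
proof -
  assume st: "s \<le> t"
  have "d s * (t - s) \<le> d t * (t - s)"
    using above_tangent[of s t] above_tangent[of t s] by (simp add: algebra_simps)
  then show ?thesis using st by (cases "s = t") auto
qed

text \<open>For \<open>h > 0\<close> monotonicity puts \<open>d (t + h)\<close> between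
  \<open>d t\<close> and the chord slope \<open>q h\<close> over [t + h, t + 2h]; for negative
  \<open>h\<close> the order is reversed. The slope \<open>q h\<close> is a combination of two
  difference quotients at \<open>t\<close> and tends to \<open>2 * d t - d t\<close>.\<close>

lemma d_continuous: "isCont d t"
proof -
  define q where "q h = (\<Lambda> (t + 2 * h) - \<Lambda> (t + h)) / h" for h
  have L1: "((\<lambda>h. (\<Lambda> (t + h) - \<Lambda> t) / h) \<longlongrightarrow> d t) (at 0)"
    using deriv[of t] by (simp add: DERIV_def)
  have "filterlim (\<lambda>h::real. 2 * h) (at 0) (at 0)"
    by (auto simp: filterlim_at eventually_at_filter intro!: tendsto_eq_intros)
  from filterlim_compose[OF L1 this]
  have L2: "((\<lambda>h. (\<Lambda> (t + 2 * h) - \<Lambda> t) / (2 * h)) \<longlongrightarrow> d t) (at 0)" .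
  have "((\<lambda>h. 2 * ((\<Lambda> (t + 2 * h) - \<Lambda> t) / (2 * h)) - (\<Lambda> (t + h) - \<Lambda> t) / h) \<longlongrightarrow> 2 * d t - d t) (at 0)"
    by (intro tendsto_intros L1 L2)
  then have "(q \<longlongrightarrow> d t) (at 0)"
    unfolding q_def by (simp add: diff_divide_distrib)
  then have q0: "((\<lambda>h. q h - d t) \<longlongrightarrow> 0) (at 0)"
    by (simp add: LIM_zero)
  have "((\<lambda>h. d (t + h) - d t) \<longlongrightarrow> 0) (at 0)"
  proof (rule Lim_null_comparison[OF _ tendsto_rabs_zero[OF q0]])
    show "eventually (\<lambda>h. norm (d (t + h) - d t) \<le> \<bar>q h - d t\<bar>) (at 0)"
    proof (rule eventually_at_filter[THEN iffD2], rule always_eventually, intro allI impI)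
      fix h :: real assume "h \<noteq> 0"
      have *: "d (t + h) * h \<le> \<Lambda> (t + 2 * h) - \<Lambda> (t + h)"
        using above_tangent[of "t + h" "t + 2 * h"] by (simp add: algebra_simps)
      show "norm (d (t + h) - d t) \<le> \<bar>q h - d t\<bar>"
      proof (cases "0 < h")
        case True
        then have "d (t + h) \<le> q h" using * by (simp add: q_def pos_le_divide_eq)
        moreover have "d t \<le> d (t + h)" using d_mono True by simp
        ultimately show ?thesis by simp
      next
        case False
        then have "q h \<le> d (t + h)" using * \<open>h \<noteq> 0\<close> by (simp add: q_def neg_divide_le_eq)
        moreover have "d (t + h) \<le> d t" using d_mono False by simp
        ultimately show ?thesis by simp
      qed
    qed
  qed
  then show ?thesis
    by (simp add: isCont_def LIM_offset_zero_iff LIM_zero_iff)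
qed

text \<open>The convex conjugate of \<open>\<Lambda>\<close> at the slope \<open>d t\<close>.
  Heuristically exp(- n \<rho>(t)) is the mean number of particles near n \<Lambda>'(t), so a
  negative value means that this speed is populated.\<close>

definition \<rho> :: "real \<Rightarrow> real" where
  "\<rho> t = t * d t - \<Lambda> t"

lemma \<rho>_continuous: "continuous_on S \<rho>"
  unfolding \<rho>_def
  by (intro continuous_at_imp_continuous_on ballI continuous_intros d_continuous DERIV_isCont[OF deriv])

text \<open>This is the tangent at \<open>t\<close> evaluated at \<open>s\<close>. It shows that
  \<rho> is nondecreasing on the nonnegative half-line.\<close>

lemma \<rho>_diff: "s * (d t - d s) \<le> \<rho> t - \<rho> s"
  using above_tangent[of t s] by (simp add: \<rho>_def algebra_simps)

lemma \<rho>_0: "\<rho> 0 < 0"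
  using pos by (simp add: \<rho>_def)

lemma slope_ge: "s < t \<Longrightarrow> d s \<le> (\<Lambda> t - \<Lambda> s) / (t - s)"
  using above_tangent[of s t] by (simp add: pos_le_divide_eq)

lemma d_tendsto_SUP: "((\<lambda>s. ereal (d s)) \<longlongrightarrow> (SUP s. ereal (d s))) at_top"
proof (rule order_tendstoI)
  fix a assume "a < (SUP s. ereal (d s))"
  then obtain s where s: "a < ereal (d s)" by (auto simp: less_SUP_iff)
  show "eventually (\<lambda>s. a < ereal (d s)) at_top"
    using eventually_ge_at_top[of s]
  proof eventually_elim
    case (elim t)
    then have "ereal (d s) \<le> ereal (d t)" using d_mono by simp
    with s show ?case by (rule less_le_trans)
  qed
next
  fix a assume "(SUP s. ereal (d s)) < a"
  then show "eventually (\<lambda>s. ereal (d s) < a) at_top"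
    by (intro always_eventually allI) (auto dest: SUP_lessD)
qed

lemma extended_deriv_PInf: "extended_deriv \<Lambda> \<infinity> = (SUP s. ereal (d s))"
proof -
  have "Lim at_top (\<lambda>s. ereal (d s)) = (SUP s. ereal (d s))"
    by (intro tendsto_Lim d_tendsto_SUP) auto
  then show ?thesis
    by (simp add: extended_deriv_def deriv_eq flip: PInfty_eq_infinity)
qed

lemma t_plus_eq: "t_plus \<Lambda> = Sup (ereal ` {t. \<rho> t \<le> 0})"
  by (simp add: t_plus_def deriv_eq \<rho>_def)

lemma unbounded_t_plus:
  assumes "\<And>b. \<exists>t\<ge>b. \<rho> t \<le> 0"
  shows "t_plus \<Lambda> = \<infinity>"
proof -
  have "ereal b \<le> t_plus \<Lambda>" for b
  proof -
    obtain t where "b \<le> t" "\<rho> t \<le> 0" using assms by blast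
    then show ?thesis unfolding t_plus_eq by (intro SUP_upper2) auto
  qed
  then show ?thesis by (rule ereal_top)
qed

text \<open>The nonnegative parameters with \<open>\<rho> t \<ge> 0\<close> form a closed set, so
  its infimum belongs to it; since \<rho> is negative at 0, the intermediate value theorem makes
  that point a zero.\<close>

lemma first_zero_cases:
  obtains (never) "\<And>t. 0 \<le> t \<Longrightarrow> \<rho> t < 0"
  | (zero) \<tau> where "0 < \<tau>" "\<rho> \<tau> = 0" "\<And>t. 0 \<le> t \<Longrightarrow> t < \<tau> \<Longrightarrow> \<rho> t < 0"
proof (cases "\<exists>t\<ge>0. 0 \<le> \<rho> t")
  case True
  let ?S = "{t. 0 \<le> t \<and> 0 \<le> \<rho> t}"
  have "closed ?S"
    by (intro closed_Collect_conj closed_Collect_le continuous_intros \<rho>_continuous)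
  moreover have bdd: "bdd_below ?S" by (auto intro: bdd_belowI)
  ultimately have \<tau>: "Inf ?S \<in> ?S"
    using True by (intro closed_contains_Inf) auto
  have less: "\<rho> t < 0" if "0 \<le> t" "t < Inf ?S" for t
    using cInf_lower[OF _ bdd, of t] that by force
  have "Inf ?S \<noteq> 0" using \<tau> \<rho>_0 by auto
  then have pos: "0 < Inf ?S" using \<tau> by auto
  obtain t where t: "0 \<le> t" "t \<le> Inf ?S" "\<rho> t = 0"
    using IVT'[of \<rho> 0 0 "Inf ?S"] \<rho>_0 \<tau> \<rho>_continuous pos by force
  then have "\<rho> (Inf ?S) = 0" using less[of t] by (cases "t = Inf ?S") auto
  then show ?thesis using zero less pos by blast
next
  case False
  then show ?thesis using never by force
qed

text \<open>Beyond its first zero \<open>\<rho>\<close> may vanish on an interval, where \<open>\<Lambda>\<close> is linear through the origin;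
  \<open>\<Lambda>'\<close> is constant there, so the first zero serves as well as \<open>t_plus \<Lambda>\<close>, its last one.\<close>

lemma extended_deriv_t_plus_zero:
  assumes \<tau>: "0 < \<tau>" "\<rho> \<tau> = 0"
  shows "extended_deriv \<Lambda> (t_plus \<Lambda>) = ereal (d \<tau>)"
proof -
  let ?S = "{t. \<rho> t \<le> 0}"
  have d_eq: "d t = d \<tau>" if "t \<in> ?S" "\<tau> \<le> t" for t
  proof -
    have "\<tau> * (d t - d \<tau>) \<le> 0" using \<rho>_diff[of \<tau> t] that \<tau> by auto
    then have "d t \<le> d \<tau>" using \<tau> by (simp add: mult_le_0_iff)
    then show ?thesis using d_mono[OF that(2)] by simp
  qed
  show ?thesis
  proof (cases "bdd_above ?S")
    case True
    have "closed ?S" by (intro closed_Collect_le continuous_intros \<rho>_continuous)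
    then have S: "Sup ?S \<in> ?S"
      using True \<tau> by (intro closed_contains_Sup) (auto intro: exI[of _ \<tau>])
    moreover have "\<tau> \<le> Sup ?S" using True \<tau> by (intro cSup_upper) auto
    moreover have "t_plus \<Lambda> = ereal (Sup ?S)"
      unfolding t_plus_eq
      by (rule antisym, rule SUP_least) (use True S in \<open>auto intro: cSup_upper SUP_upper\<close>)
    ultimately show ?thesis using d_eq by (simp add: extended_deriv_def deriv_eq)
  next
    case False
    have unb: "\<exists>t\<ge>b. \<rho> t \<le> 0" for b
      using False unfolding bdd_above_def by (auto simp: not_le intro: less_imp_le)
    \<comment> \<open>Arbitrarily large parameters satisfy \<open>\<rho> t \<le> 0\<close>, and at
      those beyond \<open>\<tau>\<close> the derivative is still \<open>d \<tau>\<close>.\<close>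
    have "d s \<le> d \<tau>" for s
    proof -
      obtain t where "max s \<tau> \<le> t" "\<rho> t \<le> 0" using unb by blast
      then show ?thesis using d_mono[of s t] d_eq[of t] by auto
    qed
    then have "(SUP s. ereal (d s)) = ereal (d \<tau>)"
      by (intro antisym SUP_least SUP_upper) auto
    then show ?thesis using unbounded_t_plus[OF unb] extended_deriv_PInf by simp
  qed
qed

text \<open>At a zero of \<rho> the tangent passes through the origin, so
  \<open>\<Lambda> \<tau> / \<tau>\<close> is exactly \<open>d \<tau>\<close>. If \<rho> stays
  negative, the slopes have a supremum below \<open>a\<close>, and a line of smaller slope
  eventually drops below \<open>a * t\<close>.\<close>

lemma upper_speed:
  assumes "extended_deriv \<Lambda> (t_plus \<Lambda>) < ereal a"
  shows "\<exists>t>0. \<Lambda> t / t < a"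
proof (cases rule: first_zero_cases)
  case never
  have "\<exists>t\<ge>b. \<rho> t \<le> 0" for b
    using never[of "max b 0"] by (intro exI[of _ "max b 0"]) auto
  then have sup: "(SUP s. ereal (d s)) < ereal a"
    using unbounded_t_plus extended_deriv_PInf assms by simp
  moreover have "ereal (d 0) \<le> (SUP s. ereal (d s))" by (rule SUP_upper) auto
  ultimately obtain b where b: "(SUP s. ereal (d s)) = ereal b"
    by (cases "(SUP s. ereal (d s))") auto
  have "b < a" using sup b by simp
  have d_le: "d s \<le> b" for s
    using SUP_upper[of s UNIV "\<lambda>s. ereal (d s)"] b by simp
  \<comment> \<open>Chosen so that \<open>(a - b) * t\<close> exceeds \<open>\<Lambda> 0\<close> by
    \<open>a - b\<close>.\<close>
  define t where "t = \<Lambda> 0 / (a - b) + 1"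
  have "0 < \<Lambda> 0 / (a - b)" using pos \<open>b < a\<close> by simp
  then have t: "0 < t" by (simp add: t_def)
  have "\<Lambda> 0 < (a - b) * t" using \<open>b < a\<close> by (simp add: t_def distrib_left)
  moreover have "\<Lambda> t \<le> \<Lambda> 0 + d t * t" using above_tangent[of t 0] by simp
  moreover have "d t * t \<le> b * t" using d_le t by simp
  ultimately have "\<Lambda> t < a * t" by (simp add: algebra_simps)
  then show ?thesis using t by (intro exI[of _ t]) (simp add: pos_divide_less_eq)
next
  case (zero \<tau>)
  then have "\<Lambda> \<tau> / \<tau> = d \<tau>" by (simp add: \<rho>_def field_simps)
  then show ?thesis
    using extended_deriv_t_plus_zero[OF zero(1,2)] assms zero(1) by auto
qed

text \<open>The chord is taken to the left of the first zero, where \<rho> is negative at both ends;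
  continuity of \<open>d\<close> lets its slope come as close to \<open>d \<tau>\<close> as
  required. Without a zero every positive parameter is admissible.\<close>

lemma lower_speed:
  assumes "ereal a < extended_deriv \<Lambda> (t_plus \<Lambda>)"
  shows "\<exists>t s. 0 < t \<and> t < s \<and> \<rho> t < 0 \<and> \<rho> s < 0 \<and> a < (\<Lambda> s - \<Lambda> t) / (s - t)"
proof (cases rule: first_zero_cases)
  case never
  have "\<exists>t\<ge>b. \<rho> t \<le> 0" for b
    using never[of "max b 0"] by (intro exI[of _ "max b 0"]) auto
  then have "ereal a < (SUP s. ereal (d s))"
    using unbounded_t_plus extended_deriv_PInf assms by simp
  then obtain t0 where "a < d t0" by (auto simp: less_SUP_iff)
  then have "a < d (max t0 1)" using d_mono[of t0 "max t0 1"] by simp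
  also have "\<dots> \<le> (\<Lambda> (max t0 1 + 1) - \<Lambda> (max t0 1)) / (max t0 1 + 1 - max t0 1)"
    by (rule slope_ge) simp
  finally show ?thesis using never
    by (intro exI[of _ "max t0 1"] exI[of _ "max t0 1 + 1"]) auto
next
  case (zero \<tau>)
  have a: "a < d \<tau>" using extended_deriv_t_plus_zero[OF zero(1,2)] assms by simp
  have "(d \<longlongrightarrow> d \<tau>) (at_left \<tau>)"
    using d_continuous[of \<tau>] by (auto simp: isCont_def intro: tendsto_within_subset)
  then have "eventually (\<lambda>t. a < d t) (at_left \<tau>)" using a by (rule order_tendstoD)
  moreover have "eventually (\<lambda>t. 0 < t) (at_left \<tau>)"
    using zero(1) eventually_at_left_real[of 0 \<tau>] by (auto elim: eventually_mono)
  moreover have "eventually (\<lambda>t. t < \<tau>) (at_left \<tau>)"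
    by (simp add: eventually_at_filter)
  ultimately have "eventually (\<lambda>t. a < d t \<and> 0 < t \<and> t < \<tau>) (at_left \<tau>)"
    by eventually_elim auto
  then obtain t where t: "a < d t" "0 < t" "t < \<tau>"
    using eventually_happens[of _ "at_left \<tau>"] by auto
  \<comment> \<open>The midpoint of \<open>t\<close> and \<open>\<tau>\<close> serves as the second
    parameter: any point strictly between them would do.\<close>
  have "a < (\<Lambda> ((t + \<tau>) / 2) - \<Lambda> t) / ((t + \<tau>) / 2 - t)"
    using slope_ge[of t "(t + \<tau>) / 2"] t by simp
  then show ?thesis using t zero(3)[of t] zero(3)[of "(t + \<tau>) / 2"]
    by (intro exI[of _ t] exI[of _ "(t + \<tau>) / 2"]) auto
qed

text \<open>The difference \<open>\<Lambda> (p * t) - p * \<Lambda> t\<close> vanishes at p = 1 and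
  has derivative \<open>\<rho> t\<close> there. The cap at 2 is the range of the moment inequality
  for independent sums.\<close>

lemma strict_power_gap:
  assumes "\<rho> t < 0"
  obtains p where "1 < p" "p \<le> 2" "\<Lambda> (p * t) < p * \<Lambda> t"
proof -
  have "((\<lambda>p. \<Lambda> (p * t)) has_real_derivative d (1 * t) * t) (at 1)"
    by (rule DERIV_chain2[where f = \<Lambda> and g = "\<lambda>p. p * t", OF deriv]) (auto intro!: derivative_eq_intros)
  then have "((\<lambda>p. \<Lambda> (p * t) - p * \<Lambda> t) has_real_derivative \<rho> t) (at 1)"
    unfolding \<rho>_def by (auto intro!: derivative_eq_intros simp: mult.commute)
  from DERIV_neg_dec_right[OF this assms]
  obtain h where h: "0 < h" and dec: "\<And>x. 0 < x \<Longrightarrow> x < h \<Longrightarrow> \<Lambda> ((1 + x) * t) - (1 + x) * \<Lambda> t < 0"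
    by auto
  show ?thesis
    using that[of "1 + min 1 (h / 2)"] dec[of "min 1 (h / 2)"] h by auto
qed

end

lemma convex_free_energy_reflect:
  assumes "convex_free_energy \<Lambda> d"
  shows "convex_free_energy (\<lambda>t. \<Lambda> (- t)) (\<lambda>t. - d (- t))"
proof -
  interpret convex_free_energy \<Lambda> d by fact
  show ?thesis
  proof
    show "convex_on UNIV (\<lambda>t. \<Lambda> (- t))"
    proof (rule convex_onI)
      fix x y t :: real
      assume "0 < t" "t < 1"
      then show "\<Lambda> (- ((1 - t) *\<^sub>R x + t *\<^sub>R y)) \<le> (1 - t) * \<Lambda> (- x) + t * \<Lambda> (- y)"
        using convex_onD[OF convex, of t "- x" "- y"] by (simp add: algebra_simps)
    qed simp
    show "((\<lambda>t. \<Lambda> (- t)) has_real_derivative - d (- t)) (at t)" for t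
      using DERIV_chain2[where f = \<Lambda> and g = uminus and s = UNIV, OF deriv[of "- t"] DERIV_minus[OF DERIV_ident]]
      by simp
    show "0 < \<Lambda> (- 0)" using pos by simp
  qed
qed

context convex_free_energy
begin

text \<open>Reflection exchanges infimum and supremum and the limits at the two infinities, and
  changes the sign of the derivative. The leftmost particle thereby reduces to the rightmost
  one.\<close>

lemma extended_deriv_t_minus:
  "extended_deriv \<Lambda> (t_minus \<Lambda>) = - extended_deriv (\<lambda>t. \<Lambda> (- t)) (t_plus (\<lambda>t. \<Lambda> (- t)))"
proof -
  interpret r: convex_free_energy "\<lambda>t. \<Lambda> (- t)" "\<lambda>t. - d (- t)"
    by (rule convex_free_energy_reflect) (unfold_locales)
  have S: "{t. \<rho> t \<le> 0} = uminus ` {t. r.\<rho> t \<le> 0}"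
  proof (intro equalityI subsetI)
    fix t assume "t \<in> {t. \<rho> t \<le> 0}"
    then show "t \<in> uminus ` {t. r.\<rho> t \<le> 0}"
      by (intro image_eqI[of _ _ "- t"]) (auto simp: \<rho>_def r.\<rho>_def)
  qed (auto simp: \<rho>_def r.\<rho>_def)
  have "t_minus \<Lambda> = Inf (ereal ` uminus ` {t. r.\<rho> t \<le> 0})"
    by (simp add: t_minus_def deriv_eq S[symmetric] \<rho>_def)
  also have "ereal ` uminus ` {t. r.\<rho> t \<le> 0} = uminus ` ereal ` {t. r.\<rho> t \<le> 0}"
    by (simp add: image_image)
  also have "Inf \<dots> = - t_plus (\<lambda>t. \<Lambda> (- t))"
    by (simp add: ereal_Inf_uminus_image_eq r.t_plus_eq)
  finally have t: "t_minus \<Lambda> = - t_plus (\<lambda>t. \<Lambda> (- t))" .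
  show ?thesis
  proof (cases "t_plus (\<lambda>t. \<Lambda> (- t))")
    case (real x)
    then show ?thesis unfolding t by (simp add: extended_deriv_def deriv_eq r.deriv_eq)
  next
    case PInf
    let ?S = "SUP s. ereal (- d (- s))"
    have "((\<lambda>s. - ereal (- d (- s))) \<longlongrightarrow> - ?S) at_top"
      by (intro tendsto_uminus_ereal r.d_tendsto_SUP)
    then have "((\<lambda>s. ereal (d s)) \<longlongrightarrow> - ?S) at_bot"
      by (simp add: filterlim_at_bot_mirror)
    then have "Lim at_bot (\<lambda>s. ereal (d s)) = - ?S"
      by (intro tendsto_Lim) auto
    then show ?thesis
      unfolding t PInf r.extended_deriv_PInf
      by (simp add: extended_deriv_def deriv_eq flip: MInfty_eq_minfinity)
  next
    case MInf
    have "ereal 0 \<le> t_plus (\<lambda>t. \<Lambda> (- t))"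
      unfolding r.t_plus_eq using r.\<rho>_0 by (intro SUP_upper) auto
    then show ?thesis using MInf by simp
  qed
qed

end

section \<open>Moments of order between one and two\<close>

lemma powr_le_tangent:
  fixes z q :: real
  assumes "0 \<le> z" "0 < q" "q \<le> 1"
  shows "z powr q \<le> 1 + q * (z - 1)"
proof (cases "z = 0")
  case False
  have "z powr q * 1 powr (1 - q) \<le> q * z + (1 - q) * 1"
    by (rule Youngs_inequality_0) (use assms False in auto)
  then show ?thesis by (simp add: algebra_simps)
qed (use assms in simp)

text \<open>Bernoulli's inequality, obtained from the concave case with exponent 1/p at the point
  \<open>1 + p * (z - 1)\<close>.\<close>

lemma powr_ge_tangent:
  fixes z p :: real
  assumes "0 \<le> z" "1 < p"
  shows "1 + p * (z - 1) \<le> z powr p"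
proof (cases "1 + p * (z - 1) \<le> 0")
  case False
  have "(1 + p * (z - 1)) powr (1 / p) \<le> 1 + (1 / p) * ((1 + p * (z - 1)) - 1)"
    by (rule powr_le_tangent) (use assms False in auto)
  then have "(1 + p * (z - 1)) powr (1 / p) \<le> z" using assms by simp
  then have "((1 + p * (z - 1)) powr (1 / p)) powr p \<le> z powr p"
    using assms by (intro powr_mono2) auto
  then show ?thesis using assms False by (simp add: powr_powr)
qed (use assms in \<open>auto intro: order_trans\<close>)

lemma powr_add_subadditive:
  fixes x y q :: real
  assumes "0 \<le> x" "0 \<le> y" "0 < q" "q \<le> 1"
  shows "(x + y) powr q \<le> x powr q + y powr q"
proof (cases "x + y = 0")
  case False
  define z where "z = x + y"
  have z: "0 < z" using False assms by (simp add: z_def)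
  have *: "w / z \<le> (w / z) powr q" if "0 \<le> w" "w \<le> z" for w
  proof (cases "w = 0")
    case False
    then have "(w / z) powr 1 \<le> (w / z) powr q"
      using that z assms by (intro powr_mono') auto
    then show ?thesis using that z by simp
  qed simp
  have "1 = x / z + y / z" using z by (simp add: z_def add_divide_distrib[symmetric])
  also have "\<dots> \<le> (x / z) powr q + (y / z) powr q"
    using * assms by (intro add_mono) (auto simp: z_def)
  also have "\<dots> = (x powr q + y powr q) / z powr q"
    using assms z by (simp add: powr_divide add_divide_distrib)
  finally show ?thesis using z by (simp add: z_def field_simps)
qed (use assms in simp)

text \<open>One factor \<open>s + y\<close> is split off the power. The multiple of \<open>s\<close>
  is estimated by the tangent of the concave power p - 1, the multiple of \<open>y\<close> by
  subadditivity; both need p - 1 \<le> 1.\<close>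

lemma powr_add_le_expansion:
  fixes s y p :: real
  assumes "0 \<le> s" "0 \<le> y" "1 < p" "p \<le> 2"
  shows "(s + y) powr p \<le> s powr p + p * s powr (p - 1) * y + y powr p"
proof (cases "s = 0")
  case False
  then have s: "0 < s" using assms by simp
  have split: "x powr p = x * x powr (p - 1)" if "0 \<le> x" for x
    using that by (cases "x = 0") (simp_all add: powr_diff)
  have "(s + y) powr (p - 1) = s powr (p - 1) * ((s + y) / s) powr (p - 1)"
    using s assms by (simp add: powr_divide)
  also have "\<dots> \<le> s powr (p - 1) * (1 + (p - 1) * ((s + y) / s - 1))"
    using s assms by (intro mult_left_mono powr_le_tangent) auto
  also have "\<dots> = s powr (p - 1) + (p - 1) * s powr (p - 1) * y / s"
    using s by (simp add: field_simps)
  finally have "s * (s + y) powr (p - 1) \<le> s * (s powr (p - 1) + (p - 1) * s powr (p - 1) * y / s)"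
    using s by (intro mult_left_mono) auto
  also have "\<dots> = s powr p + (p - 1) * s powr (p - 1) * y"
    using s by (simp add: split field_simps)
  finally have 1: "s * (s + y) powr (p - 1) \<le> s powr p + (p - 1) * s powr (p - 1) * y" .
  have "y * (s + y) powr (p - 1) \<le> y * (s powr (p - 1) + y powr (p - 1))"
    using assms by (intro mult_left_mono powr_add_subadditive) auto
  also have "\<dots> = y * s powr (p - 1) + y powr p"
    using assms by (simp add: split algebra_simps)
  finally have 2: "y * (s + y) powr (p - 1) \<le> y * s powr (p - 1) + y powr p" .
  have "(s + y) powr p = s * (s + y) powr (p - 1) + y * (s + y) powr (p - 1)"
    using assms by (simp add: split algebra_simps)
  then show ?thesis using 1 2 by (simp add: algebra_simps)
qed (use assms in simp)

lemma powr_add_ge_tangent: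
  fixes s y p :: real
  assumes "0 \<le> s" "0 \<le> y" "1 < p"
  shows "s powr p + p * s powr (p - 1) * y \<le> (s + y) powr p"
proof (cases "s = 0")
  case False
  then have s: "0 < s" using assms by simp
  have "s powr p * (1 + p * ((s + y) / s - 1)) \<le> s powr p * ((s + y) / s) powr p"
    using s assms by (intro mult_left_mono powr_ge_tangent) auto
  also have "\<dots> = (s + y) powr p" using s assms by (simp add: powr_divide)
  finally show ?thesis using s by (simp add: powr_diff field_simps)
qed simp

lemma powr_le_one_plus:
  fixes x p q :: real
  assumes "0 \<le> x" "0 < q" "q \<le> p"
  shows "x powr q \<le> 1 + x powr p"
proof (cases "x \<le> 1")
  case True
  then have "x powr q \<le> 1" using assms by (simp add: powr_le1)
  then show ?thesis by (simp add: add_increasing2)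
next
  case False
  then have "x powr q \<le> x powr p" using assms by (intro powr_mono) auto
  then show ?thesis by simp
qed

context prob_space
begin

lemma expectation_powr_le:
  fixes S :: "'a \<Rightarrow> real"
  assumes S: "integrable M S" "\<And>x. 0 \<le> S x" and q: "0 < q" "q \<le> 1"
    and int: "integrable M (\<lambda>x. S x powr q)"
  shows "(\<integral>x. S x powr q \<partial>M) \<le> (\<integral>x. S x \<partial>M) powr q"
proof (cases "(\<integral>x. S x \<partial>M) = 0")
  case True
  then have "AE x in M. S x = 0"
    using integral_nonneg_eq_0_iff_AE[OF S(1)] S(2) by auto
  then have "(\<integral>x. S x powr q \<partial>M) = (\<integral>x. 0 \<partial>M)"
    using S by (intro integral_cong_AE) auto
  then show ?thesis by simp
next
  case False
  define s where "s = (\<integral>x. S x \<partial>M)"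
  have s: "0 < s" using False S by (simp add: s_def less_le integral_nonneg_AE)
  have "(\<integral>x. S x powr q \<partial>M) \<le> (\<integral>x. s powr q * (1 + q * (S x / s - 1)) \<partial>M)"
  proof (rule integral_mono)
    show "S x powr q \<le> s powr q * (1 + q * (S x / s - 1))" for x
    proof -
      have "S x powr q = s powr q * (S x / s) powr q" using s S by (simp add: powr_divide)
      also have "\<dots> \<le> s powr q * (1 + q * (S x / s - 1))"
        using s S q by (intro mult_left_mono powr_le_tangent) auto
      finally show ?thesis .
    qed
  qed (use S int in auto)
  also have "\<dots> = s powr q * (1 + q * (s / s - 1))"
    using S(1) by (simp add: prob_space s_def)
  finally show ?thesis using s by (simp add: s_def)
qed

text \<open>The summands are peeled off one at a time: the two expansions of \<open>(s + y) powr p\<close> have the same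
  cross term, so the excess of the \<open>p\<close>-th moment over the \<open>p\<close>-th power of the mean is subadditive.\<close>

lemma sum_powr_moment:
  fixes X :: "'i \<Rightarrow> 'a \<Rightarrow> real"
  assumes "finite I" "indep_vars (\<lambda>_. borel) X I" "\<And>i x. i \<in> I \<Longrightarrow> 0 \<le> X i x"
    and p: "1 < p" "p \<le> 2"
    and "\<And>i. i \<in> I \<Longrightarrow> integrable M (X i)" "\<And>i. i \<in> I \<Longrightarrow> integrable M (\<lambda>x. X i x powr p)"
  shows "integrable M (\<lambda>x. (\<Sum>i\<in>I. X i x) powr p)"
    and "(\<integral>x. (\<Sum>i\<in>I. X i x) powr p \<partial>M) \<le>
      (\<Sum>i\<in>I. \<integral>x. X i x powr p \<partial>M) + (\<Sum>i\<in>I. \<integral>x. X i x \<partial>M) powr p"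
proof -
  have "integrable M (\<lambda>x. (\<Sum>i\<in>I. X i x) powr p) \<and> (\<integral>x. (\<Sum>i\<in>I. X i x) powr p \<partial>M) \<le>
      (\<Sum>i\<in>I. \<integral>x. X i x powr p \<partial>M) + (\<Sum>i\<in>I. \<integral>x. X i x \<partial>M) powr p"
    using assms
  proof (induction I rule: finite_induct)
    case (insert i I)
    define S where "S x = (\<Sum>i\<in>I. X i x)" for x
    define s where "s = (\<Sum>i\<in>I. \<integral>x. X i x \<partial>M)"
    define y where "y = (\<integral>x. X i x \<partial>M)"
    have nonneg: "0 \<le> S x" "0 \<le> X i x" for x using insert by (auto simp: S_def intro: sum_nonneg)
    have IH: "integrable M (\<lambda>x. S x powr p)"
      "(\<integral>x. S x powr p \<partial>M) \<le> (\<Sum>i\<in>I. \<integral>x. X i x powr p \<partial>M) + s powr p"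
      using insert.IH indep_vars_subset[OF insert.prems(1), of I] insert.prems
      by (auto simp: S_def s_def)
    have intS: "integrable M S"
      unfolding S_def[abs_def] using insert.prems by (intro Bochner_Integration.integrable_sum) auto
    have ES: "(\<integral>x. S x \<partial>M) = s"
      using insert.prems by (simp add: S_def s_def)
    have intY: "integrable M (X i)" "integrable M (\<lambda>x. X i x powr p)" using insert.prems by auto
    have [measurable]: "S \<in> borel_measurable M" "X i \<in> borel_measurable M" using intS intY by auto
    have intSq: "integrable M (\<lambda>x. S x powr (p - 1))"
    proof (rule Bochner_Integration.integrable_bound)
      show "integrable M (\<lambda>x. 1 + S x powr p)" using IH by simp
      show "AE x in M. norm (S x powr (p - 1)) \<le> norm (1 + S x powr p)"
        using powr_le_one_plus[of _ "p - 1" p] nonneg p by (auto simp: abs_of_nonneg)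
    qed measurable
    have "indep_var borel (X i) borel S"
      unfolding S_def using insert by (intro indep_vars_sum) auto
    then have "indep_var borel ((\<lambda>z. z) \<circ> X i) borel ((\<lambda>z. z powr (p - 1)) \<circ> S)"
      by (rule indep_var_compose) auto
    then have ind: "indep_var borel (X i) borel (\<lambda>x. S x powr (p - 1))"
      by (simp add: o_def)
    have intSY: "integrable M (\<lambda>x. X i x * S x powr (p - 1))"
      by (rule indep_var_integrable[OF ind intY(1) intSq])
    have ESY: "(\<integral>x. X i x * S x powr (p - 1) \<partial>M) = y * (\<integral>x. S x powr (p - 1) \<partial>M)"
      unfolding y_def by (rule indep_var_lebesgue_integral[OF ind intY(1) intSq])
    have s: "0 \<le> s" "0 \<le> y" unfolding s_def y_def
      using insert.prems by (auto intro!: sum_nonneg integral_nonneg_AE)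
    have intR: "integrable M (\<lambda>x. S x powr p + p * (X i x * S x powr (p - 1)) + X i x powr p)"
      using IH intSY intY by simp
    have bound: "(S x + X i x) powr p \<le> S x powr p + p * (X i x * S x powr (p - 1)) + X i x powr p" for x
      using powr_add_le_expansion[of "S x" "X i x" p] nonneg p by (simp add: mult_ac)
    have int: "integrable M (\<lambda>x. (S x + X i x) powr p)"
      by (rule Bochner_Integration.integrable_bound[OF intR])
        (use order_trans[OF bound abs_ge_self] in auto)
    have "(\<integral>x. (S x + X i x) powr p \<partial>M) \<le>
        (\<integral>x. S x powr p + p * (X i x * S x powr (p - 1)) + X i x powr p \<partial>M)"
      by (rule integral_mono[OF int intR bound])
    also have "\<dots> = (\<integral>x. S x powr p \<partial>M) + p * (y * (\<integral>x. S x powr (p - 1) \<partial>M)) + (\<integral>x. X i x powr p \<partial>M)"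
      using IH intSY intY ESY by simp
    \<comment> \<open>Jensen's inequality for the concave power p - 1 replaces the mean of
      \<open>S x powr (p - 1)\<close> by \<open>s powr (p - 1)\<close>.\<close>
    also have "\<dots> \<le> (\<integral>x. S x powr p \<partial>M) + p * (y * s powr (p - 1)) + (\<integral>x. X i x powr p \<partial>M)"
      using expectation_powr_le[OF intS nonneg(1) _ _ intSq] ES s p
      by (intro add_mono mult_left_mono order_refl) auto
    also have "\<dots> \<le> (\<Sum>i\<in>I. \<integral>x. X i x powr p \<partial>M) + (\<integral>x. X i x powr p \<partial>M) + (s powr p + p * s powr (p - 1) * y)"
      using IH(2) by (simp add: mult_ac)
    also have "\<dots> \<le> (\<Sum>i\<in>I. \<integral>x. X i x powr p \<partial>M) + (\<integral>x. X i x powr p \<partial>M) + (s + y) powr p"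
      using powr_add_ge_tangent[OF s p(1)] by simp
    finally show ?case
      using insert.hyps int by (simp add: S_def[symmetric] s_def[symmetric] y_def[symmetric] add.commute)
  qed simp
  then show "integrable M (\<lambda>x. (\<Sum>i\<in>I. X i x) powr p)"
    and "(\<integral>x. (\<Sum>i\<in>I. X i x) powr p \<partial>M) \<le>
      (\<Sum>i\<in>I. \<integral>x. X i x powr p \<partial>M) + (\<Sum>i\<in>I. \<integral>x. X i x \<partial>M) powr p"
    by auto
qed

text \<open>Values below half the mean contribute at most 1/2 to the normalised mean, and those
  above the level \<open>A\<close> at most 1/4 by the p-th moment. The remaining 1/4 must come from
  the event, on which values are charged at most \<open>A\<close>.\<close>

lemma paley_zygmund_powr:
  fixes W :: "'a \<Rightarrow> real"
  assumes W: "integrable M W" "\<And>x. 0 \<le> W x" "(\<integral>x. W x \<partial>M) = \<mu>" "0 < \<mu>"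
    and p: "1 < p" "integrable M (\<lambda>x. W x powr p)" "(\<integral>x. W x powr p \<partial>M) \<le> B * \<mu> powr p" "0 < B"
  shows "1 / (4 * (4 * B) powr (1 / (p - 1))) \<le> prob {x \<in> space M. \<mu> / 2 \<le> W x}"
proof -
  have [measurable]: "W \<in> borel_measurable M" using W by simp
  \<comment> \<open>The level beyond which \<open>V \<le> V powr p / (4 * B)\<close>.\<close>
  define A where "A = (4 * B) powr (1 / (p - 1))"
  have A: "0 < A" using p by (simp add: A_def)
  have Ap: "A powr (p - 1) = 4 * B" using p by (simp add: A_def powr_powr)
  let ?E = "{x \<in> space M. \<mu> / 2 \<le> W x}"
  have E [measurable]: "?E \<in> sets M" by measurable
  define I :: "'a \<Rightarrow> real" where "I = indicator ?E"
  have intI: "integrable M I"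
    unfolding I_def by (rule integrable_real_indicator[OF E]) (simp add: emeasure_eq_measure)
  have EI: "(\<integral>x. I x \<partial>M) = prob ?E" unfolding I_def by simp
  have bound: "W x / \<mu> \<le> 1 / 2 + A * I x + W x powr p / (\<mu> powr p * (4 * B))" if x: "x \<in> space M" for x
  proof -
    define V where "V = W x / \<mu>"
    have V: "0 \<le> V" using W by (simp add: V_def)
    have Vp: "W x powr p / (\<mu> powr p * (4 * B)) = V powr p / (4 * B)"
      using W by (simp add: V_def powr_divide)
    have nn: "0 \<le> V powr p / (4 * B)" using p by simp
    consider "\<not> \<mu> / 2 \<le> W x" | "\<mu> / 2 \<le> W x" "V \<le> A" | "\<mu> / 2 \<le> W x" "A < V" by linarith
    then show ?thesis
    proof cases
      case 1
      then have "V \<le> 1 / 2" using W by (simp add: V_def field_simps)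
      then show ?thesis using nn 1 unfolding I_def Vp V_def[symmetric] by simp
    next
      case 2
      then show ?thesis using nn x 2 unfolding I_def Vp V_def[symmetric] by simp
    next
      case 3
      have "V * (4 * B) \<le> V * V powr (p - 1)"
        using 3 A p V unfolding Ap[symmetric] by (intro mult_left_mono powr_mono2) auto
      also have "\<dots> = V powr p" using 3 A by (simp add: powr_diff)
      finally have "V \<le> V powr p / (4 * B)" using p by (simp add: pos_le_divide_eq)
      moreover have "0 \<le> A * I x" using A by (simp add: I_def)
      ultimately show ?thesis unfolding Vp V_def[symmetric] by linarith
    qed
  qed
  have intR: "integrable M (\<lambda>x. 1 / 2 + A * I x + W x powr p / (\<mu> powr p * (4 * B)))"
    using p intI by (intro Bochner_Integration.integrable_add integrable_mult_right integrable_divide_zero) auto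
  have "1 = (\<integral>x. W x / \<mu> \<partial>M)" using W by simp
  also have "\<dots> \<le> (\<integral>x. 1 / 2 + A * I x + W x powr p / (\<mu> powr p * (4 * B)) \<partial>M)"
    using W intR bound by (intro integral_mono) auto
  also have "\<dots> = 1 / 2 + A * prob ?E + (\<integral>x. W x powr p \<partial>M) / (\<mu> powr p * (4 * B))"
    using p intI EI by (simp add: prob_space)
  also have "\<dots> \<le> 1 / 2 + A * prob ?E + 1 / 4"
    using p W by (simp add: field_simps)
  finally have "1 / 4 \<le> A * prob ?E" by simp
  then show ?thesis unfolding A_def[symmetric] using A by (simp add: field_simps)
qed

end

section \<open>Independently marked trees\<close>

type_synonym mark = "nat \<times> (nat \<Rightarrow> real)"
type_synonym marking = "nat list \<Rightarrow> mark"

abbreviation marking_space :: "marking measure" where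
  "marking_space \<equiv> Pi\<^sub>M UNIV (\<lambda>_. mark_space)"

text \<open>Parametrised by the sequence of laws by generation, so that the law of a subtree is the
  same construction with a shifted sequence.\<close>

definition tree_law :: "(nat \<Rightarrow> mark measure) \<Rightarrow> marking measure" where
  "tree_law \<kappa> = Pi\<^sub>M UNIV (\<lambda>u. \<kappa> (length u))"

definition subtree :: "marking \<Rightarrow> nat list \<Rightarrow> marking" where
  "subtree w u = (\<lambda>v. w (u @ v))"

lemma subtree_append: "subtree (subtree w u) v = subtree w (u @ v)"
  by (simp add: subtree_def)

lemma space_marking [simp]: "space mark_space = UNIV" "space marking_space = UNIV"
  by (simp_all add: mark_space_def space_pair_measure space_PiM)

lemma measurable_mark [measurable]:
  "fst \<in> mark_space \<rightarrow>\<^sub>M count_space UNIV" "(\<lambda>x. snd x i) \<in> borel_measurable mark_space"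
  unfolding mark_space_def by measurable

lemma measurable_eval_marking: "(\<lambda>w. w u) \<in> marking_space \<rightarrow>\<^sub>M mark_space"
  by (rule measurable_component_singleton) simp

lemma measurable_subtree [measurable]: "(\<lambda>w. subtree w u) \<in> marking_space \<rightarrow>\<^sub>M marking_space"
  unfolding subtree_def by (rule measurable_PiM_single') (auto simp: space_PiM)

definition mark_laws :: "(nat \<Rightarrow> mark measure) \<Rightarrow> bool" where
  "mark_laws \<kappa> \<longleftrightarrow> (\<forall>n. \<kappa> n \<in> space (prob_algebra mark_space))"

lemma mark_laws_shift: "mark_laws \<kappa> \<Longrightarrow> mark_laws (\<lambda>n. \<kappa> (k + n))"
  by (simp add: mark_laws_def)

lemma
  assumes "mark_laws \<kappa>"
  shows mark_laws_prob: "prob_space (\<kappa> n)"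
    and mark_laws_sets: "sets (\<kappa> n) = sets mark_space"
  using assms by (auto simp: mark_laws_def space_prob_algebra)

context
  fixes \<kappa> assumes \<kappa>: "mark_laws \<kappa>"
begin

lemma prob_space_tree_law: "prob_space (tree_law \<kappa>)"
  unfolding tree_law_def by (intro prob_space_PiM mark_laws_prob \<kappa>)

lemma sets_tree_law [measurable_cong]: "sets (tree_law \<kappa>) = sets marking_space"
  unfolding tree_law_def by (intro sets_PiM_cong mark_laws_sets \<kappa> refl)

lemma space_tree_law: "space (tree_law \<kappa>) = UNIV"
  using sets_eq_imp_space_eq[OF sets_tree_law] by simp

lemma tree_law_measurable: "f \<in> tree_law \<kappa> \<rightarrow>\<^sub>M N \<longleftrightarrow> f \<in> marking_space \<rightarrow>\<^sub>M N"
  using measurable_cong_sets[OF sets_tree_law refl] by auto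

lemma distr_subtree:
  "distr (tree_law \<kappa>) marking_space (\<lambda>w. subtree w u) = tree_law (\<lambda>n. \<kappa> (length u + n))"
proof -
  have "distr (tree_law \<kappa>) (Pi\<^sub>M UNIV (\<lambda>v. \<kappa> (length (u @ v)))) (\<lambda>w. \<lambda>v\<in>UNIV. w (u @ v)) =
      Pi\<^sub>M UNIV (\<lambda>v. \<kappa> (length (u @ v)))"
    unfolding tree_law_def
    by (rule distr_PiM_reindex) (auto simp: mark_laws_prob[OF \<kappa>] inj_on_def)
  moreover have "sets (Pi\<^sub>M UNIV (\<lambda>v. \<kappa> (length (u @ v)))) = sets marking_space"
    by (intro sets_PiM_cong mark_laws_sets \<kappa> refl)
  ultimately show ?thesis
    by (simp add: subtree_def tree_law_def restrict_UNIV cong: distr_cong)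
qed

lemma distr_eval: "distr (tree_law \<kappa>) mark_space (\<lambda>w. w u) = \<kappa> (length u)"
proof -
  have "distr (tree_law \<kappa>) (\<kappa> (length u)) (\<lambda>w. w u) = \<kappa> (length u)"
    unfolding tree_law_def by (rule distr_PiM_component) (auto simp: mark_laws_prob[OF \<kappa>])
  then show ?thesis
    using mark_laws_sets[OF \<kappa>, of "length u"] by (simp cong: distr_cong)
qed

text \<open>Overwriting the root by an independent sample does not change the law. This plays the
  part of conditioning on the first reproduction.\<close>

lemma nn_integral_root:
  assumes [measurable]: "G \<in> borel_measurable marking_space"
  shows "(\<integral>\<^sup>+w. G w \<partial>tree_law \<kappa>) = (\<integral>\<^sup>+x. \<integral>\<^sup>+w. G (w([] := x)) \<partial>tree_law \<kappa> \<partial>\<kappa> 0)"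
proof -
  note [measurable_cong] = mark_laws_sets[OF \<kappa>]
  interpret T: prob_space "tree_law \<kappa>" by (rule prob_space_tree_law)
  have [measurable]: "(\<lambda>(x, w). w([] := x)) \<in> \<kappa> 0 \<Otimes>\<^sub>M tree_law \<kappa> \<rightarrow>\<^sub>M marking_space"
    unfolding split_beta'
    by (rule measurable_PiM_single') (auto simp: space_PiM fun_upd_def)
  have "distr (\<kappa> 0 \<Otimes>\<^sub>M tree_law \<kappa>) marking_space (\<lambda>(x, w). w([] := x)) =
      distr (\<kappa> 0 \<Otimes>\<^sub>M tree_law \<kappa>) (tree_law \<kappa>) (\<lambda>(x, w). w([] := x))"
    by (intro distr_cong sets_tree_law[symmetric] refl)
  also have "\<dots> = tree_law \<kappa>"
    using distr_pair_PiM_eq_PiM[of UNIV "\<lambda>u. \<kappa> (length u)" "[]"] mark_laws_prob[OF \<kappa>]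
    by (simp add: tree_law_def)
  finally have "(\<integral>\<^sup>+w. G w \<partial>tree_law \<kappa>) =
      (\<integral>\<^sup>+w. G w \<partial>distr (\<kappa> 0 \<Otimes>\<^sub>M tree_law \<kappa>) marking_space (\<lambda>(x, w). w([] := x)))"
    by simp
  also have "\<dots> = (\<integral>\<^sup>+y. G ((snd y)([] := fst y)) \<partial>(\<kappa> 0 \<Otimes>\<^sub>M tree_law \<kappa>))"
    by (subst nn_integral_distr) (auto simp: split_beta')
  also have "\<dots> = (\<integral>\<^sup>+x. \<integral>\<^sup>+w. G (w([] := x)) \<partial>tree_law \<kappa> \<partial>\<kappa> 0)"
    by (subst T.nn_integral_fst[symmetric]) (auto simp: split_beta')
  finally show ?thesis .
qed

lemma nn_integral_subtree:
  assumes "G \<in> borel_measurable marking_space"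
  shows "(\<integral>\<^sup>+w. G (subtree w u) \<partial>tree_law \<kappa>) = (\<integral>\<^sup>+w. G w \<partial>tree_law (\<lambda>n. \<kappa> (length u + n)))"
  unfolding distr_subtree[symmetric]
  by (subst nn_integral_distr) (use assms in \<open>auto simp: tree_law_measurable\<close>)

lemma indep_eval: "prob_space.indep_vars (tree_law \<kappa>) (\<lambda>_. mark_space) (\<lambda>u w. w u) UNIV"
proof -
  interpret prob_space "tree_law \<kappa>" by (rule prob_space_tree_law)
  have "distr (tree_law \<kappa>) marking_space (\<lambda>w. \<lambda>u\<in>UNIV. w u) = tree_law \<kappa>"
    by (simp add: distr_id2 sets_tree_law restrict_UNIV)
  also have "\<dots> = (\<Pi>\<^sub>M u\<in>UNIV. distr (tree_law \<kappa>) mark_space (\<lambda>w. w u))"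
    unfolding distr_eval by (simp add: tree_law_def)
  finally show ?thesis
    by (subst indep_vars_iff_distr_eq_PiM) (auto simp: tree_law_measurable)
qed

lemma indep_vars_tree:
  assumes "disjoint_family_on J L"
    and "\<And>j. j \<in> L \<Longrightarrow> F j \<in> Pi\<^sub>M (J j) (\<lambda>_. mark_space) \<rightarrow>\<^sub>M N j"
  shows "prob_space.indep_vars (tree_law \<kappa>) N (\<lambda>j w. F j (restrict w (J j))) L"
proof -
  interpret prob_space "tree_law \<kappa>" by (rule prob_space_tree_law)
  have "indep_vars (\<lambda>j. Pi\<^sub>M (J j) (\<lambda>_. mark_space)) (\<lambda>j w. restrict (\<lambda>u. w u) (J j)) L"
    by (rule indep_vars_restrict[OF indep_eval]) (use assms in auto)
  from indep_vars_compose2[OF this assms(2)] show ?thesis by simp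
qed

lemma indep_vars_subtree:
  assumes "\<And>i. F i \<in> marking_space \<rightarrow>\<^sub>M N i"
  shows "prob_space.indep_vars (tree_law \<kappa>) N (\<lambda>i w. F i (subtree w [i])) L"
proof -
  have "(\<lambda>f. F i (\<lambda>v. f (i # v))) \<in> Pi\<^sub>M {i # v |v. True} (\<lambda>_. mark_space) \<rightarrow>\<^sub>M N i" for i
    by (rule measurable_compose[OF _ assms], rule measurable_PiM_single')
      (auto simp: space_PiM intro!: measurable_component_singleton)
  from indep_vars_tree[where F = "\<lambda>i f. F i (\<lambda>v. f (i # v))" and N = N and J = "\<lambda>i. {i # v |v. True}", OF _ this]
  have "prob_space.indep_vars (tree_law \<kappa>) N (\<lambda>i w. F i (\<lambda>v. restrict w {i # v |v. True} (i # v))) L"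
    by (auto simp: disjoint_family_on_def)
  then show ?thesis by (simp add: subtree_def)
qed

end

section \<open>Weighted sums over marked trees and their moments\<close>

primrec weight_sum :: "(mark \<Rightarrow> nat) \<Rightarrow> (nat \<Rightarrow> mark \<Rightarrow> real) \<Rightarrow> nat \<Rightarrow> marking \<Rightarrow> real" where
  "weight_sum c a 0 w = 1"
| "weight_sum c a (Suc n) w = (\<Sum>i<c (w []). a i (w []) * weight_sum c a n (subtree w [i]))"

text \<open>Instantiated with the exponential weights, with their truncation, and with absolute
  displacements along first children. As \<open>weight_sum\<close> recurses at the root, every
  summand is a root weight times a sum over an independent subtree.\<close>

locale weights =
  fixes c :: "mark \<Rightarrow> nat" and a :: "nat \<Rightarrow> mark \<Rightarrow> real"
  assumes c_measurable [measurable]: "c \<in> mark_space \<rightarrow>\<^sub>M count_space UNIV"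
    and a_measurable [measurable]: "\<And>i. a i \<in> borel_measurable mark_space"
    and a_nonneg: "\<And>i x. 0 \<le> a i x"
begin

abbreviation Y :: "nat \<Rightarrow> marking \<Rightarrow> real" where "Y \<equiv> weight_sum c a"

definition total :: "mark \<Rightarrow> real" where
  "total x = (\<Sum>i<c x. a i x)"

definition powr_total :: "real \<Rightarrow> mark \<Rightarrow> real" where
  "powr_total p x = (\<Sum>i<c x. a i x powr p)"

lemma total_measurable [measurable]: "total \<in> borel_measurable mark_space"
  unfolding total_def
  by (rule measurable_compose_countable[where g = c]) auto

lemma powr_total_measurable [measurable]: "powr_total p \<in> borel_measurable mark_space"
  unfolding powr_total_def
  by (rule measurable_compose_countable[where g = c]) auto

lemma Y_measurable [measurable]: "Y n \<in> borel_measurable marking_space"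
proof (induction n)
  case (Suc n)
  note [measurable] = Suc
  have "(\<lambda>w. \<Sum>i<k. a i (w []) * Y n (subtree w [i])) \<in> borel_measurable marking_space" for k
    by measurable
  then show ?case unfolding weight_sum.simps
    by (rule measurable_compose_countable[where g = "\<lambda>w. c (w [])"]) measurable
qed simp

lemma Y_nonneg: "0 \<le> Y n w"
  by (induction n arbitrary: w) (auto intro!: sum_nonneg mult_nonneg_nonneg a_nonneg)

lemma total_nonneg: "0 \<le> total x" and powr_total_nonneg: "0 \<le> powr_total p x"
  by (auto simp: total_def powr_total_def intro!: sum_nonneg a_nonneg)

lemma Y_Suc_root: "Y (Suc n) (w([] := x)) = (\<Sum>i<c x. a i x * Y n (subtree w [i]))"
  by (simp add: subtree_def)

text \<open>Each reproduction splits off one factor. The induction ranges over all sequences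
  \<open>\<kappa>\<close>, since the subtrees see the shifted one.\<close>

lemma first_moment:
  assumes "mark_laws \<kappa>"
  shows "(\<integral>\<^sup>+w. Y n w \<partial>tree_law \<kappa>) = (\<Prod>k<n. \<integral>\<^sup>+x. total x \<partial>\<kappa> k)"
  using assms
proof (induction n arbitrary: \<kappa>)
  case 0
  then show ?case using prob_space.emeasure_space_1[OF prob_space_tree_law] by simp
next
  case (Suc n)
  note \<kappa> = Suc.prems
  note [measurable_cong] = sets_tree_law[OF \<kappa>] mark_laws_sets[OF \<kappa>]
  let ?\<mu> = "\<integral>\<^sup>+w. Y n w \<partial>tree_law (\<lambda>n. \<kappa> (1 + n))"
  have *: "(\<integral>\<^sup>+w. ennreal (Y (Suc n) (w([] := x))) \<partial>tree_law \<kappa>) = total x * ?\<mu>" for x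
  proof -
    have "(\<integral>\<^sup>+w. ennreal (Y (Suc n) (w([] := x))) \<partial>tree_law \<kappa>) =
        (\<integral>\<^sup>+w. (\<Sum>i<c x. ennreal (a i x) * ennreal (Y n (subtree w [i]))) \<partial>tree_law \<kappa>)"
      unfolding Y_Suc_root
      by (subst sum_ennreal[symmetric]) (auto simp: ennreal_mult a_nonneg Y_nonneg)
    also have "\<dots> = (\<Sum>i<c x. ennreal (a i x) * (\<integral>\<^sup>+w. ennreal (Y n (subtree w [i])) \<partial>tree_law \<kappa>))"
      by (subst nn_integral_sum, measurable) (simp add: nn_integral_cmult)
    also have "\<dots> = (\<Sum>i<c x. ennreal (a i x) * ?\<mu>)"
      by (simp add: nn_integral_subtree[OF \<kappa>, where G = "\<lambda>w. ennreal (Y n w)"])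
    also have "\<dots> = total x * ?\<mu>"
      by (simp add: total_def a_nonneg sum_distrib_right[symmetric])
    finally show ?thesis .
  qed
  have "(\<integral>\<^sup>+w. Y (Suc n) w \<partial>tree_law \<kappa>) = (\<integral>\<^sup>+x. \<integral>\<^sup>+w. Y (Suc n) (w([] := x)) \<partial>tree_law \<kappa> \<partial>\<kappa> 0)"
    by (rule nn_integral_root[OF \<kappa>, where G = "\<lambda>w. ennreal (Y (Suc n) w)"])
      (rule measurable_compose[OF Y_measurable measurable_ennreal])
  also have "\<dots> = (\<integral>\<^sup>+x. total x * ?\<mu> \<partial>\<kappa> 0)"
    by (simp only: *)
  also have "\<dots> = (\<integral>\<^sup>+x. total x \<partial>\<kappa> 0) * ?\<mu>"
    by (rule nn_integral_multc) measurable
  also have "?\<mu> = (\<Prod>k<n. \<integral>\<^sup>+x. total x \<partial>\<kappa> (1 + k))"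
    using mark_laws_shift[OF \<kappa>] by (rule Suc.IH)
  finally show ?case by (subst prod.lessThan_Suc_shift) simp
qed

lemma first_moment_integral:
  assumes \<kappa>: "mark_laws \<kappa>"
    and int: "\<And>k. integrable (\<kappa> k) total" and m: "\<And>k. (\<integral>x. total x \<partial>\<kappa> k) = m k"
  shows "integrable (tree_law \<kappa>) (Y n)" and "(\<integral>w. Y n w \<partial>tree_law \<kappa>) = (\<Prod>k<n. m k)"
proof -
  have m0: "0 \<le> m k" for k
    unfolding m[symmetric] by (rule integral_nonneg_AE) (simp add: total_nonneg)
  have "(\<integral>\<^sup>+x. total x \<partial>\<kappa> k) = ennreal (m k)" for k
    using int m by (subst nn_integral_eq_integral) (auto simp: total_nonneg)
  then have "(\<integral>\<^sup>+w. Y n w \<partial>tree_law \<kappa>) = ennreal (\<Prod>k<n. m k)"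
    using first_moment[OF \<kappa>, of n] m0 by (simp add: prod_ennreal)
  then have "has_bochner_integral (tree_law \<kappa>) (Y n) (\<Prod>k<n. m k)"
    by (intro has_bochner_integral_nn_integral)
      (auto simp: tree_law_measurable[OF \<kappa>] Y_nonneg m0 prod_nonneg)
  then show "integrable (tree_law \<kappa>) (Y n)" and "(\<integral>w. Y n w \<partial>tree_law \<kappa>) = (\<Prod>k<n. m k)"
    by (auto simp: has_bochner_integral_iff)
qed

text \<open>After division by \<open>m k powr p\<close> the second condition on \<open>H\<close>
  says that \<open>H\<close> is a supersolution of the recursion for the normalised p-th moments:
  the independent subtrees contribute \<open>\<alpha> k\<close> times the moment one generation
  later, the conditional mean contributes \<open>\<beta> k\<close>. Generation 0 is covered by
  \<open>1 \<le> H k\<close>, and \<open>H 0\<close> does not depend on \<open>n\<close>.\<close>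

lemma moment_bound:
  fixes \<alpha> \<beta> m H :: "nat \<Rightarrow> real"
  assumes \<kappa>: "mark_laws \<kappa>" and p: "1 < p" "p \<le> 2"
    and m: "\<And>k. integrable (\<kappa> k) total" "\<And>k. (\<integral>x. total x \<partial>\<kappa> k) = m k"
    and \<alpha>: "\<And>k. (\<integral>\<^sup>+x. powr_total p x \<partial>\<kappa> k) \<le> ennreal (\<alpha> k)" "\<And>k. 0 \<le> \<alpha> k"
    and \<beta>: "\<And>k. (\<integral>\<^sup>+x. total x powr p \<partial>\<kappa> k) \<le> ennreal (\<beta> k)" "\<And>k. 0 \<le> \<beta> k"
    and H: "\<And>k. 1 \<le> H k" "\<And>k. \<alpha> k * H (Suc k) + \<beta> k \<le> H k * m k powr p"
  shows "(\<integral>\<^sup>+w. Y n w powr p \<partial>tree_law \<kappa>) \<le> ennreal (H 0 * (\<Prod>k<n. m k) powr p)"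
  using \<kappa> m \<alpha> \<beta> H
proof (induction n arbitrary: \<kappa> m \<alpha> \<beta> H)
  case (0 \<kappa>)
  then show ?case
    using prob_space.emeasure_space_1[OF prob_space_tree_law[OF 0(1)]] by simp
next
  case (Suc n \<kappa> m \<alpha> \<beta> H)
  note \<kappa> = Suc.prems(1) and m = Suc.prems(2,3) and \<alpha> = Suc.prems(4,5)
    and \<beta> = Suc.prems(6,7) and H = Suc.prems(8,9)
  note [measurable_cong] = sets_tree_law[OF \<kappa>] mark_laws_sets[OF \<kappa>]
  define \<kappa>' where "\<kappa>' = (\<lambda>k. \<kappa> (Suc k))"
  have \<kappa>': "mark_laws \<kappa>'" using mark_laws_shift[OF \<kappa>, of 1] by (simp add: \<kappa>'_def)
  interpret T: prob_space "tree_law \<kappa>" by (rule prob_space_tree_law[OF \<kappa>])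
  define \<mu> where "\<mu> = (\<Prod>k<n. m (Suc k))"
  define V where "V = H 1 * \<mu> powr p"
  have m_nonneg: "0 \<le> m k" for k
    unfolding m(2)[symmetric] by (rule integral_nonneg_AE) (simp add: total_nonneg)
  have \<mu>: "0 \<le> \<mu>" unfolding \<mu>_def by (intro prod_nonneg) (simp add: m_nonneg)
  have V: "0 \<le> V" unfolding V_def using H(1)[of 1] by simp
  have IH: "(\<integral>\<^sup>+w. Y n w powr p \<partial>tree_law \<kappa>') \<le> ennreal V"
    unfolding V_def \<mu>_def One_nat_def
    by (rule Suc.IH[OF \<kappa>', where \<alpha> = "\<lambda>k. \<alpha> (Suc k)" and \<beta> = "\<lambda>k. \<beta> (Suc k)"])
      (use m \<alpha> \<beta> H in \<open>simp_all add: \<kappa>'_def\<close>)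
  have sub: "(\<integral>\<^sup>+w. ennreal (f (subtree w [i])) \<partial>tree_law \<kappa>) = (\<integral>\<^sup>+w. ennreal (f w) \<partial>tree_law \<kappa>')"
    if [measurable]: "f \<in> borel_measurable marking_space" for f i
    using nn_integral_subtree[OF \<kappa>, of "\<lambda>w. ennreal (f w)" "[i]"] by (simp add: \<kappa>'_def)
  have intY: "integrable (tree_law \<kappa>) (\<lambda>w. Y n (subtree w [i]))"
    and EY: "(\<integral>w. Y n (subtree w [i]) \<partial>tree_law \<kappa>) = \<mu>" for i
  proof -
    have "(\<integral>\<^sup>+w. ennreal (Y n (subtree w [i])) \<partial>tree_law \<kappa>) = ennreal \<mu>"
      using first_moment_integral[OF \<kappa>', of "\<lambda>k. m (Suc k)" n] m
      by (simp add: sub nn_integral_eq_integral Y_nonneg \<kappa>'_def \<mu>_def)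
    then have "has_bochner_integral (tree_law \<kappa>) (\<lambda>w. Y n (subtree w [i])) \<mu>"
      by (intro has_bochner_integral_nn_integral) (auto simp: Y_nonneg \<mu>)
    then show "integrable (tree_law \<kappa>) (\<lambda>w. Y n (subtree w [i]))"
      and "(\<integral>w. Y n (subtree w [i]) \<partial>tree_law \<kappa>) = \<mu>"
      by (auto simp: has_bochner_integral_iff)
  qed
  have intYp: "integrable (tree_law \<kappa>) (\<lambda>w. Y n (subtree w [i]) powr p)"
    and EYp: "(\<integral>w. Y n (subtree w [i]) powr p \<partial>tree_law \<kappa>) \<le> V" for i
  proof -
    have *: "(\<integral>\<^sup>+w. ennreal (Y n (subtree w [i]) powr p) \<partial>tree_law \<kappa>) \<le> ennreal V"
      using sub[of "\<lambda>w. Y n w powr p" i] IH by simp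
    then show int: "integrable (tree_law \<kappa>) (\<lambda>w. Y n (subtree w [i]) powr p)"
      by (intro integrableI_nonneg) (auto intro: le_less_trans)
    show "(\<integral>w. Y n (subtree w [i]) powr p \<partial>tree_law \<kappa>) \<le> V"
      using * V nn_integral_eq_integral[OF int] by simp
  qed
  \<comment> \<open>Given the root mark \<open>x\<close> the subtrees are independent, and their
    p-th moments separate from the p-th power of the conditional mean
    \<open>total x * \<mu>\<close>.\<close>
  have inner: "(\<integral>\<^sup>+w. ennreal (Y (Suc n) (w([] := x)) powr p) \<partial>tree_law \<kappa>) \<le>
      ennreal V * ennreal (powr_total p x) + ennreal (\<mu> powr p) * ennreal (total x powr p)" for x
  proof -
    let ?X = "\<lambda>i w. a i x * Y n (subtree w [i])"
    have ind: "T.indep_vars (\<lambda>_. borel) ?X {..<c x}"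
      by (rule indep_vars_subtree[OF \<kappa>]) measurable
    have Xp: "?X i w powr p = a i x powr p * Y n (subtree w [i]) powr p" for i w
      by (simp add: powr_mult a_nonneg Y_nonneg)
    have int: "integrable (tree_law \<kappa>) (?X i)" "integrable (tree_law \<kappa>) (\<lambda>w. ?X i w powr p)" for i
      unfolding Xp using intY intYp by auto
    note mom = T.sum_powr_moment[OF finite_lessThan ind _ p int]
    have "(\<integral>w. (\<Sum>i<c x. ?X i w) powr p \<partial>tree_law \<kappa>) \<le>
        (\<Sum>i<c x. \<integral>w. ?X i w powr p \<partial>tree_law \<kappa>) + (\<Sum>i<c x. \<integral>w. ?X i w \<partial>tree_law \<kappa>) powr p"
      by (rule mom(2)) (simp add: a_nonneg Y_nonneg)
    also have "\<dots> = (\<Sum>i<c x. a i x powr p * (\<integral>w. Y n (subtree w [i]) powr p \<partial>tree_law \<kappa>)) + (total x * \<mu>) powr p"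
      unfolding Xp by (simp add: EY total_def sum_distrib_right)
    also have "\<dots> \<le> (\<Sum>i<c x. a i x powr p * V) + (total x * \<mu>) powr p"
      by (intro add_mono sum_mono mult_left_mono EYp) auto
    also have "\<dots> = V * powr_total p x + \<mu> powr p * total x powr p"
      by (simp add: powr_total_def sum_distrib_left mult.commute powr_mult total_nonneg \<mu>)
    finally have le: "(\<integral>w. (\<Sum>i<c x. ?X i w) powr p \<partial>tree_law \<kappa>) \<le> V * powr_total p x + \<mu> powr p * total x powr p" .
    have "(\<integral>\<^sup>+w. ennreal (Y (Suc n) (w([] := x)) powr p) \<partial>tree_law \<kappa>) =
        ennreal (\<integral>w. (\<Sum>i<c x. ?X i w) powr p \<partial>tree_law \<kappa>)"
      unfolding Y_Suc_root
      by (rule nn_integral_eq_integral, rule mom(1)) (auto simp: a_nonneg Y_nonneg)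
    also have "\<dots> \<le> ennreal (V * powr_total p x + \<mu> powr p * total x powr p)"
      by (rule ennreal_leI[OF le])
    also have "\<dots> = ennreal V * ennreal (powr_total p x) + ennreal (\<mu> powr p) * ennreal (total x powr p)"
      using V by (simp add: ennreal_plus ennreal_mult powr_total_nonneg)
    finally show ?thesis .
  qed
  have "(\<integral>\<^sup>+w. Y (Suc n) w powr p \<partial>tree_law \<kappa>) =
      (\<integral>\<^sup>+x. \<integral>\<^sup>+w. Y (Suc n) (w([] := x)) powr p \<partial>tree_law \<kappa> \<partial>\<kappa> 0)"
    by (rule nn_integral_root[OF \<kappa>, where G = "\<lambda>w. ennreal (Y (Suc n) w powr p)"]) measurable
  also have "\<dots> \<le> (\<integral>\<^sup>+x. ennreal V * ennreal (powr_total p x) + ennreal (\<mu> powr p) * ennreal (total x powr p) \<partial>\<kappa> 0)"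
    by (intro nn_integral_mono inner)
  also have "\<dots> = ennreal V * (\<integral>\<^sup>+x. powr_total p x \<partial>\<kappa> 0) + ennreal (\<mu> powr p) * (\<integral>\<^sup>+x. total x powr p \<partial>\<kappa> 0)"
    by (subst nn_integral_add, measurable) (subst nn_integral_cmult, measurable)+
  also have "\<dots> \<le> ennreal V * ennreal (\<alpha> 0) + ennreal (\<mu> powr p) * ennreal (\<beta> 0)"
    by (intro add_mono mult_left_mono \<alpha> \<beta>) auto
  also have "\<dots> = ennreal (\<mu> powr p * (\<alpha> 0 * H 1 + \<beta> 0))"
    using V \<alpha>(2)[of 0] \<beta>(2)[of 0] by (simp add: ennreal_mult[symmetric] ennreal_plus[symmetric] V_def algebra_simps del: ennreal_plus)
  also have "\<dots> \<le> ennreal (\<mu> powr p * (H 0 * m 0 powr p))"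
    using H(2)[of 0] by (intro ennreal_leI mult_left_mono) auto
  also have "\<mu> powr p * (H 0 * m 0 powr p) = H 0 * (\<Prod>k<Suc n. m k) powr p"
    by (subst prod.lessThan_Suc_shift) (simp add: powr_mult \<mu>_def[symmetric] \<mu> m_nonneg)
  finally show ?case .
qed

text \<open>The bound sees the laws only through \<open>p\<close> and \<open>B\<close>, hence is the
  same for all heights \<open>n\<close> and for all environments with
  \<open>H 0 \<le> B\<close>.\<close>

lemma survival_bound:
  fixes \<alpha> \<beta> m H :: "nat \<Rightarrow> real"
  assumes \<kappa>: "mark_laws \<kappa>" and p: "1 < p" "p \<le> 2"
    and m: "\<And>k. integrable (\<kappa> k) total" "\<And>k. (\<integral>x. total x \<partial>\<kappa> k) = m k" "\<And>k. 0 < m k"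
    and \<alpha>: "\<And>k. (\<integral>\<^sup>+x. powr_total p x \<partial>\<kappa> k) \<le> ennreal (\<alpha> k)" "\<And>k. 0 \<le> \<alpha> k"
    and \<beta>: "\<And>k. (\<integral>\<^sup>+x. total x powr p \<partial>\<kappa> k) \<le> ennreal (\<beta> k)" "\<And>k. 0 \<le> \<beta> k"
    and H: "\<And>k. 1 \<le> H k" "\<And>k. \<alpha> k * H (Suc k) + \<beta> k \<le> H k * m k powr p" "H 0 \<le> B"
  shows "1 / (4 * (4 * B) powr (1 / (p - 1))) \<le> measure (tree_law \<kappa>) {w. (\<Prod>k<n. m k) / 2 \<le> Y n w}"
proof -
  interpret T: prob_space "tree_law \<kappa>" by (rule prob_space_tree_law[OF \<kappa>])
  note [measurable_cong] = sets_tree_law[OF \<kappa>]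
  let ?\<mu> = "\<Prod>k<n. m k"
  have \<mu>: "0 < ?\<mu>" using m(3) by (intro prod_pos) auto
  have B: "1 \<le> B" using H(1)[of 0] H(3) by linarith
  have "(\<integral>\<^sup>+w. Y n w powr p \<partial>tree_law \<kappa>) \<le> ennreal (H 0 * ?\<mu> powr p)"
    by (rule moment_bound[OF \<kappa> p m(1,2) \<alpha> \<beta> H(1,2)])
  also have "\<dots> \<le> ennreal (B * ?\<mu> powr p)"
    using H(3) by (intro ennreal_leI mult_right_mono) auto
  finally have le: "(\<integral>\<^sup>+w. Y n w powr p \<partial>tree_law \<kappa>) \<le> ennreal (B * ?\<mu> powr p)" .
  then have int: "integrable (tree_law \<kappa>) (\<lambda>w. Y n w powr p)"
    by (intro integrableI_nonneg) (auto intro: le_less_trans)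
  have "(\<integral>w. Y n w powr p \<partial>tree_law \<kappa>) \<le> B * ?\<mu> powr p"
    using le B nn_integral_eq_integral[OF int] by simp
  from T.paley_zygmund_powr[OF _ Y_nonneg _ \<mu> p(1) int this] first_moment_integral[OF \<kappa> m(1,2), of n] B
  show ?thesis by (simp add: space_tree_law[OF \<kappa>])
qed

end

section \<open>Independent trials along the line of first children\<close>

context
  fixes \<kappa> assumes \<kappa>: "mark_laws \<kappa>"
begin

interpretation T: prob_space "tree_law \<kappa>" by (rule prob_space_tree_law[OF \<kappa>])

text \<open>By \<open>uv\<close> the vertex \<open>u\<close> lies outside the subtree at
  \<open>u'\<close>, so the two events read disjoint sets of marks.\<close>

lemma prob_eval_subtree:
  assumes C: "C \<in> sets mark_space" and B: "B \<in> sets marking_space" and uv: "\<And>v. u' @ v \<noteq> u"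
  shows "T.prob {w. w u \<in> C \<and> subtree w u' \<in> B} =
    measure (\<kappa> (length u)) C * measure (tree_law (\<lambda>n. \<kappa> (length u' + n))) B"
proof -
  note [measurable_cong] = sets_tree_law[OF \<kappa>]
  note [measurable] = C B
  let ?J = "case_bool {u} {u' @ v |v. True}"
  let ?F = "case_bool (\<lambda>f. f u \<in> C) (\<lambda>f. (\<lambda>v. f (u' @ v)) \<in> B)"
  let ?G = "case_bool (\<lambda>w. w u \<in> C) (\<lambda>w. subtree w u' \<in> B)"
  have [measurable]: "(\<lambda>f. f u) \<in> Pi\<^sub>M {u} (\<lambda>_. mark_space) \<rightarrow>\<^sub>M mark_space"
    by (rule measurable_component_singleton) simp
  have [measurable]: "(\<lambda>f v. f (u' @ v)) \<in> Pi\<^sub>M {u' @ v |v. True} (\<lambda>_. mark_space) \<rightarrow>\<^sub>M marking_space"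
    by (rule measurable_PiM_single') (auto simp: space_PiM intro!: measurable_component_singleton)
  have "(\<lambda>f. f u \<in> C) \<in> Pi\<^sub>M {u} (\<lambda>_. mark_space) \<rightarrow>\<^sub>M count_space UNIV"
    and "(\<lambda>f. (\<lambda>v. f (u' @ v)) \<in> B) \<in> Pi\<^sub>M {u' @ v |v. True} (\<lambda>_. mark_space) \<rightarrow>\<^sub>M count_space UNIV"
    by measurable
  then have "T.indep_vars (\<lambda>_. count_space UNIV) (\<lambda>j w. ?F j (restrict w (?J j))) UNIV"
    using uv by (intro indep_vars_tree[OF \<kappa>])
      (auto simp: disjoint_family_on_def split: bool.splits)
  also have "(\<lambda>j w. ?F j (restrict w (?J j))) = ?G"
    by (auto simp: fun_eq_iff subtree_def split: bool.split)
  finally have "T.prob (\<Inter>j\<in>UNIV. ?G j -` {True} \<inter> space (tree_law \<kappa>)) =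
      (\<Prod>j\<in>UNIV. T.prob (?G j -` {True} \<inter> space (tree_law \<kappa>)))"
    by (rule T.indep_varsD_finite) auto
  then have "T.prob {w. w u \<in> C \<and> subtree w u' \<in> B} =
      T.prob ((\<lambda>w. w u) -` C \<inter> space (tree_law \<kappa>)) *
      T.prob ((\<lambda>w. subtree w u') -` B \<inter> space (tree_law \<kappa>))"
    by (simp add: UNIV_bool space_tree_law[OF \<kappa>] vimage_def Collect_conj_eq Int_commute mult.commute)
  also have "T.prob ((\<lambda>w. w u) -` C \<inter> space (tree_law \<kappa>)) = measure (\<kappa> (length u)) C"
    unfolding distr_eval[OF \<kappa>, of u, symmetric]
    by (rule measure_distr[symmetric]) (auto simp: tree_law_measurable[OF \<kappa>] measurable_eval_marking)
  also have "T.prob ((\<lambda>w. subtree w u') -` B \<inter> space (tree_law \<kappa>)) =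
      measure (tree_law (\<lambda>n. \<kappa> (length u' + n))) B"
    unfolding distr_subtree[OF \<kappa>, of u', symmetric] by (rule measure_distr[symmetric]) auto
  finally show ?thesis .
qed

text \<open>The second children of the line of first children root disjoint subtrees.\<close>

lemma spine_failure:
  assumes C: "C \<in> sets mark_space" and B: "\<And>j. B j \<in> sets marking_space"
  shows "T.prob {w. \<forall>j<k. \<not> (w (replicate j 0) \<in> C \<and> subtree w (replicate j 0 @ [1]) \<in> B j)} =
    (\<Prod>j<k. 1 - measure (\<kappa> j) C * measure (tree_law (\<lambda>n. \<kappa> (Suc j + n))) (B j))"
proof (cases "k = 0")
  case False
  note [measurable_cong] = sets_tree_law[OF \<kappa>]
  note [measurable] = C B
  \<comment> \<open>The marks read by trial \<open>j\<close>: its vertex on the line of first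
    children, and everything from that vertex's second child downwards.\<close>
  define J :: "nat \<Rightarrow> nat list set" where "J j = insert (replicate j 0) {replicate j 0 @ 1 # v |v. True}" for j
  define F where "F j f = (f (replicate j 0) \<in> C \<and> (\<lambda>v. f (replicate j 0 @ 1 # v)) \<in> B j)"
    for j and f :: marking
  have disj: "disjoint_family_on J {..<k}"
  proof (unfold disjoint_family_on_def, intro ballI impI)
    fix i j :: nat assume "i \<noteq> j"
    \<comment> \<open>The number of leading zeros of an address recovers \<open>j\<close>, which
      separates the blocks.\<close>
    have zeros: "takeWhile (\<lambda>x. x = 0) (replicate i 0 @ 1 # v) = replicate i (0 :: nat)" for i v
      by (subst takeWhile_append2) auto
    have 1: "replicate i 0 @ 1 # v \<noteq> replicate j 0 @ 1 # (v' :: nat list)" for v v'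
      using zeros[of i v] zeros[of j v'] \<open>i \<noteq> j\<close> by (metis length_replicate)
    have 2: "replicate i 0 @ 1 # v \<noteq> replicate j (0 :: nat)" for i j v
      by (metis in_set_conv_decomp in_set_replicate zero_neq_one)
    show "J i \<inter> J j = {}"
      unfolding J_def using 1 2 2[symmetric] \<open>i \<noteq> j\<close>
      by (auto dest: arg_cong[of _ _ length] simp del: One_nat_def)
  qed
  have F: "F j \<in> Pi\<^sub>M (J j) (\<lambda>_. mark_space) \<rightarrow>\<^sub>M count_space UNIV" for j
  proof -
    have [measurable]: "(\<lambda>f. f (replicate j 0)) \<in> Pi\<^sub>M (J j) (\<lambda>_. mark_space) \<rightarrow>\<^sub>M mark_space"
      by (rule measurable_component_singleton) (simp add: J_def)
    have [measurable]: "(\<lambda>f v. f (replicate j 0 @ 1 # v)) \<in> Pi\<^sub>M (J j) (\<lambda>_. mark_space) \<rightarrow>\<^sub>M marking_space"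
      by (rule measurable_PiM_single') (auto simp: space_PiM J_def intro!: measurable_component_singleton)
    show ?thesis unfolding F_def by measurable
  qed
  let ?G = "\<lambda>j w. w (replicate j 0) \<in> C \<and> subtree w (replicate j 0 @ [1]) \<in> B j"
  have "T.indep_vars (\<lambda>_. count_space UNIV) (\<lambda>j w. F j (restrict w (J j))) {..<k}"
    by (rule indep_vars_tree[OF \<kappa> disj F])
  also have "(\<lambda>j w. F j (restrict w (J j))) = ?G"
    by (auto simp: F_def J_def subtree_def fun_eq_iff)
  finally have ind: "T.indep_vars (\<lambda>_. count_space UNIV) ?G {..<k}" .
  have "{w. \<forall>j<k. \<not> ?G j w} = (\<Inter>j\<in>{..<k}. ?G j -` {False} \<inter> space (tree_law \<kappa>))"
    using False by (auto simp: space_tree_law[OF \<kappa>])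
  also have "T.prob \<dots> = (\<Prod>j<k. T.prob (?G j -` {False} \<inter> space (tree_law \<kappa>)))"
    using False by (intro T.indep_varsD_finite[OF ind]) auto
  also have "\<dots> = (\<Prod>j<k. 1 - measure (\<kappa> j) C * measure (tree_law (\<lambda>n. \<kappa> (Suc j + n))) (B j))"
  proof (rule prod.cong[OF refl])
    fix j
    have E: "{w. ?G j w} \<in> T.events"
    proof -
      have "{w \<in> space (tree_law \<kappa>). ?G j w} \<in> T.events" by measurable
      then show ?thesis by (simp add: space_tree_law[OF \<kappa>])
    qed
    have "?G j -` {False} \<inter> space (tree_law \<kappa>) = space (tree_law \<kappa>) - {w. ?G j w}" by auto
    then have "T.prob (?G j -` {False} \<inter> space (tree_law \<kappa>)) = 1 - T.prob {w. ?G j w}"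
      using T.prob_compl[OF E] by simp
    also have "T.prob {w. ?G j w} = measure (\<kappa> j) C * measure (tree_law (\<lambda>n. \<kappa> (Suc j + n))) (B j)"
      by (subst prob_eval_subtree[OF C B]) (auto dest: arg_cong[of _ _ length])
    finally show "T.prob (?G j -` {False} \<inter> space (tree_law \<kappa>)) =
      1 - measure (\<kappa> j) C * measure (tree_law (\<lambda>n. \<kappa> (Suc j + n))) (B j)" .
  qed
  finally show ?thesis .
qed (simp add: space_tree_law[OF \<kappa>, symmetric] T.prob_space)

end

section \<open>Partition functions in a fixed environment\<close>

lemma (in prob_space) prob_exceeds_le:
  fixes f :: "'a \<Rightarrow> real"
  assumes "integrable M f" "\<And>x. 0 \<le> f x" "(\<integral>x. f x \<partial>M) \<le> exp b"
  shows "prob {x \<in> space M. exp b' \<le> f x} \<le> exp (b - b')"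
proof -
  have "prob {x \<in> space M. exp b' \<le> f x} \<le> (\<integral>x. f x \<partial>M) / exp b'"
    by (rule integral_Markov_inequality_measure[where A = "space M"]) (use assms in auto)
  also have "\<dots> \<le> exp b / exp b'" using assms by (intro divide_right_mono) auto
  finally show ?thesis by (simp add: exp_diff)
qed

lemma (in prob_space) AE_eventually_not:
  assumes P: "\<And>n. {x \<in> space M. P n x} \<in> sets M"
    and g: "eventually (\<lambda>n. prob {x \<in> space M. P n x} \<le> g n) sequentially" "summable g"
  shows "AE x in M. eventually (\<lambda>n. \<not> P n x) sequentially"
proof -
  have "summable (\<lambda>n. prob {x \<in> space M. P n x})"
    using g by (intro summable_comparison_test_ev[OF _ g(2)]) (auto elim: eventually_mono)
  then have "AE x in M. eventually (\<lambda>n. x \<in> space M - {x \<in> space M. P n x}) sequentially"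
    using P by (intro borel_cantelli_AE1) (auto simp: emeasure_eq_measure)
  then show ?thesis
    by eventually_elim (auto elim: eventually_mono)
qed

text \<open>Only \<open>n div D\<close> of the first \<open>n\<close> generations carry trials, so
  the failure probabilities decay in that quantity; it exceeds n/D - 1, which gives a geometric
  majorant.\<close>

lemma summable_exp_div:
  fixes \<delta> :: real and D :: nat
  assumes "0 < \<delta>" "0 < D"
  shows "summable (\<lambda>n. exp (- \<delta> * real (n div D)))"
proof (rule summable_comparison_test)
  have *: "exp (- \<delta> * real (n div D)) \<le> exp \<delta> * exp (- \<delta> / D) ^ n" for n
  proof -
    have "n < D * (n div D) + D"
      using assms(2) by (metis mod_less_divisor mult_div_mod_eq nat_add_left_cancel_less)
    then have "real n < real D * real (n div D) + real D"
      by (metis of_nat_add of_nat_less_iff of_nat_mult)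
    then have "\<delta> * (real n / D) \<le> \<delta> * (real (n div D) + 1)"
      using assms by (intro mult_left_mono) (auto simp: field_simps)
    then have "- \<delta> * real (n div D) \<le> \<delta> + real n * (- \<delta> / D)"
      by (simp add: algebra_simps)
    then show ?thesis by (simp add: exp_of_nat_mult[symmetric] exp_add[symmetric])
  qed
  then show "\<exists>N. \<forall>n\<ge>N. norm (exp (- \<delta> * real (n div D))) \<le> exp \<delta> * exp (- \<delta> / D) ^ n"
    by auto
  show "summable (\<lambda>n. exp \<delta> * exp (- \<delta> / D) ^ n)"
    using assms by (intro summable_mult summable_geometric) auto
qed

section \<open>Exponential weights, their truncation, and the line of first children\<close>

definition exp_weight :: "real \<Rightarrow> nat \<Rightarrow> mark \<Rightarrow> real" where
  "exp_weight t i x = exp (t * snd x i)"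

abbreviation partition_sum :: "real \<Rightarrow> nat \<Rightarrow> marking \<Rightarrow> real" where
  "partition_sum t \<equiv> weight_sum fst (exp_weight t)"

text \<open>The truncation bounds all children but the first one, which is always kept: otherwise truncated
  families could be empty and the logarithm of their mean non-integrable.\<close>

definition cut_count :: "nat \<Rightarrow> mark \<Rightarrow> nat" where
  "cut_count K x = min K (fst x)"

definition cut_weight :: "nat \<Rightarrow> real \<Rightarrow> nat \<Rightarrow> mark \<Rightarrow> real" where
  "cut_weight K t i x = (if i = 0 \<or> \<bar>snd x i\<bar> \<le> real K then exp (t * snd x i) else 0)"

text \<open>Combined with \<open>cut_count 1\<close> the sum has a single term, the product of these
  weights along the first children. It bounds the cost of reaching a vertex of that line, whatever
  the signs of \<open>t\<close> and of the displacements.\<close>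

definition spine_weight :: "real \<Rightarrow> nat \<Rightarrow> mark \<Rightarrow> real" where
  "spine_weight t i x = exp (\<bar>t\<bar> * \<bar>snd x i\<bar>)"

lemma measurable_mark_weights [measurable]:
  "exp_weight t i \<in> borel_measurable mark_space"
  "cut_count K \<in> mark_space \<rightarrow>\<^sub>M count_space UNIV"
  "cut_weight K t i \<in> borel_measurable mark_space"
  "spine_weight t i \<in> borel_measurable mark_space"
  unfolding exp_weight_def[abs_def] cut_count_def[abs_def] cut_weight_def[abs_def] spine_weight_def[abs_def]
  by measurable

interpretation full: weights fst "exp_weight t" for t
  by standard (auto simp: exp_weight_def)

interpretation cut: weights "cut_count K" "cut_weight K t" for K t
  by standard (auto simp: cut_weight_def)

interpretation spine: weights "cut_count 1" "spine_weight t" for t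
  by standard (auto simp: spine_weight_def)

lemma cut_le_partition_sum: "cut.Y K t n w \<le> partition_sum t n w"
proof (induction n arbitrary: w)
  case (Suc n)
  have "(\<Sum>i<cut_count K (w []). cut_weight K t i (w []) * cut.Y K t n (subtree w [i]))
      \<le> (\<Sum>i<cut_count K (w []). exp_weight t i (w []) * partition_sum t n (subtree w [i]))"
    using full.Y_nonneg[of t n]
    by (intro sum_mono mult_mono Suc cut.Y_nonneg) (auto simp: cut_weight_def exp_weight_def)
  also have "\<dots> \<le> (\<Sum>i<fst (w []). exp_weight t i (w []) * partition_sum t n (subtree w [i]))"
    by (intro sum_mono2) (auto simp: cut_count_def exp_weight_def full.Y_nonneg)
  finally show ?case by simp
qed simp

lemma spine_sum_Suc:
  assumes "1 \<le> fst (w [])"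
  shows "spine.Y t (Suc n) w =
    exp (\<bar>t\<bar> * \<bar>snd (w []) 0\<bar>) * spine.Y t n (subtree w [0])"
  using assms by (simp add: cut_count_def min_def spine_weight_def)

lemma spine_sum_ge_1:
  assumes "\<And>u. 1 \<le> fst (w u)"
  shows "1 \<le> spine.Y t n w"
  using assms
proof (induction n arbitrary: w)
  case (Suc n)
  have "1 \<le> spine.Y t n (subtree w [0])"
    using Suc.prems by (intro Suc.IH) (simp add: subtree_def)
  then show ?case
    unfolding spine_sum_Suc[of w, OF Suc.prems] using mult_mono[of 1 "exp (\<bar>t\<bar> * \<bar>snd (w []) 0\<bar>)" 1] by simp
qed simp

lemma spine_sum_mono:
  assumes "\<And>u. 1 \<le> fst (w u)" "j \<le> k"
  shows "spine.Y t j w \<le> spine.Y t k w"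
  using assms
proof (induction k arbitrary: j w)
  case (Suc k)
  show ?case
  proof (cases j)
    case 0
    then show ?thesis using spine_sum_ge_1[OF Suc.prems(1), of t "Suc k"] by simp
  next
    case (Suc j')
    have "spine.Y t j' (subtree w [0]) \<le>
        spine.Y t k (subtree w [0])"
      using Suc.prems Suc by (intro Suc.IH) (simp_all add: subtree_def)
    then show ?thesis
      unfolding Suc spine_sum_Suc[of w, OF Suc.prems(1)] by (intro mult_left_mono) auto
  qed
qed simp

lemma partition_sum_ge_child:
  assumes "i < fst (w [])"
  shows "exp (t * snd (w []) i) * partition_sum t n (subtree w [i]) \<le> partition_sum t (Suc n) w"
  using member_le_sum[of i "{..<fst (w [])}" "\<lambda>i. exp_weight t i (w []) * partition_sum t n (subtree w [i])"]
  assms full.Y_nonneg[of t n] by (simp add: exp_weight_def)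

text \<open>Only the descendants of one second child are kept. Undoing the displacements on the way
  to it costs the spine product for the \<open>j\<close> steps to first children and
  \<open>exp (\<bar>t\<bar> * A)\<close> for the last step, which is the extra generation in
  \<open>Suc (j + n)\<close>.\<close>

lemma partition_sum_ge_spine:
  assumes "\<And>u. 1 \<le> fst (w u)" "2 \<le> fst (w (replicate j 0))" "\<bar>snd (w (replicate j 0)) 1\<bar> \<le> A"
  shows "partition_sum t n (subtree w (replicate j 0 @ [1])) \<le>
    exp (\<bar>t\<bar> * A) * spine.Y t j w * partition_sum t (Suc (j + n)) w"
  using assms
proof (induction j arbitrary: w)
  case 0
  have "- (t * snd (w []) 1) \<le> \<bar>t\<bar> * A"
  proof -
    have "\<bar>t * snd (w []) 1\<bar> \<le> \<bar>t\<bar> * A"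
      using 0 by (simp add: abs_mult mult_left_mono)
    then show ?thesis by linarith
  qed
  then have "1 \<le> exp (\<bar>t\<bar> * A) * exp (t * snd (w []) 1)"
    by (simp add: exp_add[symmetric])
  then have "1 * partition_sum t n (subtree w [1]) \<le>
      (exp (\<bar>t\<bar> * A) * exp (t * snd (w []) 1)) * partition_sum t n (subtree w [1])"
    by (intro mult_right_mono full.Y_nonneg)
  also have "\<dots> \<le> exp (\<bar>t\<bar> * A) * partition_sum t (Suc n) w"
    unfolding mult.assoc using 0 by (intro mult_left_mono partition_sum_ge_child) auto
  finally show ?case by (simp del: weight_sum.simps(2))
next
  case (Suc j)
  let ?S = "spine.Y t"
  have S: "?S (Suc j) w = exp (\<bar>t\<bar> * \<bar>snd (w []) 0\<bar>) * ?S j (subtree w [0])"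
    by (rule spine_sum_Suc) (rule Suc.prems)
  have "partition_sum t n (subtree w (replicate (Suc j) 0 @ [1])) =
      partition_sum t n (subtree (subtree w [0]) (replicate j 0 @ [1]))"
    by (simp add: subtree_append)
  also have "\<dots> \<le> exp (\<bar>t\<bar> * A) * ?S j (subtree w [0]) * partition_sum t (Suc (j + n)) (subtree w [0])"
    using Suc.prems by (intro Suc.IH) (simp_all add: subtree_def)
  also have "\<dots> \<le> exp (\<bar>t\<bar> * A) * ?S j (subtree w [0]) *
      (exp (\<bar>t\<bar> * \<bar>snd (w []) 0\<bar>) * partition_sum t (Suc (Suc (j + n))) w)"
  proof (intro mult_left_mono mult_nonneg_nonneg spine.Y_nonneg)
    have "- (t * snd (w []) 0) \<le> \<bar>t\<bar> * \<bar>snd (w []) 0\<bar>"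
      by (metis abs_ge_minus_self abs_mult)
    then have "1 \<le> exp (\<bar>t\<bar> * \<bar>snd (w []) 0\<bar>) * exp (t * snd (w []) 0)"
      by (simp add: exp_add[symmetric])
    then have "1 * partition_sum t (Suc (j + n)) (subtree w [0]) \<le>
        (exp (\<bar>t\<bar> * \<bar>snd (w []) 0\<bar>) * exp (t * snd (w []) 0)) * partition_sum t (Suc (j + n)) (subtree w [0])"
      by (intro mult_right_mono full.Y_nonneg)
    also have "\<dots> \<le> exp (\<bar>t\<bar> * \<bar>snd (w []) 0\<bar>) * partition_sum t (Suc (Suc (j + n))) w"
      unfolding mult.assoc using Suc.prems(1)[of "[]"] by (intro mult_left_mono partition_sum_ge_child) auto
    finally show "partition_sum t (Suc (j + n)) (subtree w [0]) \<le>
        exp (\<bar>t\<bar> * \<bar>snd (w []) 0\<bar>) * partition_sum t (Suc (Suc (j + n))) w" by simp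
  qed auto
  also have "\<dots> = exp (\<bar>t\<bar> * A) * ?S (Suc j) w * partition_sum t (Suc (Suc j + n)) w"
    unfolding S by (simp add: mult_ac del: weight_sum.simps(2))
  finally show ?case .
qed

section \<open>Almost sure growth of the partition function under deterministic hypotheses\<close>

lemma AE_partition_sum_upper:
  fixes m :: "nat \<Rightarrow> real" and L t \<epsilon> :: real
  assumes \<kappa>: "mark_laws \<kappa>"
    and m: "\<And>k. integrable (\<kappa> k) (full.total t)" "\<And>k. (\<integral>x. full.total t x \<partial>\<kappa> k) = m k" "\<And>k. 0 < m k"
    and lim: "(\<lambda>n. (\<Sum>k<n. ln (m k)) / n) \<longlonglongrightarrow> L" and "0 < \<epsilon>"
  shows "AE w in tree_law \<kappa>. eventually (\<lambda>n. partition_sum t n w < exp (n * (L + \<epsilon>))) sequentially"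
proof -
  interpret T: prob_space "tree_law \<kappa>" by (rule prob_space_tree_law[OF \<kappa>])
  note [measurable_cong] = sets_tree_law[OF \<kappa>]
  have "AE w in tree_law \<kappa>. eventually (\<lambda>n. \<not> exp (n * (L + \<epsilon>)) \<le> partition_sum t n w) sequentially"
  proof (rule T.AE_eventually_not)
    show "summable (\<lambda>n. exp (- (\<epsilon> / 2) * real (n div 1)))"
      by (rule summable_exp_div) (use \<open>0 < \<epsilon>\<close> in auto)
    have "eventually (\<lambda>n. (\<Sum>k<n. ln (m k)) / n < L + \<epsilon> / 2) sequentially"
      using order_tendstoD(2)[OF lim, of "L + \<epsilon> / 2"] \<open>0 < \<epsilon>\<close> by simp
    then show "eventually (\<lambda>n. T.prob {w \<in> space (tree_law \<kappa>). exp (n * (L + \<epsilon>)) \<le> partition_sum t n w}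
        \<le> exp (- (\<epsilon> / 2) * real (n div 1))) sequentially"
      using eventually_gt_at_top[of 0]
    proof eventually_elim
      case (elim n)
      have "(\<Sum>k<n. ln (m k)) \<le> n * (L + \<epsilon> / 2)" using elim by (simp add: field_simps)
      moreover have "(\<Prod>k<n. m k) = exp (\<Sum>k<n. ln (m k))"
        using m(3) by (simp add: exp_sum)
      ultimately have "(\<integral>w. partition_sum t n w \<partial>tree_law \<kappa>) \<le> exp (n * (L + \<epsilon> / 2))"
        using full.first_moment_integral(2)[OF \<kappa> m(1,2), of n] by simp
      from T.prob_exceeds_le[OF full.first_moment_integral(1)[OF \<kappa> m(1,2)] full.Y_nonneg this, of "n * (L + \<epsilon>)"]
      show ?case by (simp add: algebra_simps)
    qed
  qed measurable
  then show ?thesis by (simp add: not_le)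
qed

text \<open>Trials outside \<open>G\<close> carry no useful estimate; they enter as factors at most
  1.\<close>

lemma prod_le_power_card:
  fixes f :: "nat \<Rightarrow> real"
  assumes "\<And>j. 0 \<le> f j" "\<And>j. f j \<le> 1" "\<And>j. j \<in> G \<Longrightarrow> f j \<le> q" "0 \<le> q"
  shows "(\<Prod>j<k. f j) \<le> q ^ card {j. j < k \<and> j \<in> G}"
proof -
  have "(\<Prod>j<k. f j) = (\<Prod>j\<in>{j. j < k \<and> j \<in> G} \<union> {j. j < k \<and> j \<notin> G}. f j)"
    by (rule prod.cong) auto
  also have "\<dots> = (\<Prod>j\<in>{j. j < k \<and> j \<in> G}. f j) * (\<Prod>j\<in>{j. j < k \<and> j \<notin> G}. f j)"
    by (rule prod.union_disjoint) auto
  also have "\<dots> \<le> (\<Prod>j\<in>{j. j < k \<and> j \<in> G}. q) * 1"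
    using assms by (intro mult_mono prod_mono prod_le_1 prod_nonneg) auto
  finally show ?thesis by simp
qed

text \<open>\<open>G\<close> collects the generations whose trial is worth counting:
  \<open>a\<close> bounds from below the chance of a second child displaced by at most
  \<open>A\<close>, \<open>b\<close> the chance that its truncated subtree reaches half its mean.
  The rates \<open>c1\<close> and \<open>c2\<close> control what is lost along the line of first
  children; taking only a small fraction of the generations for trials makes that loss
  negligible.\<close>

lemma AE_partition_sum_lower:
  fixes m s :: "nat \<Rightarrow> real" and a b c1 c2 A L t \<gamma> \<epsilon> :: real
  assumes \<kappa>: "mark_laws \<kappa>" and N: "\<And>k. AE x in \<kappa> k. 1 \<le> fst x"
    and m: "\<And>k. 0 < m k"
    and s: "\<And>k. integrable (\<kappa> k) (spine.total t)" "\<And>k. (\<integral>x. spine.total t x \<partial>\<kappa> k) = s k"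
    and G: "\<And>j. j \<in> G \<Longrightarrow> a \<le> measure (\<kappa> j) {x. 2 \<le> fst x \<and> \<bar>snd x 1\<bar> \<le> A}"
      "\<And>j n. j \<in> G \<Longrightarrow> b \<le> measure (tree_law (\<lambda>n. \<kappa> (Suc j + n)))
        {w. (\<Prod>i<n. m (Suc j + i)) / 2 \<le> cut.Y K t n w}"
    and ab: "0 < a" "0 < b" and \<gamma>: "0 < \<gamma>"
    and freq: "eventually (\<lambda>k. \<gamma> * real k \<le> real (card {j. j < k \<and> j \<in> G})) sequentially"
    and lim: "(\<lambda>n. (\<Sum>k<n. ln (m k)) / n) \<longlonglongrightarrow> L"
    and c1: "eventually (\<lambda>k. (\<Prod>i<k. s i) \<le> exp (c1 * k)) sequentially"
    and c2: "eventually (\<lambda>k. (\<Sum>i<k. \<bar>ln (m i)\<bar>) \<le> c2 * k) sequentially"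
    and \<epsilon>: "0 < \<epsilon>"
  shows "AE w in tree_law \<kappa>. eventually (\<lambda>n. exp (n * (L - \<epsilon>)) < partition_sum t n w) sequentially"
proof -
  interpret T: prob_space "tree_law \<kappa>" by (rule prob_space_tree_law[OF \<kappa>])
  note [measurable_cong] = sets_tree_law[OF \<kappa>]
  let ?Y = "cut.Y K t"
  let ?S = "spine.Y t"
  let ?C = "{x. 2 \<le> fst x \<and> \<bar>snd x 1\<bar> \<le> A} :: mark set"
  \<comment> \<open>A subtree rooted in generation \<open>Suc j\<close> has \<open>n - Suc j\<close>
    generations left.\<close>
  let ?B = "\<lambda>n j. {w. (\<Prod>i<n - Suc j. m (Suc j + i)) / 2 \<le> ?Y (n - Suc j) w}"
  have C: "?C \<in> sets mark_space"
  proof -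
    have "{x \<in> space mark_space. 2 \<le> fst x \<and> \<bar>snd x 1\<bar> \<le> A} \<in> sets mark_space" by measurable
    then show ?thesis by simp
  qed
  have B: "?B n j \<in> sets marking_space" for n j
  proof -
    have "{w \<in> space marking_space. (\<Prod>i<n - Suc j. m (Suc j + i)) / 2 \<le> ?Y (n - Suc j) w} \<in> sets marking_space"
      by measurable
    then show ?thesis by simp
  qed
  note [measurable] = C B
  \<comment> \<open>Exponential cost per generation of the spine: \<open>c1 + 1\<close> dominates
    the growth rate of \<open>?S\<close>, and \<open>c2\<close> that of the factors of the mean
    which precede the subtree.\<close>
  define c3 where "c3 = \<bar>c1\<bar> + 1 + \<bar>c2\<bar>"
  \<comment> \<open>Makes the total cost over \<open>n div D\<close> generations at most n
    \<epsilon>/4.\<close>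
  obtain D :: nat where D: "4 * c3 / \<epsilon> < real D" using reals_Archimedean2 by blast
  have c3: "0 < c3" by (simp add: c3_def)
  then have "0 < 4 * c3 / \<epsilon>" using \<epsilon> by simp
  then have D0: "0 < D" using D by (metis gr0I less_asym of_nat_0)
  have D': "c3 * real (n div D) \<le> real n * (\<epsilon> / 4)" for n
  proof -
    have "4 * c3 \<le> \<epsilon> * real D" using D \<epsilon> by (simp add: field_simps)
    then have "4 * c3 * real (n div D) \<le> \<epsilon> * real D * real (n div D)"
      by (intro mult_right_mono) auto
    also have "\<dots> = \<epsilon> * real (D * (n div D))" by simp
    also have "\<dots> \<le> \<epsilon> * real n" using \<epsilon> by (intro mult_left_mono) (auto simp: of_nat_le_iff simp del: of_nat_mult)
    finally show ?thesis by (simp add: mult.commute mult.left_commute)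
  qed
  have div_top: "filterlim (\<lambda>n. n div D) at_top sequentially"
    unfolding filterlim_at_top
  proof
    fix Z
    show "eventually (\<lambda>n. Z \<le> n div D) sequentially"
      using eventually_ge_at_top[of "Z * D"]
      by eventually_elim (metis D0 less_eq_div_iff_mult_less_eq)
  qed
  define fail where "fail n w = (\<forall>j<n div D. \<not> (w (replicate j 0) \<in> ?C \<and> subtree w (replicate j 0 @ [1]) \<in> ?B n j))"
    for n and w :: marking
  have fail_event: "{w \<in> space (tree_law \<kappa>). fail n w} \<in> T.events" for n
  proof -
    have [measurable]: "(\<lambda>w :: marking. w u) \<in> marking_space \<rightarrow>\<^sub>M mark_space" for u
      by (rule measurable_eval_marking)
    show ?thesis unfolding fail_def by measurable
  qed
  \<comment> \<open>\<open>a\<close> and \<open>b\<close> are compared with probabilities only at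
    indices in \<open>G\<close>; the frequency hypothesis yields such an index for large
    \<open>n\<close>.\<close>
  have ab1: "a * b \<le> 1" if "G \<noteq> {}"
  proof -
    obtain j where "j \<in> G" using \<open>G \<noteq> {}\<close> by blast
    then have "a \<le> 1" "b \<le> 1"
      using G(1)[of j] G(2)[of j 0] prob_space.prob_le_1[OF mark_laws_prob[OF \<kappa>], of j ?C]
        prob_space.prob_le_1[OF prob_space_tree_law[OF mark_laws_shift[OF \<kappa>, of "Suc j"]]]
      by (meson order_trans)+
    then show ?thesis using ab by (simp add: mult_le_one)
  qed
  have not_fail: "AE w in tree_law \<kappa>. eventually (\<lambda>n. \<not> fail n w) sequentially"
  proof (rule T.AE_eventually_not[OF fail_event])
    show "summable (\<lambda>n. exp (- (a * b * \<gamma>) * real (n div D)))"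
      using ab \<gamma> D0 by (intro summable_exp_div) auto
    have freq1: "eventually (\<lambda>k. \<gamma> * real k \<le> real (card {j. j < k \<and> j \<in> G}) \<and> 0 < k) sequentially"
      by (intro eventually_conj freq eventually_gt_at_top)
    show "eventually (\<lambda>n. T.prob {w \<in> space (tree_law \<kappa>). fail n w} \<le>
        exp (- (a * b * \<gamma>) * real (n div D))) sequentially"
      using eventually_compose_filterlim[OF freq1 div_top]
    proof eventually_elim
      case (elim n)
      let ?k = "n div D"
      let ?card = "card {j. j < ?k \<and> j \<in> G}"
      have "0 < \<gamma> * real ?k" using elim \<gamma> by simp
      then have "0 < ?card" using elim by linarith
      then have "G \<noteq> {}" by (metis (mono_tags, lifting) card.empty empty_Collect_eq empty_iff less_irrefl)
      let ?f = "\<lambda>j. 1 - measure (\<kappa> j) ?C * measure (tree_law (\<lambda>n. \<kappa> (Suc j + n))) (?B n j)"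
      have "T.prob {w \<in> space (tree_law \<kappa>). fail n w} = (\<Prod>j<?k. ?f j)"
        unfolding fail_def using spine_failure[OF \<kappa> C B] by (simp add: space_tree_law[OF \<kappa>])
      also have "\<dots> \<le> (1 - a * b) ^ ?card"
      proof (rule prod_le_power_card)
        show "0 \<le> ?f j" for j
          using prob_space.prob_le_1[OF mark_laws_prob[OF \<kappa>], of j ?C]
            prob_space.prob_le_1[OF prob_space_tree_law[OF mark_laws_shift[OF \<kappa>, of "Suc j"]], of "?B n j"]
          by (simp add: mult_le_one)
        show "?f j \<le> 1" for j by simp
        show "?f j \<le> 1 - a * b" if "j \<in> G" for j
          using mult_mono[OF G(1)[OF that] G(2)[OF that, of "n - Suc j"]] ab by simp
      qed (use ab1[OF \<open>G \<noteq> {}\<close>] in simp)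
      also have "\<dots> \<le> exp (- (a * b)) ^ ?card"
        using ab1[OF \<open>G \<noteq> {}\<close>] exp_ge_add_one_self[of "- (a * b)"] by (intro power_mono) auto
      also have "\<dots> = exp (- (a * b) * real ?card)" by (simp add: exp_of_nat_mult[symmetric] mult.commute)
      also have "\<dots> \<le> exp (- (a * b * \<gamma>) * real ?k)"
        using elim ab mult_left_mono[of "\<gamma> * real ?k" "real ?card" "a * b"] by simp
      finally show ?case .
    qed
  qed
  \<comment> \<open>The surplus 1 in the rate is the room that Markov's inequality needs for a
    summable bound.\<close>
  have spine: "AE w in tree_law \<kappa>. eventually (\<lambda>n. \<not> exp ((c1 + 1) * real (n div D)) \<le> ?S (n div D) w) sequentially"
  proof (rule T.AE_eventually_not)
    show "summable (\<lambda>n. exp (- 1 * real (n div D)))"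
      by (rule summable_exp_div) (use D0 in auto)
    show "eventually (\<lambda>n. T.prob {w \<in> space (tree_law \<kappa>). exp ((c1 + 1) * real (n div D)) \<le> ?S (n div D) w}
      \<le> exp (- 1 * real (n div D))) sequentially"
      using eventually_compose_filterlim[OF c1 div_top]
    proof eventually_elim
      case (elim n)
      then have "(\<integral>w. ?S (n div D) w \<partial>tree_law \<kappa>) \<le> exp (c1 * real (n div D))"
        using spine.first_moment_integral(2)[OF \<kappa> s, of "n div D"] by simp
      from T.prob_exceeds_le[OF spine.first_moment_integral(1)[OF \<kappa> s] spine.Y_nonneg this, of "(c1 + 1) * real (n div D)"]
      show ?case by (simp add: algebra_simps)
    qed
  qed measurable
  have offspring: "AE w in tree_law \<kappa>. \<forall>u. 1 \<le> fst (w u)"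
    unfolding AE_all_countable
  proof
    fix u :: "nat list"
    have "AE x in \<kappa> (length u). 1 \<le> fst x" by (rule N)
    then show "AE w in tree_law \<kappa>. 1 \<le> fst (w u)"
      unfolding tree_law_def by (intro AE_PiM_component) (auto simp: mark_laws_prob[OF \<kappa>])
  qed
  \<comment> \<open>One quarter of \<open>\<epsilon>\<close> each goes to the ergodic average, to
    the constants, and to the spine through \<open>D'\<close>; the last quarter is to spare.\<close>
  have "eventually (\<lambda>n. (\<Sum>k<n. ln (m k)) / n > L - \<epsilon> / 4) sequentially"
    using order_tendstoD(1)[OF lim, of "L - \<epsilon> / 4"] \<epsilon> by simp
  moreover have "eventually (\<lambda>n. \<bar>t\<bar> * A + ln 2 < real n * (\<epsilon> / 4)) sequentially"
    using \<epsilon> by real_asymp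
  ultimately have det: "eventually (\<lambda>n. real n * (L - \<epsilon> / 4) < (\<Sum>k<n. ln (m k)) \<and>
      \<bar>t\<bar> * A + ln 2 < real n * (\<epsilon> / 4) \<and> (\<Sum>i<n div D. \<bar>ln (m i)\<bar>) \<le> c2 * (n div D)) sequentially"
    using eventually_compose_filterlim[OF c2 div_top] eventually_gt_at_top[of 0]
    by eventually_elim (simp add: field_simps)
  show ?thesis
    using not_fail spine offspring
  proof eventually_elim
    case (elim w)
    note off = elim(3)
    show ?case
      using elim(1,2) det
    proof eventually_elim
      case (elim n)
      let ?k = "n div D"
      obtain j where j: "j < ?k" and wC: "w (replicate j 0) \<in> ?C" and
        wB: "subtree w (replicate j 0 @ [1]) \<in> ?B n j"
        using elim(1) unfolding fail_def by blast
      have "?k \<le> n" by simp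
      with j have jn: "Suc j \<le> n" by linarith
      let ?r = "n - Suc j"
      have n: "Suc (j + ?r) = n" using jn by simp
      have Sj: "?S j w < exp ((c1 + 1) * real ?k)"
      proof -
        have "?S j w \<le> ?S ?k w" by (rule spine_sum_mono) (use off j in auto)
        then show ?thesis using elim(2) by simp
      qed
      have Sj0: "1 \<le> ?S j w" using off by (intro spine_sum_ge_1) auto
      have "(\<Prod>i<?r. m (Suc j + i)) / 2 \<le> partition_sum t ?r (subtree w (replicate j 0 @ [1]))"
        using wB cut_le_partition_sum[of K t ?r] by (auto intro: order_trans)
      also have "\<dots> \<le> exp (\<bar>t\<bar> * A) * ?S j w * partition_sum t n w"
        using partition_sum_ge_spine[of w j A t ?r] off wC n by simp
      finally have lower: "(\<Prod>i<?r. m (Suc j + i)) / 2 \<le> exp (\<bar>t\<bar> * A) * ?S j w * partition_sum t n w" .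
      have "(\<Prod>i<?r. m (Suc j + i)) = exp (\<Sum>i<?r. ln (m (Suc j + i)))"
        using m by (simp add: exp_sum)
      \<comment> \<open>The subtree lacks the first \<open>Suc j\<close> factors of the mean. As
        \<open>Suc j \<le> n div D\<close>, their logarithms sum to at most
        \<open>c2 * ?k\<close>.\<close>
      moreover have "(\<Sum>k<n. ln (m k)) = (\<Sum>k<Suc j. ln (m k)) + (\<Sum>i<?r. ln (m (Suc j + i)))"
      proof -
        have "(\<Sum>i<?r. ln (m (Suc j + i))) = (\<Sum>k\<in>{Suc j..<n}. ln (m k))"
          by (rule sum.reindex_bij_witness[of _ "\<lambda>k. k - Suc j" "\<lambda>i. Suc j + i"]) auto
        moreover have "{..<n} = {..<Suc j} \<union> {Suc j..<n}" using jn by auto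
        moreover have "(\<Sum>k\<in>{..<Suc j} \<union> {Suc j..<n}. ln (m k)) = (\<Sum>k<Suc j. ln (m k)) + (\<Sum>k\<in>{Suc j..<n}. ln (m k))"
          by (rule sum.union_disjoint) auto
        ultimately show ?thesis by presburger
      qed
      moreover have "(\<Sum>k<Suc j. ln (m k)) \<le> c2 * ?k"
      proof -
        have "(\<Sum>k<Suc j. ln (m k)) \<le> (\<Sum>k<Suc j. \<bar>ln (m k)\<bar>)" by (intro sum_mono) simp
        also have "\<dots> \<le> (\<Sum>k<?k. \<bar>ln (m k)\<bar>)" using j by (intro sum_mono2) auto
        finally show ?thesis using elim(3) by simp
      qed
      ultimately have "exp ((\<Sum>k<n. ln (m k)) - c2 * ?k) \<le> (\<Prod>i<?r. m (Suc j + i))" by simp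
      also have "\<dots> \<le> 2 * (exp (\<bar>t\<bar> * A) * ?S j w * partition_sum t n w)" using lower by simp
      also have "\<dots> \<le> 2 * (exp (\<bar>t\<bar> * A) * exp ((c1 + 1) * real ?k) * partition_sum t n w)"
        using Sj by (intro mult_left_mono mult_right_mono full.Y_nonneg) auto
      also have "\<dots> = exp (ln 2 + \<bar>t\<bar> * A + (c1 + 1) * real ?k) * partition_sum t n w"
        by (simp add: exp_add)
      finally have "exp ((\<Sum>k<n. ln (m k)) - c2 * ?k - (ln 2 + \<bar>t\<bar> * A + (c1 + 1) * real ?k)) \<le> partition_sum t n w"
        by (subst exp_diff) (simp add: pos_divide_le_eq mult.commute)
      moreover have "real n * (L - \<epsilon>) < (\<Sum>k<n. ln (m k)) - c2 * ?k - (ln 2 + \<bar>t\<bar> * A + (c1 + 1) * real ?k)"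
      proof -
        have "c2 * real ?k + (c1 + 1) * real ?k \<le> c3 * real ?k"
          unfolding c3_def distrib_right[symmetric] by (intro mult_right_mono) auto
        moreover have "0 \<le> \<epsilon> * real n" using \<epsilon> by simp
        ultimately show ?thesis using elim(3) D'[of n] by (simp add: algebra_simps)
      qed
      ultimately show ?case by (meson exp_less_mono less_le_trans)
    qed
  qed
qed

section \<open>Differentiability and rational parameters\<close>

text \<open>Increments of a convex function over short steps are dominated by its increments over
  unit steps, a majorant free of \<open>h\<close>.\<close>

lemma convex_increment_bound:
  fixes f :: "real \<Rightarrow> real"
  assumes f: "convex_on UNIV f" and h: "\<bar>h\<bar> \<le> 1"
  shows "\<bar>f (t + h) - f t\<bar> \<le> \<bar>h\<bar> * (\<bar>f (t + 1) - f t\<bar> + \<bar>f t - f (t - 1)\<bar>)"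
proof -
  have up: "f (t + s * k) - f t \<le> k * (f (t + s) - f t)" if "0 \<le> k" "k \<le> 1" for s k
    using convex_onD[OF f, of k t "t + s"] that by (simp add: algebra_simps)
  have low: "f t - f (t + s * k) \<le> k * (f (t - s) - f t)" if "0 \<le> k" "k \<le> 1" for s k
  proof -
    \<comment> \<open>Convexity at the midpoint \<open>t\<close> bounds a decrease on one side by an
      increase on the other, which \<open>up\<close> controls.\<close>
    have mid: "(1 - 1 / 2) *\<^sub>R (t - s * k) + (1 / 2) *\<^sub>R (t + s * k) = t" by (simp add: field_simps)
    have "f t \<le> (1 - 1 / 2) * f (t - s * k) + (1 / 2) * f (t + s * k)"
      using convex_onD[OF f, of "1 / 2" "t - s * k" "t + s * k"] unfolding mid by simp
    then have "2 * f t \<le> f (t - s * k) + f (t + s * k)" by simp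
    then show ?thesis using up[OF that, of "- s"] by simp
  qed
  define g where "g = \<bar>f (t + 1) - f t\<bar> + \<bar>f t - f (t - 1)\<bar>"
  have "f (t + 1) - f t \<le> g" "f (t - 1) - f t \<le> g" by (simp_all add: g_def)
  then have bound: "\<bar>h\<bar> * (f (t + 1) - f t) \<le> \<bar>h\<bar> * g" "\<bar>h\<bar> * (f (t - 1) - f t) \<le> \<bar>h\<bar> * g"
    by (auto intro: mult_left_mono)
  show ?thesis
  proof (cases "0 \<le> h")
    case True
    then show ?thesis
      using up[of h 1] low[of h 1] bound h unfolding g_def[symmetric] by simp
  next
    case False
    then have h': "\<bar>h\<bar> = - h" by simp
    have "f (t + h) - f t \<le> - h * (f (t - 1) - f t)" "f t - f (t + h) \<le> - h * (f (t + 1) - f t)"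
      using up[of "- h" "- 1"] low[of "- h" "- 1"] False h by simp_all
    then show ?thesis
      using bound unfolding g_def[symmetric] h' by (intro abs_leI) linarith+
  qed
qed

text \<open>Dominated convergence for the difference quotients, with the convexity majorant over
  unit steps.\<close>

lemma convex_integral_differentiable:
  fixes F :: "real \<Rightarrow> 'a \<Rightarrow> real"
  assumes int: "\<And>s. integrable M (F s)"
    and conv: "AE x in M. convex_on UNIV (\<lambda>s. F s x)"
    and diff: "AE x in M. \<exists>D. ((\<lambda>s. F s x) has_real_derivative D) (at t)"
  shows "\<exists>D. ((\<lambda>s. \<integral>x. F s x \<partial>M) has_real_derivative D) (at t)"
proof -
  define q where "q h x = (F (t + h) x - F t x) / h" for h x
  \<comment> \<open>The pointwise derivative is written as a limit along a fixed sequence so that it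
    is measurable.\<close>
  define D where "D x = lim (\<lambda>n. q (1 / real (Suc n)) x)" for x
  have [measurable]: "F s \<in> borel_measurable M" for s using int[of s] by simp
  have q_measurable [measurable]: "q h \<in> borel_measurable M" for h
    unfolding q_def[abs_def] by measurable
  have D_measurable: "D \<in> borel_measurable M"
    unfolding D_def[abs_def] by (rule borel_measurable_lim_metric) measurable
  have seq: "filterlim (\<lambda>n. 1 / real (Suc n)) (at 0) sequentially"
    using LIMSEQ_inverse_real_of_nat by (simp add: filterlim_at inverse_eq_divide del: of_nat_Suc)
  have D: "AE x in M. ((\<lambda>h. q h x) \<longlongrightarrow> D x) (at 0)"
    using diff
  proof eventually_elim
    case (elim x)
    then obtain D' where "((\<lambda>h. q h x) \<longlongrightarrow> D') (at 0)"
      by (auto simp: DERIV_def q_def)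
    moreover from filterlim_compose[OF this seq] have "D x = D'"
      unfolding D_def by (rule limI)
    ultimately show ?case by simp
  qed
  have "((\<lambda>h. \<integral>x. q h x \<partial>M) \<longlongrightarrow> (\<integral>x. D x \<partial>M)) (at 0)"
  proof (unfold tendsto_at_iff_sequentially comp_def, intro allI impI)
    fix X :: "nat \<Rightarrow> real" assume X: "\<forall>i. X i \<in> UNIV - {0}" "X \<longlonglongrightarrow> 0"
    \<comment> \<open>Changes finitely many terms so that every step has length at most 1, as the
      majorant requires.\<close>
    define X' where "X' i = (if \<bar>X i\<bar> \<le> 1 then X i else 1)" for i
    have "eventually (\<lambda>i. \<bar>X i\<bar> < 1) sequentially"
      using order_tendstoD(2)[OF tendsto_rabs_zero[OF X(2)], of 1] by simp
    then have eq: "eventually (\<lambda>i. X' i = X i) sequentially"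
      by eventually_elim (simp add: X'_def)
    have X'0: "X' i \<noteq> 0" "\<bar>X' i\<bar> \<le> 1" for i using X(1) by (auto simp: X'_def)
    have "X' \<longlonglongrightarrow> 0" using X(2) tendsto_cong[OF eq] by simp
    then have X'lim: "filterlim X' (at 0) sequentially"
      using X'0 by (simp add: filterlim_at)
    have "(\<lambda>i. \<integral>x. q (X' i) x \<partial>M) \<longlonglongrightarrow> (\<integral>x. D x \<partial>M)"
    proof (rule integral_dominated_convergence[OF D_measurable q_measurable])
      show "integrable M (\<lambda>x. \<bar>F (t + 1) x - F t x\<bar> + \<bar>F t x - F (t - 1) x\<bar>)"
        using int by (intro Bochner_Integration.integrable_add integrable_abs Bochner_Integration.integrable_diff)
      show "AE x in M. norm (q (X' i) x) \<le> \<bar>F (t + 1) x - F t x\<bar> + \<bar>F t x - F (t - 1) x\<bar>" for i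
        using conv
      proof eventually_elim
        case (elim x)
        from convex_increment_bound[OF this X'0(2), of t i] X'0(1)[of i] show ?case
          by (simp add: q_def pos_divide_le_eq mult.commute)
      qed
      show "AE x in M. (\<lambda>i. q (X' i) x) \<longlonglongrightarrow> D x"
        using D by eventually_elim (rule filterlim_compose[OF _ X'lim])
    qed
    moreover have "eventually (\<lambda>i. (\<integral>x. q (X' i) x \<partial>M) = (\<integral>x. q (X i) x \<partial>M)) sequentially"
      using eq by eventually_elim simp
    ultimately show "(\<lambda>i. \<integral>x. q (X i) x \<partial>M) \<longlonglongrightarrow> (\<integral>x. D x \<partial>M)"
      by (rule Lim_transform_eventually)
  qed
  moreover have "(\<integral>x. q h x \<partial>M) = ((\<integral>x. F (t + h) x \<partial>M) - (\<integral>x. F t x \<partial>M)) / h" for h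
    unfolding q_def using int by simp
  ultimately show ?thesis unfolding DERIV_def by auto
qed

lemma eventually_at_right_Rats:
  fixes x :: real
  assumes "eventually P (at_right x)"
  shows "\<exists>y\<in>\<rat>. x < y \<and> P y"
proof -
  obtain b where b: "x < b" "\<And>y. x < y \<Longrightarrow> y < b \<Longrightarrow> P y"
    using assms by (auto simp: eventually_at_right_field)
  obtain y where "y \<in> \<rat>" "x < y" "y < b" using Rats_dense_in_real[OF b(1)] by blast
  then show ?thesis using b(2) by blast
qed

section \<open>Rational parameters and the limit of an extreme position\<close>

context convex_free_energy
begin

lemma \<Lambda>_right: "(\<Lambda> \<longlongrightarrow> \<Lambda> t) (at_right t)"
  using DERIV_isCont[OF deriv[of t]] by (auto simp: isCont_def intro: tendsto_within_subset)

lemma \<rho>_right: "(\<rho> \<longlongrightarrow> \<rho> t) (at_right t)"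
  using \<rho>_continuous[of UNIV]
  by (auto simp: continuous_on_eq_continuous_at isCont_def intro: tendsto_within_subset)

lemma upper_speed_Rats:
  assumes "extended_deriv \<Lambda> (t_plus \<Lambda>) < ereal a"
  shows "\<exists>t\<in>\<rat>. 0 < t \<and> \<Lambda> t / t < a"
proof -
  obtain t where t: "0 < t" "\<Lambda> t / t < a" using upper_speed[OF assms] by blast
  have "((\<lambda>s. \<Lambda> s / s) \<longlongrightarrow> \<Lambda> t / t) (at_right t)"
    using t by (intro tendsto_intros \<Lambda>_right) auto
  then have "eventually (\<lambda>s. \<Lambda> s / s < a) (at_right t)"
    using t(2) by (rule order_tendstoD)
  from eventually_at_right_Rats[OF this] obtain s where "s \<in> \<rat>" "t < s" "\<Lambda> s / s < a" by blast
  then show ?thesis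
    using t(1) by (intro bexI[of _ s]) auto
qed

text \<open>The slope condition couples both parameters, so they are perturbed in turn:
  \<open>s\<close> with \<open>t\<close> fixed, then \<open>t\<close> for the new \<open>s\<close>,
  staying below it.\<close>

lemma lower_speed_Rats:
  assumes "ereal a < extended_deriv \<Lambda> (t_plus \<Lambda>)"
  shows "\<exists>t\<in>\<rat>. \<exists>s\<in>\<rat>. 0 < t \<and> t < s \<and> \<rho> t < 0 \<and> \<rho> s < 0 \<and> a < (\<Lambda> s - \<Lambda> t) / (s - t)"
proof -
  obtain t s where ts: "0 < t" "t < s" "\<rho> t < 0" "\<rho> s < 0" "a < (\<Lambda> s - \<Lambda> t) / (s - t)"
    using lower_speed[OF assms] by blast
  have "((\<lambda>s. (\<Lambda> s - \<Lambda> t) / (s - t)) \<longlongrightarrow> (\<Lambda> s - \<Lambda> t) / (s - t)) (at_right s)"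
    using ts by (intro tendsto_intros \<Lambda>_right) auto
  then have "eventually (\<lambda>s. a < (\<Lambda> s - \<Lambda> t) / (s - t)) (at_right s)"
    using ts(5) by (rule order_tendstoD)
  moreover have "eventually (\<lambda>s. \<rho> s < 0) (at_right s)"
    using \<rho>_right ts(4) by (rule order_tendstoD)
  ultimately have "eventually (\<lambda>s. a < (\<Lambda> s - \<Lambda> t) / (s - t) \<and> \<rho> s < 0) (at_right s)"
    by eventually_elim simp
  from eventually_at_right_Rats[OF this] obtain s'
    where s': "s' \<in> \<rat>" "s < s'" "\<rho> s' < 0" "a < (\<Lambda> s' - \<Lambda> t) / (s' - t)" by blast
  have "((\<lambda>t. (\<Lambda> s' - \<Lambda> t) / (s' - t)) \<longlongrightarrow> (\<Lambda> s' - \<Lambda> t) / (s' - t)) (at_right t)"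
    using ts s' by (intro tendsto_intros \<Lambda>_right) auto
  then have "eventually (\<lambda>t. a < (\<Lambda> s' - \<Lambda> t) / (s' - t)) (at_right t)"
    using s'(4) by (rule order_tendstoD)
  moreover have "eventually (\<lambda>t. \<rho> t < 0) (at_right t)"
    using \<rho>_right ts(3) by (rule order_tendstoD)
  moreover have "eventually (\<lambda>t. t < s') (at_right t)"
    using ts s' by (auto simp: eventually_at_right_field)
  ultimately have "eventually (\<lambda>t. a < (\<Lambda> s' - \<Lambda> t) / (s' - t) \<and> \<rho> t < 0 \<and> t < s') (at_right t)"
    by eventually_elim simp
  from eventually_at_right_Rats[OF this] obtain t'
    where "t' \<in> \<rat>" "t < t'" "t' < s'" "\<rho> t' < 0" "a < (\<Lambda> s' - \<Lambda> t') / (s' - t')" by blast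
  then show ?thesis using s' ts(1)
    by (intro bexI[of _ t'] bexI[of _ s']) auto
qed

text \<open>Stated for an abstract family \<open>z\<close>, so that it applies to the partition
  function at \<open>t\<close> and also at \<open>- t\<close>. No probability is left in it.\<close>

lemma speed_limit:
  fixes z :: "real \<Rightarrow> nat \<Rightarrow> real" and R :: "nat \<Rightarrow> real"
  assumes R_le: "\<And>t n. 0 < t \<Longrightarrow> t * R n \<le> ln (z t n)"
    and R_ge: "\<And>t s n. 0 < t \<Longrightarrow> t < s \<Longrightarrow> ln (z s n) - ln (z t n) \<le> (s - t) * R n"
    and upper: "\<And>t \<epsilon>. t \<in> \<rat> \<Longrightarrow> 0 < \<epsilon> \<Longrightarrow> eventually (\<lambda>n. ln (z t n) \<le> n * (\<Lambda> t + \<epsilon>)) sequentially"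
    and lower: "\<And>t \<epsilon>. t \<in> \<rat> \<Longrightarrow> \<rho> t < 0 \<Longrightarrow> 0 < \<epsilon> \<Longrightarrow>
      eventually (\<lambda>n. n * (\<Lambda> t - \<epsilon>) \<le> ln (z t n)) sequentially"
  shows "(\<lambda>n. ereal (R n / real n)) \<longlonglongrightarrow> extended_deriv \<Lambda> (t_plus \<Lambda>)"
proof (rule order_tendstoI)
  fix x assume "extended_deriv \<Lambda> (t_plus \<Lambda>) < x"
  then obtain a where a: "extended_deriv \<Lambda> (t_plus \<Lambda>) < ereal a" "ereal a < x"
    using ereal_dense2 by blast
  obtain t where t: "t \<in> \<rat>" "0 < t" "\<Lambda> t / t < a" using upper_speed_Rats[OF a(1)] by blast
  have "eventually (\<lambda>n. ln (z t n) \<le> n * (\<Lambda> t + (a * t - \<Lambda> t))) sequentially"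
    using t by (intro upper) (auto simp: field_simps)
  then have "eventually (\<lambda>n. R n / real n \<le> a) sequentially"
    using eventually_gt_at_top[of 0]
  proof eventually_elim
    case (elim n)
    have "t * R n \<le> t * (a * real n)" using R_le[OF t(2), of n] elim by (simp add: mult_ac)
    then show ?case using t(2) elim by (simp add: pos_divide_le_eq)
  qed
  then show "eventually (\<lambda>n. ereal (R n / real n) < x) sequentially"
  proof eventually_elim
    case (elim n)
    then have "ereal (R n / real n) \<le> ereal a" by simp
    then show ?case using a(2) by (rule le_less_trans)
  qed
next
  fix x assume "x < extended_deriv \<Lambda> (t_plus \<Lambda>)"
  then obtain a where a: "x < ereal a" "ereal a < extended_deriv \<Lambda> (t_plus \<Lambda>)"
    using ereal_dense2 by blast
  obtain t s where ts: "t \<in> \<rat>" "s \<in> \<rat>" "0 < t" "t < s" "\<rho> t < 0" "\<rho> s < 0"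
    "a < (\<Lambda> s - \<Lambda> t) / (s - t)"
    using lower_speed_Rats[OF a(2)] by blast
  \<comment> \<open>Half of the excess of the chord over slope \<open>a\<close>: spending it once at
    \<open>s\<close> and once at \<open>t\<close> leaves exactly \<open>a * (s - t)\<close>.\<close>
  define \<epsilon> where "\<epsilon> = (\<Lambda> s - \<Lambda> t - a * (s - t)) / 2"
  have \<epsilon>: "0 < \<epsilon>" using ts by (simp add: \<epsilon>_def pos_less_divide_eq)
  have "eventually (\<lambda>n. a \<le> R n / real n) sequentially"
    using upper[OF ts(1) \<epsilon>] lower[OF ts(2,6) \<epsilon>] eventually_gt_at_top[of 0]
  proof eventually_elim
    case (elim n)
    have "real n * (a * (s - t)) = real n * (\<Lambda> s - \<epsilon>) - real n * (\<Lambda> t + \<epsilon>)"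
      unfolding \<epsilon>_def by (simp add: field_simps)
    also have "\<dots> \<le> (s - t) * R n" using elim R_ge[OF ts(3,4), of n] by linarith
    finally have "(s - t) * (a * real n) \<le> (s - t) * R n" by (simp add: mult_ac)
    then show ?case using ts(4) elim by (simp add: pos_le_divide_eq)
  qed
  then show "eventually (\<lambda>n. x < ereal (R n / real n)) sequentially"
  proof eventually_elim
    case (elim n)
    then have "ereal a \<le> ereal (R n / real n)" by simp
    with a(1) show ?case by (rule less_le_trans)
  qed
qed

end

section \<open>Laplace transforms of a mark distribution\<close>

lemma convex_on_total: "convex_on UNIV (\<lambda>s. full.total s x)"
proof (rule convex_onI)
  fix u a b :: real assume u: "0 < u" "u < 1"
  have "exp_weight ((1 - u) *\<^sub>R a + u *\<^sub>R b) i x \<le> (1 - u) * exp_weight a i x + u * exp_weight b i x" for i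
    using convex_onD[OF exp_convex, of u "a * snd x i" "b * snd x i"] u
    by (simp add: exp_weight_def algebra_simps)
  then have "full.total ((1 - u) *\<^sub>R a + u *\<^sub>R b) x \<le>
      (\<Sum>i<fst x. (1 - u) * exp_weight a i x + u * exp_weight b i x)"
    unfolding full.total_def by (intro sum_mono)
  then show "full.total ((1 - u) *\<^sub>R a + u *\<^sub>R b) x \<le> (1 - u) * full.total a x + u * full.total b x"
    by (simp add: full.total_def sum.distrib sum_distrib_left)
qed simp

lemma total_differentiable: "\<exists>D. ((\<lambda>s. full.total s x) has_real_derivative D) (at t)"
proof
  show "((\<lambda>s. full.total s x) has_real_derivative (\<Sum>i<fst x. exp (t * snd x i) * snd x i)) (at t)"
    unfolding full.total_def exp_weight_def by (auto intro!: derivative_eq_intros)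
qed

lemma total_ge_first: "1 \<le> fst x \<Longrightarrow> exp (t * snd x 0) \<le> full.total t x"
  unfolding full.total_def
  using member_le_sum[of 0 "{..<fst x}" "\<lambda>i. exp_weight t i x"] by (simp add: exp_weight_def)

lemma cut_total_le: "cut.total K t x \<le> full.total t x"
proof -
  have "cut.total K t x \<le> (\<Sum>i<cut_count K x. exp_weight t i x)"
    unfolding cut.total_def by (intro sum_mono) (simp add: cut_weight_def exp_weight_def)
  also have "\<dots> \<le> full.total t x"
    unfolding full.total_def by (intro sum_mono2) (auto simp: cut_count_def exp_weight_def)
  finally show ?thesis .
qed

lemma cut_total_ge_first:
  assumes "1 \<le> fst x" "1 \<le> K"
  shows "exp (t * snd x 0) \<le> cut.total K t x"
  unfolding cut.total_def
  using member_le_sum[of 0 "{..<cut_count K x}" "\<lambda>i. cut_weight K t i x"] assms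
  by (simp add: cut_weight_def cut_count_def)

text \<open>For a fixed mark the truncation is void as soon as \<open>K\<close> exceeds the number
  of children and all of their displacements.\<close>

lemma cut_total_tendsto: "(\<lambda>K. cut.total K t x) \<longlonglongrightarrow> full.total t x"
proof (rule tendsto_eventually)
  obtain k :: nat where k: "Max (insert 0 ((\<lambda>i. \<bar>snd x i\<bar>) ` {..<fst x})) \<le> real k"
    using real_arch_simple by blast
  then have k': "\<bar>snd x i\<bar> \<le> real k" if "i < fst x" for i
    using that by simp
  show "eventually (\<lambda>K. cut.total K t x = full.total t x) sequentially"
    using eventually_ge_at_top[of k] eventually_ge_at_top[of "fst x"]
  proof eventually_elim
    case (elim K)
    have "cut_count K x = fst x" using elim by (simp add: cut_count_def)
    moreover have "cut_weight K t i x = exp_weight t i x" if "i < fst x" for i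
      using k'[OF that] elim by (simp add: cut_weight_def exp_weight_def)
    ultimately show ?case by (simp add: cut.total_def full.total_def)
  qed
qed

lemma cut_powr_total_le: "cut.powr_total K t p x \<le> full.total (p * t) x"
proof -
  have "cut.powr_total K t p x \<le> (\<Sum>i<cut_count K x. exp_weight (p * t) i x)"
    unfolding cut.powr_total_def
    by (intro sum_mono) (simp add: cut_weight_def exp_weight_def powr_def mult.assoc)
  also have "\<dots> \<le> full.total (p * t) x"
    unfolding full.total_def by (intro sum_mono2) (auto simp: cut_count_def exp_weight_def)
  finally show ?thesis .
qed

text \<open>At most \<open>K\<close> children are kept, and each one after the first weighs at most
  \<open>exp (\<bar>t\<bar> * real K)\<close>. The summand 1 makes the logarithm
  nonnegative.\<close>

definition cut_bound :: "nat \<Rightarrow> real \<Rightarrow> real \<Rightarrow> real" where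
  "cut_bound K t p = 1 + (real K * exp (\<bar>t\<bar> * real K)) powr p"

text \<open>The first child is not bounded, but the p-th power of its weight is a term of
  \<open>full.total (p * t) x\<close>. The factor 4 bounds \<open>2 powr p\<close>, which arises on
  replacing a sum by twice a maximum.\<close>

lemma cut_total_powr_le:
  assumes "1 \<le> fst x" and p: "1 < p" "p \<le> 2"
  shows "cut.total K t x powr p \<le> 4 * (full.total (p * t) x + cut_bound K t p)"
proof -
  let ?u = "exp (t * snd x 0)" and ?v = "real K * exp (\<bar>t\<bar> * real K)"
  have "cut.total K t x \<le> ?u + ?v"
  proof (cases K)
    case 0
    then show ?thesis by (simp add: cut.total_def cut_count_def)
  next
    case (Suc K')
    have w: "cut_weight K t i x \<le> exp (\<bar>t\<bar> * real K)" if "i \<noteq> 0" for i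
    proof (cases "\<bar>snd x i\<bar> \<le> real K")
      case True
      then have "t * snd x i \<le> \<bar>t\<bar> * real K"
        by (metis abs_ge_self abs_ge_zero abs_mult mult_left_mono order_trans)
      then show ?thesis using that by (simp add: cut_weight_def)
    qed (use that in \<open>simp add: cut_weight_def\<close>)
    have "cut.total K t x \<le> (\<Sum>i<K. cut_weight K t i x)"
      unfolding cut.total_def by (intro sum_mono2) (auto simp: cut_count_def cut.a_nonneg)
    also have "\<dots> = cut_weight K t 0 x + (\<Sum>i<K'. cut_weight K t (Suc i) x)"
      unfolding Suc by (rule sum.lessThan_Suc_shift)
    also have "\<dots> \<le> ?u + (\<Sum>i<K'. exp (\<bar>t\<bar> * real K))"
      by (intro add_mono sum_mono w) (auto simp: cut_weight_def)
    also have "\<dots> \<le> ?u + ?v" using Suc by (simp add: algebra_simps)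
    finally show ?thesis .
  qed
  also have "\<dots> \<le> 2 * max ?u ?v" by simp
  finally have "cut.total K t x powr p \<le> (2 * max ?u ?v) powr p"
    using p by (intro powr_mono2 cut.total_nonneg) auto
  also have "\<dots> = 2 powr p * max ?u ?v powr p" by (simp add: powr_mult)
  also have "\<dots> \<le> 4 * max ?u ?v powr p"
    using powr_mono[of p 2 2] p by (intro mult_right_mono) auto
  also have "\<dots> \<le> 4 * (?u powr p + ?v powr p)"
    by (intro mult_left_mono) (auto simp: max_def)
  also have "?u powr p = exp (p * t * snd x 0)" by (simp add: powr_def mult.assoc)
  also have "\<dots> \<le> full.total (p * t) x" by (rule total_ge_first[OF assms(1)])
  finally show ?thesis by (simp add: cut_bound_def)
qed

lemma spine_total_le:
  assumes "1 \<le> fst x"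
  shows "spine.total t x \<le> full.total t x + full.total (- t) x"
proof -
  have "cut_count 1 x = 1" using assms by (simp add: cut_count_def min_def)
  then have "spine.total t x = exp \<bar>t * snd x 0\<bar>"
    unfolding spine.total_def by (simp add: spine_weight_def abs_mult)
  also have "\<dots> \<le> exp (t * snd x 0) + exp (- t * snd x 0)"
    by (cases "0 \<le> t * snd x 0") auto
  also have "\<dots> \<le> full.total t x + full.total (- t) x"
    using assms by (intro add_mono total_ge_first)
  finally show ?thesis .
qed

definition mark_laplace :: "mark measure \<Rightarrow> real \<Rightarrow> real" where
  "mark_laplace \<mu> t = (\<integral>x. full.total t x \<partial>\<mu>)"

definition cut_mean :: "nat \<Rightarrow> real \<Rightarrow> mark measure \<Rightarrow> real" where
  "cut_mean K t \<mu> = (\<integral>x. cut.total K t x \<partial>\<mu>)"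

locale mark_law =
  fixes \<mu> :: "mark measure"
  assumes law: "\<mu> \<in> space (prob_algebra mark_space)"
    and offspring: "AE x in \<mu>. 1 \<le> fst x"
    and total_integrable: "\<And>t. integrable \<mu> (full.total t)"
begin

sublocale prob_space \<mu> using law by (simp add: space_prob_algebra)

lemma sets_law [measurable_cong]: "sets \<mu> = sets mark_space"
  using law by (simp add: space_prob_algebra)

lemma space_law [simp]: "space \<mu> = UNIV"
  using sets_eq_imp_space_eq[OF sets_law] by simp

lemma prob_UNIV [simp]: "prob UNIV = 1"
  using prob_space by simp

lemma first_integrable: "integrable \<mu> (\<lambda>x. exp (t * snd x 0))"
proof (rule Bochner_Integration.integrable_bound[OF total_integrable[of t]])
  show "AE x in \<mu>. norm (exp (t * snd x 0)) \<le> norm (full.total t x)"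
    using offspring by eventually_elim (simp add: full.total_nonneg total_ge_first)
qed measurable

lemma first_mean_pos: "0 < (\<integral>x. exp (t * snd x 0) \<partial>\<mu>)"
  using integral_less_AE_space[of "\<lambda>_. 0" "\<lambda>x. exp (t * snd x 0)"] first_integrable emeasure_space_1
  by simp

lemma cut_integrable: "integrable \<mu> (cut.total K t)"
  by (rule Bochner_Integration.integrable_bound[OF total_integrable[of t]])
    (measurable, auto simp: full.total_nonneg cut.total_nonneg cut_total_le)

lemma first_le_cut_mean:
  assumes "1 \<le> K"
  shows "(\<integral>x. exp (t * snd x 0) \<partial>\<mu>) \<le> cut_mean K t \<mu>"
  unfolding cut_mean_def
  by (rule integral_mono_AE[OF first_integrable cut_integrable])
    (use offspring in \<open>eventually_elim, use assms cut_total_ge_first in auto\<close>)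

lemma cut_mean_le: "cut_mean K t \<mu> \<le> mark_laplace \<mu> t"
  unfolding cut_mean_def mark_laplace_def
  by (intro integral_mono cut_integrable total_integrable cut_total_le)

lemma cut_mean_pos: "1 \<le> K \<Longrightarrow> 0 < cut_mean K t \<mu>"
  using first_mean_pos first_le_cut_mean by (rule less_le_trans)

lemma laplace_pos: "0 < mark_laplace \<mu> t"
  using cut_mean_pos[of 1] cut_mean_le[of 1] by (auto intro: less_le_trans)

text \<open>Jensen's inequality for the reciprocal: its tangent at the mean \<open>A\<close> is
  integrated. It converts a lower bound for a truncated mean into an upper bound by the Laplace
  transform at \<open>- t\<close>.\<close>

lemma first_mean_reciprocal:
  "1 / (\<integral>x. exp (t * snd x 0) \<partial>\<mu>) \<le> mark_laplace \<mu> (- t)"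
proof -
  define A where "A = (\<integral>x. exp (t * snd x 0) \<partial>\<mu>)"
  have A: "0 < A" unfolding A_def by (rule first_mean_pos)
  have tangent: "2 / A - z / A\<^sup>2 \<le> 1 / z" if "0 < z" for z
  proof -
    have "0 \<le> (z - A)\<^sup>2" by simp
    then show ?thesis using A that by (simp add: field_simps power2_eq_square)
  qed
  have tangent': "2 / A - exp (t * y) / A\<^sup>2 \<le> exp ((- t) * y)" for y
    using tangent[of "exp (t * y)"] by (simp add: exp_minus inverse_eq_divide)
  have "1 / A = (\<integral>x. 2 / A - exp (t * snd x 0) / A\<^sup>2 \<partial>\<mu>)"
    using A first_integrable[of t] by (simp add: prob_space A_def[symmetric] power2_eq_square field_simps)
  also have "\<dots> \<le> (\<integral>x. exp ((- t) * snd x 0) \<partial>\<mu>)"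
    by (intro integral_mono tangent' first_integrable Bochner_Integration.integrable_diff) (auto intro: first_integrable)
  also have "\<dots> \<le> mark_laplace \<mu> (- t)"
    using order_trans[OF first_le_cut_mean cut_mean_le] by blast
  finally show ?thesis by (simp add: A_def)
qed

text \<open>The bound is uniform in \<open>K\<close>: truncated means lie between the contribution
  of the first child and the full Laplace transform. It is the majorant for letting \<open>K\<close>
  tend to infinity.\<close>

lemma abs_ln_cut_mean:
  assumes "1 \<le> K"
  shows "\<bar>ln (cut_mean K t \<mu>)\<bar> \<le> \<bar>ln (mark_laplace \<mu> t)\<bar> + \<bar>ln (mark_laplace \<mu> (- t))\<bar>"
proof -
  have "1 / cut_mean K t \<mu> \<le> 1 / (\<integral>x. exp (t * snd x 0) \<partial>\<mu>)"
    using first_le_cut_mean[OF assms, of t] first_mean_pos[of t] by (intro divide_left_mono) auto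
  also have "\<dots> \<le> mark_laplace \<mu> (- t)" by (rule first_mean_reciprocal)
  finally have "ln (1 / cut_mean K t \<mu>) \<le> ln (mark_laplace \<mu> (- t))"
    using cut_mean_pos[OF assms] laplace_pos by simp
  moreover have "ln (cut_mean K t \<mu>) \<le> ln (mark_laplace \<mu> t)"
    using cut_mean_le cut_mean_pos[OF assms] laplace_pos by simp
  ultimately show ?thesis using cut_mean_pos[OF assms, of t] by (simp add: ln_div)
qed

lemma cut_mean_tendsto: "(\<lambda>K. cut_mean K t \<mu>) \<longlonglongrightarrow> mark_laplace \<mu> t"
  unfolding cut_mean_def mark_laplace_def
proof (rule integral_dominated_convergence)
  show "integrable \<mu> (full.total t)" by (rule total_integrable)
qed (auto simp: cut.total_nonneg cut_total_le cut_total_tendsto)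

lemma cut_powr_mean: "(\<integral>\<^sup>+x. cut.powr_total K t p x \<partial>\<mu>) \<le> ennreal (mark_laplace \<mu> (p * t))"
proof -
  have "(\<integral>\<^sup>+x. cut.powr_total K t p x \<partial>\<mu>) \<le> (\<integral>\<^sup>+x. full.total (p * t) x \<partial>\<mu>)"
    by (intro nn_integral_mono ennreal_leI cut_powr_total_le)
  also have "\<dots> = ennreal (mark_laplace \<mu> (p * t))"
    unfolding mark_laplace_def
    by (rule nn_integral_eq_integral[OF total_integrable]) (simp add: full.total_nonneg)
  finally show ?thesis .
qed

lemma cut_total_powr_mean:
  assumes p: "1 < p" "p \<le> 2"
  shows "(\<integral>\<^sup>+x. cut.total K t x powr p \<partial>\<mu>) \<le> ennreal (4 * (mark_laplace \<mu> (p * t) + cut_bound K t p))"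
proof -
  have int: "integrable \<mu> (\<lambda>x. 4 * (full.total (p * t) x + cut_bound K t p))"
    using total_integrable by simp
  have "(\<integral>\<^sup>+x. cut.total K t x powr p \<partial>\<mu>) \<le> (\<integral>\<^sup>+x. ennreal (4 * (full.total (p * t) x + cut_bound K t p)) \<partial>\<mu>)"
    by (rule nn_integral_mono_AE)
      (use offspring in \<open>eventually_elim, intro ennreal_leI cut_total_powr_le p\<close>)
  also have "\<dots> = ennreal (\<integral>x. 4 * (full.total (p * t) x + cut_bound K t p) \<partial>\<mu>)"
    by (rule nn_integral_eq_integral[OF int]) (simp add: full.total_nonneg cut_bound_def)
  also have "(\<integral>x. 4 * (full.total (p * t) x + cut_bound K t p) \<partial>\<mu>) =
      4 * (mark_laplace \<mu> (p * t) + cut_bound K t p)"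
    using total_integrable by (simp add: mark_laplace_def prob_space)
  finally show ?thesis .
qed

lemma spine_integrable: "integrable \<mu> (spine.total t)"
  and spine_mean_le: "(\<integral>x. spine.total t x \<partial>\<mu>) \<le> mark_laplace \<mu> t + mark_laplace \<mu> (- t)"
proof -
  have int: "integrable \<mu> (\<lambda>x. full.total t x + full.total (- t) x)"
    using total_integrable by simp
  have le: "AE x in \<mu>. spine.total t x \<le> full.total t x + full.total (- t) x"
    using offspring by eventually_elim (rule spine_total_le)
  show *: "integrable \<mu> (spine.total t)"
    by (rule Bochner_Integration.integrable_bound[OF int])
      (measurable, use le in \<open>eventually_elim, auto simp: spine.total_nonneg simp del: One_nat_def\<close>)
  show "(\<integral>x. spine.total t x \<partial>\<mu>) \<le> mark_laplace \<mu> t + mark_laplace \<mu> (- t)"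
    using integral_mono_AE[OF * int le] total_integrable by (simp add: mark_laplace_def)
qed

lemma laplace_differentiable: "\<exists>D. ((\<lambda>t. ln (mark_laplace \<mu> t)) has_real_derivative D) (at t)"
proof -
  obtain D where "(mark_laplace \<mu> has_real_derivative D) (at t)"
    using convex_integral_differentiable[where M = \<mu> and F = full.total and t = t, OF total_integrable] convex_on_total total_differentiable
    unfolding mark_laplace_def[abs_def] by auto
  from DERIV_chain2[OF DERIV_ln_divide[OF laplace_pos] this] show ?thesis by blast
qed

text \<open>Hoelder's inequality, proved by convexity of the exponential after both endpoints are
  normalised to total mass 1.\<close>

lemma laplace_ln_convex: "convex_on UNIV (\<lambda>t. ln (mark_laplace \<mu> t))"
proof (rule convex_onI)
  fix u a b :: real assume u: "0 < u" "u < 1"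
  let ?c = "(1 - u) * a + u * b"
  let ?l = "(1 - u) * ln (mark_laplace \<mu> a) + u * ln (mark_laplace \<mu> b)"
  have young: "exp_weight ?c i x \<le> exp ?l *
      ((1 - u) * (exp_weight a i x / mark_laplace \<mu> a) + u * (exp_weight b i x / mark_laplace \<mu> b))" for i x
  proof -
    have "exp ((1 - u) * (a * snd x i - ln (mark_laplace \<mu> a)) + u * (b * snd x i - ln (mark_laplace \<mu> b))) \<le>
        (1 - u) * exp (a * snd x i - ln (mark_laplace \<mu> a)) + u * exp (b * snd x i - ln (mark_laplace \<mu> b))"
      using convex_onD[OF exp_convex, of u "a * snd x i - ln (mark_laplace \<mu> a)" "b * snd x i - ln (mark_laplace \<mu> b)"] u
      by simp
    then have "exp ?l * exp (?c * snd x i - ?l) \<le> exp ?l *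
        ((1 - u) * (exp_weight a i x / mark_laplace \<mu> a) + u * (exp_weight b i x / mark_laplace \<mu> b))"
      by (intro mult_left_mono) (simp_all add: exp_weight_def exp_diff laplace_pos algebra_simps)
    then show ?thesis by (simp add: exp_add[symmetric] exp_weight_def)
  qed
  have "full.total ?c x \<le> exp ?l * ((1 - u) * (full.total a x / mark_laplace \<mu> a) + u * (full.total b x / mark_laplace \<mu> b))" for x
  proof -
    have "full.total ?c x \<le> (\<Sum>i<fst x. exp ?l *
        ((1 - u) * (exp_weight a i x / mark_laplace \<mu> a) + u * (exp_weight b i x / mark_laplace \<mu> b)))"
      unfolding full.total_def by (intro sum_mono young)
    then show ?thesis
      by (simp add: full.total_def sum.distrib sum_distrib_left sum_divide_distrib distrib_left)
  qed
  then have "mark_laplace \<mu> ?c \<le>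
      (\<integral>x. exp ?l * ((1 - u) * (full.total a x / mark_laplace \<mu> a) + u * (full.total b x / mark_laplace \<mu> b)) \<partial>\<mu>)"
    unfolding mark_laplace_def[of \<mu> ?c] using total_integrable by (intro integral_mono) auto
  also have "\<dots> = exp ?l"
    using total_integrable laplace_pos[of a] laplace_pos[of b]
    by (simp add: mark_laplace_def[symmetric])
  finally have "ln (mark_laplace \<mu> ?c) \<le> ln (exp ?l)"
    using laplace_pos[of ?c] by (subst ln_le_cancel_iff) auto
  then show "ln (mark_laplace \<mu> ((1 - u) *\<^sub>R a + u *\<^sub>R b)) \<le> ?l" by simp
qed simp

end

section \<open>Affine recursions whose coefficients contract on average\<close>

definition perpetuity :: "(nat \<Rightarrow> real) \<Rightarrow> (nat \<Rightarrow> real) \<Rightarrow> nat \<Rightarrow> real" where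
  "perpetuity r b k = (\<Sum>j. b (k + j) * (\<Prod>i<j. r (k + i)))"

lemma perpetuity_shift:
  "perpetuity (\<lambda>n. r (n + j)) (\<lambda>n. b (n + j)) k = perpetuity r b (k + j)"
  by (simp add: perpetuity_def ac_simps)

text \<open>\<open>perpetuity\<close> is the recursion H(k) = b(k) + r(k) H(k+1) unrolled
  indefinitely. A negative average of \<open>ln (r i)\<close> makes the products decay
  geometrically, and the subexponential \<open>b\<close> cannot spoil it. Convergence from index 0
  gives it from every \<open>k\<close>, because a tail of the first series is a nonzero multiple of
  the series started at \<open>k\<close>.\<close>

lemma
  fixes r b :: "nat \<Rightarrow> real"
  assumes r: "\<And>k. 0 < r k" and b: "\<And>k. 1 \<le> b k"
    and lim_r: "(\<lambda>n. (\<Sum>i<n. ln (r i)) / n) \<longlonglongrightarrow> - \<delta>" and \<delta>: "0 < \<delta>"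
    and lim_b: "(\<lambda>n. ln (b n) / n) \<longlonglongrightarrow> 0"
  shows perpetuity_rec: "perpetuity r b k = b k + r k * perpetuity r b (Suc k)"
    and perpetuity_ge_1: "1 \<le> perpetuity r b k"
proof -
  define T where "T k j = b (k + j) * (\<Prod>i<j. r (k + i))" for k j
  have perp: "perpetuity r b k = suminf (T k)" for k
    unfolding perpetuity_def by (rule suminf_cong) (simp add: T_def)
  have T_nonneg: "0 \<le> T k j" for k j
    unfolding T_def using r b[of "k + j"] by (intro mult_nonneg_nonneg prod_nonneg) (auto intro: less_imp_le)
  have "(\<lambda>n. (\<Sum>i<n. ln (r i)) / n + ln (b n) / n) \<longlonglongrightarrow> - \<delta> + 0"
    by (intro tendsto_add lim_r lim_b)
  then have ev: "eventually (\<lambda>n. (\<Sum>i<n. ln (r i)) / n + ln (b n) / n < - \<delta> / 2) sequentially"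
    by (rule order_tendstoD) (use \<delta> in simp)
  have sum0: "summable (T 0)"
  proof (rule summable_comparison_test_ev)
    show "eventually (\<lambda>n. norm (T 0 n) \<le> exp (- \<delta> / 2) ^ n) sequentially"
      using ev eventually_gt_at_top[of 0]
    proof eventually_elim
      case (elim n)
      have "T 0 n = exp (ln (b n) + (\<Sum>i<n. ln (r i)))"
        using r b[of n] by (simp add: T_def exp_add exp_sum)
      also have "\<dots> \<le> exp (real n * (- \<delta> / 2))"
        using elim by (simp add: add_divide_distrib[symmetric] pos_divide_less_eq mult.commute)
      finally show ?case using T_nonneg[of 0 n] by (simp add: exp_of_nat_mult[symmetric])
    qed
    show "summable (\<lambda>n. exp (- \<delta> / 2) ^ n)" using \<delta> by (intro summable_geometric) auto
  qed
  have sum: "summable (T k)" for k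
  proof -
    have split: "(\<Prod>i<k + j. r i) = (\<Prod>i<k. r i) * (\<Prod>i<j. r (k + i))" for j
      by (induction j) (simp_all add: mult_ac)
    have "T 0 (j + k) = (\<Prod>i<k. r i) * T k j" for j
      by (simp add: T_def split add.commute[of j] mult_ac)
    then have "summable (\<lambda>j. (\<Prod>i<k. r i) * T k j)"
      using summable_ignore_initial_segment[OF sum0, of k] by simp
    moreover have "(\<Prod>i<k. r i) \<noteq> 0" using r by (simp add: less_imp_neq[symmetric])
    ultimately show ?thesis by (rule summable_mult_D)
  qed
  have "(\<Sum>j. T k (Suc j)) = suminf (T k) - T k 0"
    by (rule suminf_split_head[OF sum])
  moreover have "T k (Suc j) = r k * T (Suc k) j" for j
    unfolding T_def by (subst prod.lessThan_Suc_shift) (simp add: mult_ac)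
  moreover have "(\<Sum>j. r k * T (Suc k) j) = r k * suminf (T (Suc k))"
    by (rule suminf_mult[OF sum])
  moreover have "T k 0 = b k" by (simp add: T_def)
  ultimately have rec: "suminf (T k) = b k + r k * suminf (T (Suc k))"
    by simp
  then show "perpetuity r b k = b k + r k * perpetuity r b (Suc k)"
    unfolding perp .
  have "0 \<le> r k * suminf (T (Suc k))"
    using r[of k] suminf_nonneg[OF sum T_nonneg, of "Suc k"] by simp
  then show "1 \<le> perpetuity r b k"
    unfolding perp using rec b[of k] by linarith
qed

section \<open>Stationary ergodic environments\<close>

locale brw_env =
  fixes Theta :: "'th measure" and nu :: "(nat \<Rightarrow> 'th) measure"
    and eta :: "'th \<Rightarrow> mark measure"
  assumes env: "stationary_ergodic Theta nu"
    and kernel: "eta \<in> Theta \<rightarrow>\<^sub>M prob_algebra mark_space"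
    and N_ge_1: "AE (e, w) in annealed nu eta. offspring w [] \<ge> 1"
    and laplace_finite: "\<And>t. AE e in nu. integrable (quenched eta e) (\<lambda>w. exp_sum w t)"
    and log_laplace: "\<And>t. integrable nu (\<lambda>e. ln (laplace_mean eta e t))"
    and free_energy_pos: "0 < free_energy nu eta 0"
begin

sublocale ergodic_system nu shift
  by (rule ergodic_system_shift[OF env])

lemma sets_nu [measurable_cong]: "sets nu = sets (Pi\<^sub>M UNIV (\<lambda>_. Theta))"
  using env by (simp add: stationary_ergodic_def)

lemma eta_measurable: "(\<lambda>e. eta (e n)) \<in> nu \<rightarrow>\<^sub>M prob_algebra mark_space"
  using kernel unfolding measurable_cong_sets[OF sets_nu refl] by measurable

lemma eta_subprob_measurable [measurable]: "(\<lambda>e. eta (e n)) \<in> nu \<rightarrow>\<^sub>M subprob_algebra mark_space"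
  by (rule measurable_prob_algebraD[OF eta_measurable])

lemma mark_laws_eta: "e \<in> space nu \<Longrightarrow> mark_laws (\<lambda>n. eta (e n))"
  using measurable_space[OF eta_measurable] by (simp add: mark_laws_def)

lemma quenched_eq_tree_law: "quenched eta e = tree_law (\<lambda>n. eta (e n))"
  by (simp add: quenched_def tree_law_def)

lemma laplace_mean_eq:
  assumes e: "e \<in> space nu"
  shows "laplace_mean eta e t = mark_laplace (eta (e 0)) t"
    and "integrable (quenched eta e) (\<lambda>w. exp_sum w t) \<longleftrightarrow> integrable (eta (e 0)) (full.total t)"
proof -
  note \<kappa> = mark_laws_eta[OF e]
  have root [measurable]: "(\<lambda>w. w []) \<in> tree_law (\<lambda>n. eta (e n)) \<rightarrow>\<^sub>M mark_space"
    by (simp add: tree_law_measurable[OF \<kappa>] measurable_eval_marking)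
  have eq: "exp_sum w t = full.total t (w [])" for w
    by (simp add: exp_sum_def full.total_def exp_weight_def offspring_def displacement_def)
  have d: "distr (tree_law (\<lambda>n. eta (e n))) mark_space (\<lambda>w. w []) = eta (e 0)"
    using distr_eval[OF \<kappa>, of "[]"] by simp
  show "laplace_mean eta e t = mark_laplace (eta (e 0)) t"
    unfolding laplace_mean_def quenched_eq_tree_law eq mark_laplace_def d[symmetric]
    by (rule integral_distr[symmetric]) auto
  show "integrable (quenched eta e) (\<lambda>w. exp_sum w t) \<longleftrightarrow> integrable (eta (e 0)) (full.total t)"
    unfolding quenched_eq_tree_law eq d[symmetric]
    by (rule integrable_distr_eq[symmetric]) auto
qed

lemma log_mark_laplace: "integrable nu (\<lambda>e. ln (mark_laplace (eta (e 0)) t))"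
proof -
  have "integrable nu (\<lambda>e. ln (mark_laplace (eta (e 0)) t)) \<longleftrightarrow> integrable nu (\<lambda>e. ln (laplace_mean eta e t))"
    by (rule Bochner_Integration.integrable_cong) (auto simp: laplace_mean_eq)
  with log_laplace show ?thesis by simp
qed

lemma free_energy_eq: "free_energy nu eta t = (\<integral>e. ln (mark_laplace (eta (e 0)) t) \<partial>nu)"
  unfolding free_energy_def using laplace_mean_eq(1) by (intro Bochner_Integration.integral_cong) auto

lemma AE_offspring: "AE e in nu. AE x in eta (e 0). 1 \<le> fst x"
proof -
  have [measurable]: "(\<lambda>w :: marking. w []) \<in> marking_space \<rightarrow>\<^sub>M mark_space"
    by (rule measurable_eval_marking)
  have "Measurable.pred (nu \<Otimes>\<^sub>M marking_space) (\<lambda>(e, w). offspring w [] \<ge> 1)"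
    unfolding offspring_def split_beta' by measurable
  then have "AE e in nu. AE w in quenched eta e. 1 \<le> fst (w [])"
    using N_ge_1 by (subst (asm) AE_annealed_iff[OF env kernel]) (auto simp: offspring_def)
  then show ?thesis
    using AE_space
  proof eventually_elim
    case (elim e)
    note \<kappa> = mark_laws_eta[OF elim(2)]
    have "AE x in distr (tree_law (\<lambda>n. eta (e n))) mark_space (\<lambda>w. w []). 1 \<le> fst x"
    proof (subst AE_distr_iff)
      show "(\<lambda>w. w []) \<in> tree_law (\<lambda>n. eta (e n)) \<rightarrow>\<^sub>M mark_space"
        by (simp add: tree_law_measurable[OF \<kappa>] measurable_eval_marking)
      show "{x \<in> space mark_space. 1 \<le> fst x} \<in> sets mark_space" by measurable
      show "AE w in tree_law (\<lambda>n. eta (e n)). 1 \<le> fst (w [])"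
        using elim(1) unfolding quenched_eq_tree_law .
    qed
    moreover have "distr (tree_law (\<lambda>n. eta (e n))) mark_space (\<lambda>w. w []) = eta (e 0)"
      using distr_eval[OF \<kappa>, of "[]"] by simp
    ultimately show ?case by (simp only:)
  qed
qed

text \<open>Finiteness of the Laplace transform holds off a null set depending on \<open>t\<close>.
  Integer parameters suffice, since \<open>exp (t * y)\<close> is at most the sum of the
  exponentials at \<open>k\<close> and \<open>- k\<close> when \<bar>t\<bar> \<le> k; invariance of
  the law carries generation 0 to all generations.\<close>

lemma AE_mark_law: "AE e in nu. \<forall>n. mark_law (eta (e n))"
proof -
  have int: "AE e in nu. integrable (eta (e 0)) (full.total t)" for t
    using laplace_finite[of t] AE_space by eventually_elim (simp add: laplace_mean_eq(2))
  have "AE e in nu. integrable (eta (e 0)) (full.total (real k)) \<and> integrable (eta (e 0)) (full.total (- real k))" for k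
    using int[of "real k"] int[of "- real k"] by eventually_elim simp
  then have "AE e in nu. \<forall>k. integrable (eta (e 0)) (full.total (real k)) \<and> integrable (eta (e 0)) (full.total (- real k))"
    by (simp only: AE_all_countable) blast
  then have "AE e in nu. mark_law (eta (e 0))"
    using AE_offspring AE_space
  proof eventually_elim
    case (elim e)
    have law: "eta (e 0) \<in> space (prob_algebra mark_space)"
      using measurable_space[OF eta_measurable elim(3)] .
    then have sets_eta: "sets (eta (e 0)) = sets mark_space"
      by (simp add: space_prob_algebra)
    have "integrable (eta (e 0)) (full.total t)" for t
    proof -
      obtain k :: nat where k: "\<bar>t\<bar> \<le> real k" using real_arch_simple by blast
      have "full.total t x \<le> full.total (real k) x + full.total (- real k) x" for x
      proof -
        have "exp (t * y) \<le> exp (real k * y) + exp (- real k * y)" for y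
        proof -
          have "t * y \<le> \<bar>t\<bar> * \<bar>y\<bar>" by (metis abs_ge_self abs_mult)
          also have "\<dots> \<le> real k * \<bar>y\<bar>" using k by (intro mult_right_mono) auto
          finally have "exp (t * y) \<le> exp (real k * \<bar>y\<bar>)" by simp
          also have "\<dots> \<le> exp (real k * y) + exp (- real k * y)"
            by (cases "0 \<le> y") auto
          finally show ?thesis .
        qed
        then show ?thesis
          unfolding full.total_def exp_weight_def sum.distrib[symmetric] by (intro sum_mono)
      qed
      moreover have "full.total t \<in> borel_measurable (eta (e 0))"
        by (subst measurable_cong_sets[OF sets_eta refl]) (rule full.total_measurable)
      ultimately show ?thesis
        using elim(1)
        by (intro Bochner_Integration.integrable_bound[of _ "\<lambda>x. full.total (real k) x + full.total (- real k) x" "full.total t"])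
          (auto simp: full.total_nonneg)
    qed
    then show ?case using law elim(2) by (simp add: mark_law_def)
  qed
  from AE_all_funpow[OF this] show ?thesis by (simp add: funpow_shift)
qed

lemma birkhoff_eta:
  assumes "integrable nu (\<lambda>e. f (eta (e 0)) :: real)"
  shows "AE e in nu. (\<lambda>n. (\<Sum>k<n. f (eta (e k))) / n) \<longlonglongrightarrow> (\<integral>e. f (eta (e 0)) \<partial>nu)"
  using birkhoff[OF assms] by (simp add: birkhoff_sum_def funpow_shift)

lemma AE_quenched_upper:
  assumes "0 < \<epsilon>"
  shows "AE e in nu. AE w in quenched eta e.
    eventually (\<lambda>n. partition_sum t n w < exp (n * (free_energy nu eta t + \<epsilon>))) sequentially"
  using AE_mark_law birkhoff_eta[OF log_mark_laplace, of t] AE_space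
proof eventually_elim
  case (elim e)
  show ?case
    unfolding quenched_eq_tree_law free_energy_eq
  proof (rule AE_partition_sum_upper)
    show "mark_laws (\<lambda>n. eta (e n))" by (rule mark_laws_eta[OF elim(3)])
    show "integrable (eta (e k)) (full.total t)" for k
      using elim(1) mark_law.total_integrable by blast
    show "(\<integral>x. full.total t x \<partial>eta (e k)) = mark_laplace (eta (e k)) t" for k
      by (simp add: mark_laplace_def)
    show "0 < mark_laplace (eta (e k)) t" for k
      using elim(1) mark_law.laplace_pos by blast
  qed (use elim assms in auto)
qed

lemma free_energy_convex: "convex_on UNIV (free_energy nu eta)"
proof (rule convex_onI)
  fix u a b :: real assume u: "0 < u" "u < 1"
  let ?l = "\<lambda>t e. ln (mark_laplace (eta (e 0)) t)"
  have "(\<integral>e. ?l ((1 - u) *\<^sub>R a + u *\<^sub>R b) e \<partial>nu) \<le> (\<integral>e. (1 - u) * ?l a e + u * ?l b e \<partial>nu)"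
  proof (rule integral_mono_AE)
    show "AE e in nu. ?l ((1 - u) *\<^sub>R a + u *\<^sub>R b) e \<le> (1 - u) * ?l a e + u * ?l b e"
      using AE_mark_law
    proof eventually_elim
      case (elim e)
      then show ?case
        using convex_onD[OF mark_law.laplace_ln_convex, of "eta (e 0)" u a b] u by simp
    qed
  qed (use log_mark_laplace in auto)
  also have "\<dots> = (1 - u) * (\<integral>e. ?l a e \<partial>nu) + u * (\<integral>e. ?l b e \<partial>nu)"
    using log_mark_laplace by simp
  finally show "free_energy nu eta ((1 - u) *\<^sub>R a + u *\<^sub>R b) \<le>
      (1 - u) * free_energy nu eta a + u * free_energy nu eta b"
    by (simp add: free_energy_eq)
qed simp

text \<open>\<open>deriv\<close> is the derivative only where one exists, so differentiability is
  what gives the critical parameters their intended meaning.\<close>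

sublocale \<Lambda>: convex_free_energy "free_energy nu eta" "deriv (free_energy nu eta)"
proof
  fix t
  have "\<exists>D. ((\<lambda>s. \<integral>e. ln (mark_laplace (eta (e 0)) s) \<partial>nu) has_real_derivative D) (at t)"
  proof (rule convex_integral_differentiable[OF log_mark_laplace])
    show "AE e in nu. convex_on UNIV (\<lambda>s. ln (mark_laplace (eta (e 0)) s))"
      using AE_mark_law by eventually_elim (blast intro: mark_law.laplace_ln_convex)
    show "AE e in nu. \<exists>D. ((\<lambda>s. ln (mark_laplace (eta (e 0)) s)) has_real_derivative D) (at t)"
      using AE_mark_law by eventually_elim (blast intro: mark_law.laplace_differentiable)
  qed
  then show "(free_energy nu eta has_real_derivative deriv (free_energy nu eta) t) (at t)"
    unfolding free_energy_eq[abs_def] by (auto dest: DERIV_imp_deriv)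
qed (use free_energy_convex free_energy_pos in auto)

lemma laplace_measurable [measurable]: "(\<lambda>e. mark_laplace (eta (e n)) t) \<in> borel_measurable nu"
  unfolding mark_laplace_def
  by (rule measurable_compose[OF eta_subprob_measurable integral_measurable_subprob_algebra]) measurable

lemma cut_mean_measurable [measurable]: "(\<lambda>e. cut_mean K t (eta (e n))) \<in> borel_measurable nu"
  unfolding cut_mean_def
  by (rule measurable_compose[OF eta_subprob_measurable integral_measurable_subprob_algebra]) measurable

text \<open>An integrable majorant for the logarithms of all truncated means at \<open>t\<close>,
  and up to \<open>ln 2\<close> for that of the spine mean.\<close>

definition laplace_control :: "real \<Rightarrow> mark measure \<Rightarrow> real" where
  "laplace_control t \<mu> = \<bar>ln (mark_laplace \<mu> t)\<bar> + \<bar>ln (mark_laplace \<mu> (- t))\<bar>"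

lemma laplace_control_integrable: "integrable nu (\<lambda>e. laplace_control t (eta (e 0)))"
  unfolding laplace_control_def using log_mark_laplace by simp

lemma log_cut_mean_integrable:
  assumes "1 \<le> K"
  shows "integrable nu (\<lambda>e. ln (cut_mean K t (eta (e 0))))"
proof (rule Bochner_Integration.integrable_bound[OF laplace_control_integrable[of t]])
  show "AE e in nu. norm (ln (cut_mean K t (eta (e 0)))) \<le> norm (laplace_control t (eta (e 0)))"
    using AE_mark_law
  proof eventually_elim
    case (elim e)
    then show ?case
      using mark_law.abs_ln_cut_mean[of "eta (e 0)" K t] assms by (simp add: laplace_control_def)
  qed
qed measurable

text \<open>Dominated convergence. The index is \<open>Suc K\<close> because the truncation at 0
  discards even the first child.\<close>

lemma log_cut_mean_tendsto:
  "(\<lambda>K. \<integral>e. ln (cut_mean (Suc K) t (eta (e 0))) \<partial>nu) \<longlonglongrightarrow> free_energy nu eta t"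
  unfolding free_energy_eq
proof (rule integral_dominated_convergence)
  show "integrable nu (\<lambda>e. laplace_control t (eta (e 0)))" by (rule laplace_control_integrable)
  show "AE e in nu. norm (ln (cut_mean (Suc K) t (eta (e 0)))) \<le> laplace_control t (eta (e 0))" for K
    using AE_mark_law
  proof eventually_elim
    case (elim e)
    then show ?case
      using mark_law.abs_ln_cut_mean[of "eta (e 0)" "Suc K" t] by (simp add: laplace_control_def)
  qed
  show "AE e in nu. (\<lambda>K. ln (cut_mean (Suc K) t (eta (e 0)))) \<longlonglongrightarrow> ln (mark_laplace (eta (e 0)) t)"
    using AE_mark_law
  proof eventually_elim
    case (elim e)
    then interpret m: mark_law "eta (e 0)" by blast
    show ?case
      using m.laplace_pos[of t] by (intro tendsto_ln LIMSEQ_Suc m.cut_mean_tendsto) simp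
  qed
qed measurable

end

text \<open>Without a second child every family has exactly one member. This is what positivity of
  the free energy at 0 will exclude.\<close>

lemma (in mark_law) laplace_zero_eq_1:
  assumes "prob {x. 2 \<le> fst x} = 0"
  shows "mark_laplace \<mu> 0 = 1"
proof -
  have "{x \<in> space mark_space. 2 \<le> fst x} \<in> sets mark_space" by measurable
  then have "{x. 2 \<le> fst x} \<in> events" by (simp add: sets_law)
  then have "AE x in \<mu>. \<not> 2 \<le> fst x"
    using assms by (subst AE_iff_measurable[of "{x. 2 \<le> fst x}"]) (auto simp: emeasure_eq_measure)
  then have "AE x in \<mu>. full.total 0 x = 1"
    using offspring
  proof eventually_elim
    case (elim x)
    then have "fst x = 1" by simp
    then show ?case by (simp add: full.total_def exp_weight_def)
  qed
  then have "mark_laplace \<mu> 0 = (\<integral>x. 1 \<partial>\<mu>)"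
    unfolding mark_laplace_def by (intro integral_cong_AE) auto
  then show ?thesis by simp
qed

text \<open>The n-th term divided by n is, up to a factor tending to 1, a difference of consecutive
  averages. Hence an integrable function grows sublinearly along almost every orbit.\<close>

lemma cesaro_increment:
  fixes x :: "nat \<Rightarrow> real"
  assumes "(\<lambda>n. (\<Sum>k<n. x k) / n) \<longlonglongrightarrow> I"
  shows "(\<lambda>n. x n / n) \<longlonglongrightarrow> 0"
proof -
  have "(\<lambda>n. (\<Sum>k<Suc n. x k) / Suc n * (real (Suc n) / real n) - (\<Sum>k<n. x k) / n) \<longlonglongrightarrow> I * 1 - I"
    by (intro tendsto_intros LIMSEQ_Suc[OF assms] assms) real_asymp
  moreover have "eventually (\<lambda>n. (\<Sum>k<Suc n. x k) / Suc n * (real (Suc n) / real n) - (\<Sum>k<n. x k) / n = x n / n) sequentially"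
    using eventually_gt_at_top[of 0]
    by eventually_elim (simp add: field_simps del: of_nat_Suc)
  ultimately have "(\<lambda>n. x n / n) \<longlonglongrightarrow> I * 1 - I"
    by (rule Lim_transform_eventually)
  then show ?thesis by simp
qed

section \<open>Environments with a usable second child, and the quenched lower bound\<close>

context brw_env
begin

text \<open>A single index \<open>i\<close> controls the chance of a second child, its displacement
  and the value of \<open>h\<close>; enlarging \<open>i\<close> relaxes all three, so the sets
  exhaust the environments in which a second child is possible.\<close>

definition fertile :: "((nat \<Rightarrow> 'th) \<Rightarrow> real) \<Rightarrow> nat \<Rightarrow> (nat \<Rightarrow> 'th) set" where
  "fertile h i = {e \<in> space nu. 1 / real (Suc i) \<le>
    measure (eta (e 0)) {x. 2 \<le> fst x \<and> \<bar>snd x 1\<bar> \<le> real i} \<and> h e \<le> real (Suc i)}"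

lemma fertile_sets:
  assumes [measurable]: "h \<in> borel_measurable nu"
  shows "fertile h i \<in> sets nu"
proof -
  have "{x \<in> space mark_space. 2 \<le> fst x \<and> \<bar>snd x 1\<bar> \<le> real i} \<in> sets mark_space" by measurable
  then have [measurable]: "(\<lambda>e. measure (eta (e 0)) {x. 2 \<le> fst x \<and> \<bar>snd x 1\<bar> \<le> real i}) \<in> borel_measurable nu"
    by (intro measurable_compose[OF eta_subprob_measurable measurable_measure_subprob_algebra]) simp
  show ?thesis unfolding fertile_def by measurable
qed

text \<open>If all these sets were null, almost every environment would forbid a second child, so
  log m_0 would vanish almost surely, against the positivity of its mean.\<close>

lemma exists_fertile:
  assumes h: "h \<in> borel_measurable nu"
  obtains i where "0 < prob (fertile h i)"
proof -
  have "\<exists>i. 0 < prob (fertile h i)"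
  proof (rule ccontr)
    assume "\<not> ?thesis"
    then have null: "prob (fertile h i) = 0" for i by (simp add: less_le)
    have "AE e in nu. e \<notin> fertile h i" for i
      using fertile_sets[OF h] null
      by (subst AE_iff_measurable[of "fertile h i"]) (auto simp: emeasure_eq_measure fertile_def)
    then have "AE e in nu. \<forall>i. e \<notin> fertile h i" by (simp add: AE_all_countable)
    then have "AE e in nu. ln (mark_laplace (eta (e 0)) 0) = 0"
      using AE_mark_law AE_space
    proof eventually_elim
      case (elim e)
      from elim(2) interpret m: mark_law "eta (e 0)" by blast
      let ?C = "\<lambda>i. {x. 2 \<le> fst x \<and> \<bar>snd x 1\<bar> \<le> real i} :: mark set"
      have C: "?C i \<in> m.events" for i
      proof -
        have "{x \<in> space mark_space. 2 \<le> fst x \<and> \<bar>snd x 1\<bar> \<le> real i} \<in> sets mark_space" by measurable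
        then show ?thesis by (simp add: m.sets_law)
      qed
      have UN: "(\<Union>i. ?C i) = {x. 2 \<le> fst x}"
        using real_arch_simple by auto
      have lim: "(\<lambda>i. m.prob (?C i)) \<longlonglongrightarrow> m.prob {x. 2 \<le> fst x}"
        unfolding UN[symmetric]
        by (rule m.finite_Lim_measure_incseq) (use C in \<open>auto simp: incseq_def\<close>)
      have "m.prob {x. 2 \<le> fst x} = 0"
      proof (rule ccontr)
        assume "m.prob {x. 2 \<le> fst x} \<noteq> 0"
        then have pos: "0 < m.prob {x. 2 \<le> fst x}" by (simp add: less_le)
        have "eventually (\<lambda>i. m.prob {x. 2 \<le> fst x} / 2 < m.prob (?C i)) sequentially"
          by (rule order_tendstoD[OF lim]) (use pos in simp)
        moreover have "eventually (\<lambda>i. 1 / real (Suc i) < m.prob {x. 2 \<le> fst x} / 2) sequentially"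
          using order_tendstoD(2)[OF LIMSEQ_inverse_real_of_nat, of "m.prob {x. 2 \<le> fst x} / 2"] pos
          by (simp add: inverse_eq_divide)
        moreover have "eventually (\<lambda>i. x \<le> real (Suc i)) sequentially" for x
          by real_asymp
        ultimately have "eventually (\<lambda>i. e \<in> fertile h i) sequentially"
          by eventually_elim (use elim(3) in \<open>simp add: fertile_def del: of_nat_Suc\<close>)
        then show False using elim(1) by simp
      qed
      then show ?case by (simp add: m.laplace_zero_eq_1)
    qed
    then have "free_energy nu eta 0 = (\<integral>e. 0 \<partial>nu)"
      unfolding free_energy_eq by (intro integral_cong_AE) auto
    then show False using free_energy_pos by simp
  qed
  then show ?thesis using that by blast
qed

text \<open>The deterministic inputs of \<open>AE_partition_sum_lower\<close> all come from
  Birkhoff's theorem. The contraction coefficients \<open>rr\<close> have logarithmic mean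
  \<open>- \<delta>\<close>, so the moment constant \<open>H\<close> is a convergent perpetuity for
  almost every environment.\<close>

lemma AE_quenched_lower:
  assumes gap: "\<Lambda>.\<rho> t < 0" and \<epsilon>: "0 < \<epsilon>"
  shows "AE e in nu. AE w in quenched eta e.
    eventually (\<lambda>n. exp (n * (free_energy nu eta t - \<epsilon>)) < partition_sum t n w) sequentially"
proof -
  obtain p where p: "1 < p" "p \<le> 2" and p_gap: "free_energy nu eta (p * t) < p * free_energy nu eta t"
    using \<Lambda>.strict_power_gap[OF gap] by blast
  \<comment> \<open>The truncated log-mean must come within \<open>\<epsilon> / 2\<close> of the
    free energy and also preserve the strict gap at \<open>p * t\<close>.\<close>
  have "max (free_energy nu eta t - \<epsilon> / 2) (free_energy nu eta (p * t) / p) < free_energy nu eta t"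
    using p p_gap \<epsilon> by (simp add: pos_divide_less_eq mult.commute)
  from order_tendstoD(1)[OF log_cut_mean_tendsto this] obtain K' where
    "max (free_energy nu eta t - \<epsilon> / 2) (free_energy nu eta (p * t) / p) < (\<integral>e. ln (cut_mean (Suc K') t (eta (e 0))) \<partial>nu)"
    by (auto simp: eventually_sequentially)
  moreover define K where "K = Suc K'"
  moreover define L where "L = (\<integral>e. ln (cut_mean K t (eta (e 0))) \<partial>nu)"
  ultimately have K: "1 \<le> K" and L: "free_energy nu eta t - \<epsilon> / 2 < L" "free_energy nu eta (p * t) < p * L"
    using p by (auto simp: pos_divide_less_eq mult.commute)
  \<comment> \<open>\<open>al\<close> is left untruncated: it dominates the truncated sum of p-th
    powers, and its logarithm has mean equal to the free energy at \<open>p * t\<close>.\<close>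
  define al where "al \<mu> = mark_laplace \<mu> (p * t)" for \<mu>
  define mu where "mu \<mu> = cut_mean K t \<mu>" for \<mu>
  define be where "be \<mu> = 4 * (al \<mu> + cut_bound K t p)" for \<mu>
  define rr where "rr \<mu> = al \<mu> / mu \<mu> powr p" for \<mu>
  \<comment> \<open>The maximum with 1 gives the perpetuity terms at least 1, hence
    \<open>1 \<le> H e k\<close>.\<close>
  define bb where "bb \<mu> = max 1 (be \<mu> / mu \<mu> powr p)" for \<mu>
  define H where "H e k = perpetuity (\<lambda>n. rr (eta (e n))) (\<lambda>n. bb (eta (e n))) k" for e k
  define \<delta> where "\<delta> = p * L - free_energy nu eta (p * t)"
  have V: "1 \<le> cut_bound K t p" by (simp add: cut_bound_def)
  have [measurable]: "(\<lambda>e. al (eta (e n))) \<in> borel_measurable nu"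
    "(\<lambda>e. mu (eta (e n))) \<in> borel_measurable nu" for n
    unfolding al_def mu_def by measurable
  then have [measurable]: "(\<lambda>e. rr (eta (e n))) \<in> borel_measurable nu"
    "(\<lambda>e. bb (eta (e n))) \<in> borel_measurable nu" for n
    unfolding rr_def bb_def be_def by measurable
  have H_measurable: "(\<lambda>e. H e k) \<in> borel_measurable nu" for k
    unfolding H_def perpetuity_def by measurable
  have mark: "0 < al \<mu>" "0 < mu \<mu>" "0 < be \<mu>" "0 < rr \<mu>" "1 \<le> bb \<mu>"
    "ln (rr \<mu>) = ln (al \<mu>) - p * ln (mu \<mu>)"
    "\<bar>ln (bb \<mu>)\<bar> \<le> ln 8 + ln (cut_bound K t p) + \<bar>ln (al \<mu>)\<bar> + p * \<bar>ln (mu \<mu>)\<bar>"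
    if "mark_law \<mu>" for \<mu>
  proof -
    interpret m: mark_law \<mu> by fact
    show al: "0 < al \<mu>" unfolding al_def by (rule m.laplace_pos)
    show mu: "0 < mu \<mu>" unfolding mu_def by (rule m.cut_mean_pos[OF K])
    show be: "0 < be \<mu>" using al V by (simp add: be_def)
    show "0 < rr \<mu>" using al mu by (simp add: rr_def)
    show bb: "1 \<le> bb \<mu>" by (simp add: bb_def)
    show "ln (rr \<mu>) = ln (al \<mu>) - p * ln (mu \<mu>)"
      using al mu by (simp add: rr_def ln_div ln_powr)
    \<comment> \<open>Bounding the sum by a product turns its logarithm into a sum of integrable
      terms; 8 is this 2 times the 4 in \<open>be\<close>.\<close>
    have "al \<mu> + cut_bound K t p \<le> 2 * max (al \<mu>) (cut_bound K t p)" by simp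
    also have "max (al \<mu>) (cut_bound K t p) \<le> exp \<bar>ln (al \<mu>)\<bar> * cut_bound K t p"
    proof (rule max.boundedI)
      have "al \<mu> = exp (ln (al \<mu>))" using al by simp
      also have "\<dots> \<le> exp \<bar>ln (al \<mu>)\<bar>" by simp
      also have "\<dots> \<le> exp \<bar>ln (al \<mu>)\<bar> * cut_bound K t p" using V by simp
      finally show "al \<mu> \<le> exp \<bar>ln (al \<mu>)\<bar> * cut_bound K t p" .
      show "cut_bound K t p \<le> exp \<bar>ln (al \<mu>)\<bar> * cut_bound K t p"
        using V mult_right_mono[of 1 "exp \<bar>ln (al \<mu>)\<bar>" "cut_bound K t p"] by simp
    qed
    finally have "be \<mu> \<le> 8 * (exp \<bar>ln (al \<mu>)\<bar> * cut_bound K t p)" by (simp add: be_def)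
    then have "ln (be \<mu>) \<le> ln (8 * (exp \<bar>ln (al \<mu>)\<bar> * cut_bound K t p))"
      using be V by (subst ln_le_cancel_iff) auto
    also have "\<dots> = ln 8 + (\<bar>ln (al \<mu>)\<bar> + ln (cut_bound K t p))"
      using V by (simp add: ln_mult)
    finally have "ln (be \<mu> / mu \<mu> powr p) \<le> ln 8 + \<bar>ln (al \<mu>)\<bar> + ln (cut_bound K t p) - p * ln (mu \<mu>)"
      using be mu by (simp add: ln_div ln_powr)
    moreover have "- (p * ln (mu \<mu>)) \<le> p * \<bar>ln (mu \<mu>)\<bar>"
      using p mult_left_mono[of "- ln (mu \<mu>)" "\<bar>ln (mu \<mu>)\<bar>" p] by simp
    moreover have "ln (bb \<mu>) = max 0 (ln (be \<mu> / mu \<mu> powr p))"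
      using be mu by (simp add: bb_def max_def)
    moreover have "0 \<le> ln 8 + \<bar>ln (al \<mu>)\<bar> + ln (cut_bound K t p) + p * \<bar>ln (mu \<mu>)\<bar>"
      using V p by simp
    ultimately show "\<bar>ln (bb \<mu>)\<bar> \<le> ln 8 + ln (cut_bound K t p) + \<bar>ln (al \<mu>)\<bar> + p * \<bar>ln (mu \<mu>)\<bar>"
      by linarith
  qed
  have int_al: "integrable nu (\<lambda>e. ln (al (eta (e 0))))"
    unfolding al_def by (rule log_mark_laplace)
  have int_mu: "integrable nu (\<lambda>e. ln (mu (eta (e 0))))"
    unfolding mu_def by (rule log_cut_mean_integrable[OF K])
  have int_rr: "integrable nu (\<lambda>e. ln (al (eta (e 0))) - p * ln (mu (eta (e 0))))"
    using int_al int_mu by simp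
  have E_rr: "(\<integral>e. ln (al (eta (e 0))) - p * ln (mu (eta (e 0))) \<partial>nu) = - \<delta>"
    using int_al int_mu by (simp add: \<delta>_def L_def al_def mu_def free_energy_eq)
  have \<delta>: "0 < \<delta>" using L by (simp add: \<delta>_def)
  have int_bb: "integrable nu (\<lambda>e. ln (bb (eta (e 0))))"
  proof (rule Bochner_Integration.integrable_bound)
    show "integrable nu (\<lambda>e. ln 8 + ln (cut_bound K t p) + \<bar>ln (al (eta (e 0)))\<bar> + p * \<bar>ln (mu (eta (e 0)))\<bar>)"
      using int_al int_mu by simp
    show "AE e in nu. norm (ln (bb (eta (e 0)))) \<le>
        norm (ln 8 + ln (cut_bound K t p) + \<bar>ln (al (eta (e 0)))\<bar> + p * \<bar>ln (mu (eta (e 0)))\<bar>)"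
      using AE_mark_law
    proof eventually_elim
      case (elim e)
      then show ?case using mark(7)[of "eta (e 0)"] by simp
    qed
  qed measurable
  \<comment> \<open>The subtree tested in generation j is rooted in generation j + 1, whence the
    index 1 in \<open>H e 1\<close>.\<close>
  obtain i where i: "0 < prob (fertile (\<lambda>e. H e 1) i)"
    using exists_fertile[OF H_measurable] by blast
  define F where "F = fertile (\<lambda>e. H e 1) i"
  have F [measurable]: "F \<in> sets nu" unfolding F_def by (rule fertile_sets[OF H_measurable])
  define \<gamma> where "\<gamma> = prob F / 2"
  have \<gamma>: "0 < \<gamma>" using i by (simp add: \<gamma>_def F_def)
  have "integrable nu (indicator F :: _ \<Rightarrow> real)"
    by (rule integrable_real_indicator[OF F]) (simp add: emeasure_eq_measure)
  from birkhoff[OF this] have freq: "AE e in nu. (\<lambda>n. (\<Sum>k<n. indicator F ((shift ^^ k) e)) / real n) \<longlonglongrightarrow> prob F"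
    by (simp add: birkhoff_sum_def)
  \<comment> \<open>The ergodic limit plus 1, so that the averages are eventually below it; one rate
    serves both the spine and the lost factors of the mean.\<close>
  define c where "c = (\<integral>e. ln 2 + laplace_control t (eta (e 0)) \<partial>nu) + 1"
  have int_c: "integrable nu (\<lambda>e. ln 2 + laplace_control t (eta (e 0)))"
    using laplace_control_integrable by simp
  show ?thesis
    using AE_mark_law AE_space birkhoff_eta[of "\<lambda>\<mu>. ln (al \<mu>) - p * ln (mu \<mu>)", OF int_rr, unfolded E_rr]
      birkhoff_eta[of "\<lambda>\<mu>. ln (bb \<mu>)", OF int_bb] birkhoff_eta[of "\<lambda>\<mu>. ln (mu \<mu>)", OF int_mu]
      birkhoff_eta[of "\<lambda>\<mu>. ln 2 + laplace_control t \<mu>", OF int_c] freq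
  proof eventually_elim
    case (elim e)
    note \<kappa> = mark_laws_eta[OF elim(2)]
    have ml: "mark_law (eta (e k))" for k using elim(1) by blast
    have H_rec: "H e k = bb (eta (e k)) + rr (eta (e k)) * H e (Suc k)" and H_ge: "1 \<le> H e k" for k
    proof -
      have r: "(\<lambda>n. (\<Sum>i<n. ln (rr (eta (e i)))) / n) \<longlonglongrightarrow> - \<delta>"
        using elim(3) by (simp add: mark(6)[OF ml])
      have b: "(\<lambda>n. ln (bb (eta (e n))) / n) \<longlonglongrightarrow> 0"
        using elim(4) by (rule cesaro_increment)
      show "H e k = bb (eta (e k)) + rr (eta (e k)) * H e (Suc k)"
        unfolding H_def by (rule perpetuity_rec[OF mark(4)[OF ml] mark(5)[OF ml] r \<delta> b])
      show "1 \<le> H e k"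
        unfolding H_def by (rule perpetuity_ge_1[OF mark(4)[OF ml] mark(5)[OF ml] r \<delta> b])
    qed
    have H_step: "al (eta (e k)) * H e (Suc k) + be (eta (e k)) \<le> H e k * mu (eta (e k)) powr p" for k
    proof -
      have mu: "0 < mu (eta (e k)) powr p" using mark(2)[OF ml[of k]] by simp
      have "be (eta (e k)) = be (eta (e k)) / mu (eta (e k)) powr p * mu (eta (e k)) powr p" using mu by simp
      also have "\<dots> \<le> bb (eta (e k)) * mu (eta (e k)) powr p"
        using mu by (intro mult_right_mono) (auto simp: bb_def)
      finally have "be (eta (e k)) \<le> bb (eta (e k)) * mu (eta (e k)) powr p" .
      moreover have "al (eta (e k)) = rr (eta (e k)) * mu (eta (e k)) powr p" using mu by (simp add: rr_def)
      ultimately show ?thesis unfolding H_rec[of k] by (simp add: algebra_simps)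
    qed
    define G where "G = {j. (shift ^^ j) e \<in> F}"
    have H_shift: "H ((shift ^^ j) e) 1 = H e (Suc j)" for j
      using perpetuity_shift[of "\<lambda>n. rr (eta (e n))" j "\<lambda>n. bb (eta (e n))" 1]
      by (simp add: H_def funpow_shift)
    have control: "(\<integral>x. spine.total t x \<partial>eta (e k)) \<le> exp (ln 2 + laplace_control t (eta (e k)))"
      "\<bar>ln (mu (eta (e k)))\<bar> \<le> ln 2 + laplace_control t (eta (e k))" for k
    proof -
      interpret m: mark_law "eta (e k)" by (rule ml)
      have le: "mark_laplace (eta (e k)) s \<le> exp (laplace_control t (eta (e k)))" if "s = t \<or> s = - t" for s
      proof -
        have "mark_laplace (eta (e k)) s = exp (ln (mark_laplace (eta (e k)) s))" using m.laplace_pos by simp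
        also have "\<dots> \<le> exp (laplace_control t (eta (e k)))"
          using that by (auto simp: laplace_control_def)
        finally show ?thesis .
      qed
      have "(\<integral>x. spine.total t x \<partial>eta (e k)) \<le> 2 * exp (laplace_control t (eta (e k)))"
        using m.spine_mean_le[of t] le[of t] le[of "- t"] by simp
      then show "(\<integral>x. spine.total t x \<partial>eta (e k)) \<le> exp (ln 2 + laplace_control t (eta (e k)))"
        by (simp add: exp_add)
      show "\<bar>ln (mu (eta (e k)))\<bar> \<le> ln 2 + laplace_control t (eta (e k))"
        using m.abs_ln_cut_mean[OF K, of t] by (simp add: mu_def laplace_control_def add_increasing)
    qed
    have ev_c: "eventually (\<lambda>k. (\<Sum>j<k. ln 2 + laplace_control t (eta (e j))) \<le> c * real k) sequentially"
    proof -
      have "eventually (\<lambda>k. (\<Sum>j<k. ln 2 + laplace_control t (eta (e j))) / real k < c) sequentially"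
        by (rule order_tendstoD(2)[OF elim(6)]) (simp add: c_def)
      then show ?thesis
        using eventually_gt_at_top[of 0] by eventually_elim (simp add: pos_divide_less_eq)
    qed
    have "AE w in tree_law (\<lambda>n. eta (e n)). eventually (\<lambda>n. exp (n * (L - \<epsilon> / 2)) < partition_sum t n w) sequentially"
    proof (rule AE_partition_sum_lower[where m = "\<lambda>k. mu (eta (e k))" and G = G
          and s = "\<lambda>k. \<integral>x. spine.total t x \<partial>eta (e k)" and A = "real i" and K = K and \<gamma> = \<gamma>
          and a = "1 / real (Suc i)" and b = "1 / (4 * (4 * real (Suc i)) powr (1 / (p - 1)))"
          and ?c1.0 = c and ?c2.0 = c])
      show "mark_laws (\<lambda>n. eta (e n))" by (rule \<kappa>)
      show "AE x in eta (e k). 1 \<le> fst x" for k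
        using ml by (rule mark_law.offspring)
      show "0 < mu (eta (e k))" for k by (rule mark(2)[OF ml])
      show "integrable (eta (e k)) (spine.total t)" for k using ml by (rule mark_law.spine_integrable)
      show "1 / real (Suc i) \<le> measure (eta (e j)) {x. 2 \<le> fst x \<and> \<bar>snd x 1\<bar> \<le> real i}" if "j \<in> G" for j
        using that by (simp add: G_def F_def fertile_def funpow_shift)
      show "1 / (4 * (4 * real (Suc i)) powr (1 / (p - 1))) \<le> measure (tree_law (\<lambda>n. eta (e (Suc j + n))))
          {w. (\<Prod>l<n. mu (eta (e (Suc j + l)))) / 2 \<le> cut.Y K t n w}"
        if "j \<in> G" for j n
      proof (rule cut.survival_bound[OF _ p, where m = "\<lambda>l. mu (eta (e (Suc j + l)))" and H = "\<lambda>l. H e (Suc j + l)"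
            and \<alpha> = "\<lambda>l. al (eta (e (Suc j + l)))" and \<beta> = "\<lambda>l. be (eta (e (Suc j + l)))"])
        show "mark_laws (\<lambda>n. eta (e (Suc j + n)))" by (rule mark_laws_shift[OF \<kappa>])
        show "integrable (eta (e (Suc j + k))) (cut.total K t)" for k
          by (rule mark_law.cut_integrable[OF ml])
        show "(\<integral>x. cut.total K t x \<partial>eta (e (Suc j + k))) = mu (eta (e (Suc j + k)))" for k
          by (simp add: mu_def cut_mean_def)
        show "0 < mu (eta (e (Suc j + k)))" for k by (rule mark(2)[OF ml])
        show "(\<integral>\<^sup>+x. ennreal (cut.powr_total K t p x) \<partial>eta (e (Suc j + k))) \<le> ennreal (al (eta (e (Suc j + k))))" for k
          unfolding al_def by (rule mark_law.cut_powr_mean[OF ml])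
        show "0 \<le> al (eta (e (Suc j + k)))" for k using mark(1)[OF ml] by (rule less_imp_le)
        show "(\<integral>\<^sup>+x. ennreal (cut.total K t x powr p) \<partial>eta (e (Suc j + k))) \<le> ennreal (be (eta (e (Suc j + k))))" for k
          unfolding be_def al_def by (rule mark_law.cut_total_powr_mean[OF ml p])
        show "0 \<le> be (eta (e (Suc j + k)))" for k using mark(3)[OF ml] by (rule less_imp_le)
        show "1 \<le> H e (Suc j + k)" for k by (rule H_ge)
        show "al (eta (e (Suc j + k))) * H e (Suc j + Suc k) + be (eta (e (Suc j + k))) \<le>
            H e (Suc j + k) * mu (eta (e (Suc j + k))) powr p" for k
          using H_step[of "Suc j + k"] by simp
        show "H e (Suc j + 0) \<le> real (Suc i)"
          using that H_shift[of j] by (simp add: G_def F_def fertile_def)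
      qed
      show "eventually (\<lambda>k. \<gamma> * real k \<le> real (card {j. j < k \<and> j \<in> G})) sequentially"
      proof -
        have "eventually (\<lambda>n. \<gamma> < (\<Sum>k<n. indicator F ((shift ^^ k) e)) / real n) sequentially"
          by (rule order_tendstoD(1)[OF elim(7)]) (use \<gamma> in \<open>simp add: \<gamma>_def\<close>)
        then show ?thesis
          using eventually_gt_at_top[of 0]
        proof eventually_elim
          case (elim n)
          have "(\<Sum>k<n. indicator F ((shift ^^ k) e)) = (\<Sum>k<n. indicator G k :: real)"
            by (rule sum.cong) (auto simp: G_def indicator_def)
          also have "\<dots> = real (card ({..<n} \<inter> G))" 
            unfolding indicator_def of_bool_def by (simp add: sum.If_cases)
          also have "{..<n} \<inter> G = {j. j < n \<and> j \<in> G}" by auto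
          finally show ?case using elim by (simp add: pos_less_divide_eq)
        qed
      qed
      show "(\<lambda>n. (\<Sum>k<n. ln (mu (eta (e k)))) / real n) \<longlonglongrightarrow> L"
        using elim(5) by (simp add: L_def mu_def)
      show "eventually (\<lambda>k. (\<Prod>i<k. \<integral>x. spine.total t x \<partial>eta (e i)) \<le> exp (c * real k)) sequentially"
        using ev_c
      proof eventually_elim
        case (elim k)
        have "(\<Prod>i<k. \<integral>x. spine.total t x \<partial>eta (e i)) \<le> (\<Prod>i<k. exp (ln 2 + laplace_control t (eta (e i))))"
          by (intro prod_mono conjI control integral_nonneg_AE) (simp add: spine.total_nonneg del: One_nat_def)
        also have "\<dots> = exp (\<Sum>i<k. ln 2 + laplace_control t (eta (e i)))" by (rule exp_sum[symmetric]) simp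
        also have "\<dots> \<le> exp (c * real k)" using elim by simp
        finally show ?case .
      qed
      show "eventually (\<lambda>k. (\<Sum>i<k. \<bar>ln (mu (eta (e i)))\<bar>) \<le> c * real k) sequentially"
        using ev_c
      proof eventually_elim
        case (elim k)
        have "(\<Sum>i<k. \<bar>ln (mu (eta (e i)))\<bar>) \<le> (\<Sum>i<k. ln 2 + laplace_control t (eta (e i)))"
          by (intro sum_mono control)
        also have "\<dots> \<le> c * real k" by (rule elim)
        finally show ?case .
      qed
    qed (use \<gamma> \<epsilon> in auto)
    then show ?case
      unfolding quenched_eq_tree_law
    proof eventually_elim
      case (elim w)
      then show ?case
      proof eventually_elim
        case (elim n)
        \<comment> \<open>Truncation costs one half of \<open>\<epsilon>\<close>, the estimate for
          the truncated tree the other.\<close>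
        have "real n * (free_energy nu eta t - \<epsilon>) \<le> real n * (L - \<epsilon> / 2)"
          using L(1) by (intro mult_left_mono) auto
        then have "exp (real n * (free_energy nu eta t - \<epsilon>)) \<le> exp (real n * (L - \<epsilon> / 2))" by simp
        then show ?case using elim by (rule le_less_trans)
      qed
    qed
  qed
qed

end

section \<open>Positions of the extreme particles\<close>

text \<open>\<open>generation\<close> grows at the leaves whereas \<open>weight_sum\<close> recurses
  at the root; this identity connects the two.\<close>

lemma generation_Suc_root:
  "generation w (Suc n) = (\<Union>i<offspring w []. (\<lambda>v. i # v) ` generation (subtree w [i]) n)"
proof (induction n)
  case (Suc n)
  have off: "offspring w (i # v) = offspring (subtree w [i]) v" for i v
    by (simp add: offspring_def subtree_def)
  have "generation w (Suc (Suc n)) = {u @ [j] |u j. u \<in> generation w (Suc n) \<and> j < offspring w u}"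
    by simp
  also have "\<dots> = (\<Union>i<offspring w []. (\<lambda>v. i # v) ` generation (subtree w [i]) (Suc n))"
    unfolding Suc.IH by (fastforce simp: off)
  finally show ?case .
qed auto

lemma position_Cons: "position w (i # v) = displacement w [] i + position (subtree w [i]) v"
  unfolding position_def length_Cons
  by (subst sum.lessThan_Suc_shift) (simp add: displacement_def subtree_def)

lemma partition_sum_generation:
  "partition_sum t n w = (\<Sum>u\<in>generation w n. exp (t * position w u))"
proof (induction n arbitrary: w)
  case (Suc n)
  have "(\<Sum>u\<in>generation w (Suc n). exp (t * position w u)) =
      (\<Sum>i<offspring w []. \<Sum>u\<in>(\<lambda>v. i # v) ` generation (subtree w [i]) n. exp (t * position w u))"
    unfolding generation_Suc_root by (rule sum.UNION_disjoint) (auto simp: finite_generation)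
  also have "\<dots> = (\<Sum>i<offspring w []. \<Sum>v\<in>generation (subtree w [i]) n. exp (t * position w (i # v)))"
    by (rule sum.cong[OF refl], subst sum.reindex) (auto simp: inj_on_def)
  also have "\<dots> = partition_sum t (Suc n) w"
    by (simp add: Suc.IH position_Cons distrib_left exp_add sum_distrib_left offspring_def
        displacement_def exp_weight_def)
  finally show ?case by simp
qed simp

lemma generation_nonempty:
  assumes "\<And>u. 1 \<le> offspring w u"
  shows "generation w n \<noteq> {}"
proof (induction n)
  case (Suc n)
  then obtain u where "u \<in> generation w n" by blast
  then have "u @ [0] \<in> generation w (Suc n)" using assms[of u] by auto
  then show ?case by blast
qed simp

lemma partition_sum_pos:
  assumes "\<And>u. 1 \<le> offspring w u"
  shows "0 < partition_sum t n w"
  unfolding partition_sum_generation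
  by (rule sum_pos[OF finite_generation generation_nonempty[OF assms]]) auto

text \<open>The sign of \<open>b\<close> is free: positive increments are controlled by the
  rightmost particle, negative ones by the leftmost.\<close>

lemma partition_sum_tilt:
  assumes off: "\<And>u. 1 \<le> offspring w u"
    and M: "\<And>u. u \<in> generation w n \<Longrightarrow> b * position w u \<le> M"
  shows "ln (partition_sum (a + b) n w) - ln (partition_sum a n w) \<le> M"
proof -
  have "partition_sum (a + b) n w \<le> (\<Sum>u\<in>generation w n. exp M * exp (a * position w u))"
    unfolding partition_sum_generation
    using M by (intro sum_mono) (simp add: exp_add[symmetric] distrib_right)
  also have "\<dots> = exp M * partition_sum a n w"
    by (simp add: partition_sum_generation sum_distrib_left)
  finally have "ln (partition_sum (a + b) n w) \<le> ln (exp M * partition_sum a n w)"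
    using partition_sum_pos[OF off] by (subst ln_le_cancel_iff) auto
  also have "\<dots> = M + ln (partition_sum a n w)"
    using partition_sum_pos[OF off, of a n] by (simp add: ln_mult)
  finally show ?thesis by simp
qed

lemma le_ln_partition_sum:
  assumes "u \<in> generation w n"
  shows "t * position w u \<le> ln (partition_sum t n w)"
proof -
  have "exp (t * position w u) \<le> partition_sum t n w"
    unfolding partition_sum_generation
    using assms by (intro member_le_sum) (auto simp: finite_generation)
  moreover from this have "0 < partition_sum t n w" by (rule less_le_trans[OF exp_gt_zero])
  ultimately show ?thesis by (simp add: ln_ge_iff)
qed

context convex_free_energy
begin

lemma speed_of_extremes:
  assumes off: "\<And>u. 1 \<le> offspring w u"
    and upper: "\<And>t \<epsilon>. t \<in> \<rat> \<Longrightarrow> 0 < \<epsilon> \<Longrightarrow>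
      eventually (\<lambda>n. ln (partition_sum t n w) \<le> n * (\<Lambda> t + \<epsilon>)) sequentially"
    and lower: "\<And>t \<epsilon>. t \<in> \<rat> \<Longrightarrow> \<rho> t < 0 \<Longrightarrow> 0 < \<epsilon> \<Longrightarrow>
      eventually (\<lambda>n. n * (\<Lambda> t - \<epsilon>) \<le> ln (partition_sum t n w)) sequentially"
  shows "(\<lambda>n. ereal (leftmost w n / real n)) \<longlonglongrightarrow> extended_deriv \<Lambda> (t_minus \<Lambda>)"
    and "(\<lambda>n. ereal (rightmost w n / real n)) \<longlonglongrightarrow> extended_deriv \<Lambda> (t_plus \<Lambda>)"
proof -
  have fin: "finite (position w ` generation w n)" and ne: "position w ` generation w n \<noteq> {}" for n
    using finite_generation generation_nonempty[OF off] by auto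
  show "(\<lambda>n. ereal (rightmost w n / real n)) \<longlonglongrightarrow> extended_deriv \<Lambda> (t_plus \<Lambda>)"
  proof (rule speed_limit[where z = "\<lambda>t n. partition_sum t n w"])
    show "t * rightmost w n \<le> ln (partition_sum t n w)" for t n
      using Max_in[OF fin ne, of n] le_ln_partition_sum by (auto simp: rightmost_def)
    show "ln (partition_sum s n w) - ln (partition_sum t n w) \<le> (s - t) * rightmost w n"
      if "0 < t" "t < s" for t s n
      using partition_sum_tilt[OF off, of n "s - t" "(s - t) * rightmost w n" t] Max_ge[OF fin] that
      by (simp add: rightmost_def mult_left_mono)
  qed (use upper lower in auto)
  interpret r: convex_free_energy "\<lambda>t. \<Lambda> (- t)" "\<lambda>t. - d (- t)"
    by (rule convex_free_energy_reflect) (unfold_locales)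
  have "(\<lambda>n. ereal (- leftmost w n / real n)) \<longlonglongrightarrow> extended_deriv (\<lambda>t. \<Lambda> (- t)) (t_plus (\<lambda>t. \<Lambda> (- t)))"
  proof (rule r.speed_limit[where z = "\<lambda>t n. partition_sum (- t) n w"])
    show "t * - leftmost w n \<le> ln (partition_sum (- t) n w)" for t n
      using Min_in[OF fin ne, of n] le_ln_partition_sum[of _ w n "- t"] by (auto simp: leftmost_def)
    show "ln (partition_sum (- s) n w) - ln (partition_sum (- t) n w) \<le> (s - t) * - leftmost w n"
      if "0 < t" "t < s" for t s n
    proof -
      have "(t - s) * position w u \<le> (s - t) * - leftmost w n" if "u \<in> generation w n" for u
      proof -
        have "leftmost w n \<le> position w u" using Min_le[OF fin] that by (simp add: leftmost_def)
        then have "(s - t) * leftmost w n \<le> (s - t) * position w u"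
          using \<open>t < s\<close> by (intro mult_left_mono) auto
        then show ?thesis by (simp add: algebra_simps)
      qed
      from partition_sum_tilt[where b = "t - s" and a = "- t", OF off this] show ?thesis by simp
    qed
    show "eventually (\<lambda>n. real n * (\<Lambda> (- t) - \<epsilon>) \<le> ln (partition_sum (- t) n w)) sequentially"
      if "t \<in> \<rat>" "r.\<rho> t < 0" "0 < \<epsilon>" for t \<epsilon>
      using that by (intro lower) (auto simp: \<rho>_def r.\<rho>_def)
  qed (use upper in auto)
  from tendsto_uminus_ereal[OF this]
  show "(\<lambda>n. ereal (leftmost w n / real n)) \<longlonglongrightarrow> extended_deriv \<Lambda> (t_minus \<Lambda>)"
    by (simp add: extended_deriv_t_minus)
qed

end

section \<open>Exceptional null sets and the passage to the annealed law\<close>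

context brw_env
begin

text \<open>Countably many parameters and margins are collected into one event depending on the walk
  alone. Being stated through strict inequalities of measurable sums, it is measurable, which the
  passage from quenched to annealed null sets requires.\<close>

lemma AE_partition_sums:
  "AE (e, w) in annealed nu eta. (\<forall>u. 1 \<le> offspring w u) \<and> (\<forall>(q :: rat) (j :: nat).
    eventually (\<lambda>n. partition_sum (of_rat q) n w <
      exp (n * (free_energy nu eta (of_rat q) + 1 / Suc j))) sequentially \<and>
    (\<Lambda>.\<rho> (of_rat q) < 0 \<longrightarrow> eventually (\<lambda>n. exp (n * (free_energy nu eta (of_rat q) - 1 / Suc j)) <
      partition_sum (of_rat q) n w) sequentially))"
  (is "AE (e, w) in _. ?off w \<and> (\<forall>q j. ?U q j w \<and> (?gap q \<longrightarrow> ?L q j w))")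
proof -
  have [measurable]: "(\<lambda>w :: marking. w u) \<in> marking_space \<rightarrow>\<^sub>M mark_space" for u
    by (rule measurable_eval_marking)
  have [measurable]: "(\<lambda>w. offspring w u) \<in> marking_space \<rightarrow>\<^sub>M count_space UNIV" for u
    unfolding offspring_def by measurable
  have off: "AE e in nu. AE w in quenched eta e. ?off w"
    using AE_mark_law AE_space
  proof eventually_elim
    case (elim e)
    have "AE w in tree_law (\<lambda>n. eta (e n)). 1 \<le> fst (w u)" for u :: "nat list"
      unfolding tree_law_def
    proof (rule AE_PiM_component)
      show "AE x in eta (e (length u)). 1 \<le> fst x"
        using elim(1) mark_law.offspring by blast
    qed (use mark_laws_prob[OF mark_laws_eta[OF elim(2)]] in auto)
    then show ?case
      unfolding quenched_eq_tree_law offspring_def by (simp only: AE_all_countable) blast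
  qed
  have bounds: "AE e in nu. AE w in quenched eta e. ?U q j w \<and> (?gap q \<longrightarrow> ?L q j w)" for q j
  proof (cases "?gap q")
    case True
    show ?thesis
      using AE_quenched_upper[of "1 / real (Suc j)" "of_rat q"]
        AE_quenched_lower[OF True, of "1 / real (Suc j)"]
      by (simp del: of_nat_Suc)
  next
    case False
    show ?thesis
      using AE_quenched_upper[of "1 / real (Suc j)" "of_rat q"] False by (simp del: of_nat_Suc)
  qed
  have bounds_all: "AE e in nu. AE w in quenched eta e. \<forall>q j. ?U q j w \<and> (?gap q \<longrightarrow> ?L q j w)"
    unfolding AE_all_countable using bounds by blast
  have meas: "Measurable.pred (nu \<Otimes>\<^sub>M marking_space)
      (\<lambda>(e, w). ?off w \<and> (\<forall>q j. ?U q j w \<and> (?gap q \<longrightarrow> ?L q j w)))"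
    unfolding split_beta' eventually_sequentially by measurable
  show ?thesis
    unfolding AE_annealed_iff[OF env kernel meas] split_conv
    using off bounds_all by eventually_elim (rule AE_conjI)
qed

lemma speeds:
  assumes off: "\<And>u. 1 \<le> offspring w u"
    and U: "\<And>q j. eventually (\<lambda>n. partition_sum (of_rat q) n w <
      exp (n * (free_energy nu eta (of_rat q) + 1 / Suc j))) sequentially"
    and L: "\<And>q j. \<Lambda>.\<rho> (of_rat q) < 0 \<Longrightarrow> eventually (\<lambda>n. exp (n * (free_energy nu eta (of_rat q) - 1 / Suc j)) <
      partition_sum (of_rat q) n w) sequentially"
  shows "(\<lambda>n. ereal (leftmost w n / real n)) \<longlonglongrightarrow> extended_deriv (free_energy nu eta) (t_minus (free_energy nu eta))
    \<and> (\<lambda>n. ereal (rightmost w n / real n)) \<longlonglongrightarrow> extended_deriv (free_energy nu eta) (t_plus (free_energy nu eta))"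
proof -
  have upper: "eventually (\<lambda>n. ln (partition_sum t n w) \<le> n * (free_energy nu eta t + \<epsilon>)) sequentially"
    if t: "t \<in> \<rat>" and \<epsilon>: "0 < \<epsilon>" for t \<epsilon> :: real
  proof -
    obtain q where q: "t = of_rat q" using t by (rule Rats_cases)
    obtain j where j: "1 / real (Suc j) < \<epsilon>" using nat_approx_posE[OF \<epsilon>] by blast
    show ?thesis
      using U[of q j]
    proof eventually_elim
      case (elim n)
      have "ln (partition_sum t n w) \<le> ln (exp (n * (free_energy nu eta t + 1 / Suc j)))"
        using elim partition_sum_pos[OF off, of t n] q by (subst ln_le_cancel_iff) auto
      also have "\<dots> \<le> n * (free_energy nu eta t + \<epsilon>)"
        using j by (auto intro!: mult_left_mono)
      finally show ?case .
    qed
  qed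
  have lower: "eventually (\<lambda>n. n * (free_energy nu eta t - \<epsilon>) \<le> ln (partition_sum t n w)) sequentially"
    if t: "t \<in> \<rat>" and gap: "\<Lambda>.\<rho> t < 0" and \<epsilon>: "0 < \<epsilon>" for t \<epsilon> :: real
  proof -
    obtain q where q: "t = of_rat q" using t by (rule Rats_cases)
    obtain j where j: "1 / real (Suc j) < \<epsilon>" using nat_approx_posE[OF \<epsilon>] by blast
    show ?thesis
      using L[of q j, folded q, OF gap]
    proof eventually_elim
      case (elim n)
      have "n * (free_energy nu eta t - \<epsilon>) \<le> ln (exp (n * (free_energy nu eta t - 1 / Suc j)))"
        using j by (auto intro!: mult_left_mono)
      also have "\<dots> \<le> ln (partition_sum t n w)"
        using elim partition_sum_pos[OF off, of t n] by (subst ln_le_cancel_iff) auto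
      finally show ?case .
    qed
  qed
  show ?thesis
    using \<Lambda>.speed_of_extremes[OF off upper lower] by blast
qed

end

theorem theorem3p4:
  fixes Theta :: "'th measure"
    and nu :: "(nat \<Rightarrow> 'th) measure"
    and eta :: "'th \<Rightarrow> (nat \<times> (nat \<Rightarrow> real)) measure"
  assumes env: "stationary_ergodic Theta nu"
    and kernel: "eta \<in> Theta \<rightarrow>\<^sub>M prob_algebra mark_space"
    and mean_finite: "AE e in nu. integrable (quenched eta e) (\<lambda>w. real (offspring w []))"
    and log_mean: "integrable nu (\<lambda>e. ln (mean_offspring eta e))"
      "(\<integral>e. ln (mean_offspring eta e) \<partial>nu) > 0"
    and N_log_N: "integrable (annealed nu eta)
      (\<lambda>(e, w). real (offspring w []) / mean_offspring eta e * max 0 (ln (real (offspring w []))))"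
    and N_ge_1: "AE (e, w) in annealed nu eta. offspring w [] \<ge> 1"
    and L_1: "integrable (annealed nu eta) (\<lambda>(e, w). displacement w [] 0)"
    and laplace_finite: "\<And>t. AE e in nu. integrable (quenched eta e) (\<lambda>w. exp_sum w t)"
    and log_laplace: "\<And>t. integrable nu (\<lambda>e. ln (laplace_mean eta e t))"
    and log_deriv: "\<And>t. integrable nu (\<lambda>e. deriv (laplace_mean eta e) t / laplace_mean eta e t)"
  defines "\<Lambda> \<equiv> free_energy nu eta"
  shows "AE (e, w) in annealed nu eta.
    (\<lambda>n. ereal (leftmost w n / real n)) \<longlonglongrightarrow> extended_deriv \<Lambda> (t_minus \<Lambda>) \<and>
    (\<lambda>n. ereal (rightmost w n / real n)) \<longlonglongrightarrow> extended_deriv \<Lambda> (t_plus \<Lambda>)"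
proof -
  \<comment> \<open>At parameter 0 the exponential sum counts the children, so the free energy there
    is the mean of log m_0.\<close>
  have "laplace_mean eta e 0 = mean_offspring eta e" for e
    by (simp add: laplace_mean_def mean_offspring_def exp_sum_def)
  then have "0 < free_energy nu eta 0"
    using log_mean(2) by (simp add: free_energy_def)
  then interpret brw_env Theta nu eta
    by unfold_locales (use env kernel N_ge_1 laplace_finite log_laplace in auto)
  show ?thesis
    using AE_partition_sums unfolding \<Lambda>_def split_beta'
    by eventually_elim (rule speeds, blast+)
qed

end
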